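(* For almost every real $a>1$ (with respect to Lebesgue measure) and every sufficiently large integer $K$ that is a power of two (how large may depend on $a$), there are a squarefree integer $Q_K\ge2$ and an integer $b_K$ such that $$\gcd\bigl(b_K-\lfloor a^m\rfloor,\,Q_K\bigr)>1\qquad\text{for all integers }1\le m\le K,$$ all prime divisors of $Q_K$ are at most $8K$, and $$\log Q_K=o(K)$$ as $K$ tends to infinity through powers of two.
   Context: $\lfloor x\rfloor$ is the greatest integer not exceeding $x$. The base $a$ is fixed while $K\to\infty$; $Q_K$ and $b_K$ may depend on $a$ and $K$, and the rate in $o(K)$ may depend on $a$. *)

theory Defs
  imports "HOL-Analysis.Analysis" "HOL-Computational_Algebra.Squarefree" "HOL-Library.Landau_Symbols"
begin

end

theory Submission
  imports Defs "HOL-Probability.Probability" "HOL-Number_Theory.Number_Theory" "HOL-Real_Asymp.Real_Asymp"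
begin

text \<open>
  Fix \<open>K = 2 ^ j\<close>. A modulus is built from a finite set of distinct primes \<open>q \<le> 8 * K\<close> with one
  residue \<open>r q\<close> for each: the Chinese remainder theorem gives \<open>b\<close> with \<open>b \<equiv> r q (mod q)\<close> for all of
  them, and the gcd condition holds at \<open>m\<close> as soon as \<open>\<lfloor>a ^ m\<rfloor> \<equiv> r q (mod q)\<close> for one of the primes;
  then \<open>q\<close> is said to cover \<open>m\<close>. So the exponents \<open>1 \<le> m \<le> K\<close> have to be covered by primes whose
  logarithms add up to \<open>o(K)\<close>.

  The primes \<open>q\<close> with \<open>j ^ 3 < q \<le> 2 ^ (j div 2)\<close> form a sieve. They contribute only about \<open>sqrt K\<close>
  to the logarithm, and random residues for them leave a proportion \<open>W = (\<Prod>q. 1 - 1 / q)\<close> of the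
  exponents uncovered, where \<open>W\<close> is of order \<open>(log j) / j\<close>. A private prime for each remaining
  exponent, of logarithm about \<open>j\<close>, would still cost about \<open>K * log j\<close>. The saving comes from large
  primes \<open>p\<close> between \<open>K / j\<close> and \<open>8 * K\<close> that each cover \<open>M\<close> survivors of the sieve at once, where
  \<open>M\<close> is about \<open>j powr (1/4)\<close>: then about \<open>K / j powr (17/16)\<close> large primes cover all but a
  proportion \<open>O(1 / j)\<close> of the survivors, and the rest can be given private primes.

  To find residues modulo \<open>p\<close> that cover \<open>M\<close> survivors, the exponents are split into \<open>G = j ^ 3\<close>
  arithmetic progressions with difference \<open>G\<close>, called classes, and every class receives its own
  block of large primes. Along a class \<open>a ^ m\<close> grows so fast from one member to the next that, for
  \<open>a\<close> uniform in an interval, the residues of \<open>\<lfloor>a ^ m\<rfloor>\<close> modulo any \<open>d \<le> (8 * K) ^ (10 * j)\<close> are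
  almost independent and uniform (\<open>interval_residues_measure_le\<close>). The reason is that the level sets
  of \<open>\<lfloor>a ^ m\<rfloor>\<close> are short intervals of slowly decreasing length, which fill those of the previous
  member up to the two end pieces. First and second moments therefore show that outside a set of \<open>a\<close>
  of probability at most \<open>2 powr (-j/4)\<close> no two members of a class agree modulo \<open>10 * j\<close> primes up
  to \<open>8 * K\<close> (\<open>prob_many_common_primes\<close>), and that the residue classes modulo large primes that
  contain exactly \<open>M\<close> members, the full bins, have the expected number and are spread evenly over
  the members (\<open>prob_irregular_full_bins\<close>).

  For such \<open>a\<close> the residues of the sieve primes are chosen at random. A set of at most \<open>2 * M\<close>
  members of a class survives with probability close to \<open>W\<close> to the power of its size
  (\<open>survival_probability_bounds\<close>), and second moments show that most survivors lie in about the
  expected number of surviving full bins. Choosing for each large prime at most one surviving full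
  bin, all with the same probability, leaves few survivors uncovered on average (\<open>avg_uncovered\<close>,
  \<open>exists_good_edge_choice\<close>). The bound is in \<open>good_modulus_eventually\<close>; the exceptional measures
  are summable over \<open>j\<close>, so the Borel--Cantelli lemma gives the claim for almost every \<open>a\<close>.
\<close>

section \<open>Products and counts of primes\<close>

text \<open>One half of Euler's product formula, by induction on \<open>A\<close> without infinite series: a number
  with all prime factors in \<open>insert q A\<close> either has them all in \<open>A\<close>, or is \<open>q\<close> times a smaller
  number of the same kind.\<close>

lemma smooth_sum_mult_euler_le_1:
  fixes A :: "nat set" and N :: nat
  assumes "finite A" "\<And>q. q \<in> A \<Longrightarrow> prime q"
  shows "(\<Sum>n | n \<in> {1..N} \<and> prime_factors n \<subseteq> A. 1 / real n) * (\<Prod>q\<in>A. 1 - 1 / real q) \<le> 1"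
  using assms
proof (induction A rule: finite_induct)
  case empty
  have "{n. n \<in> {1..N} \<and> prime_factors n \<subseteq> {}} \<subseteq> {1}"
    by (auto simp: prime_factorization_empty_iff)
  then have "(\<Sum>n | n \<in> {1..N} \<and> prime_factors n \<subseteq> {}. 1 / real n) \<le> (\<Sum>n\<in>{1}. 1 / real n)"
    by (intro sum_mono2) auto
  then show ?case by simp
next
  case (insert q A)
  define S where "S = {n. n \<in> {1..N} \<and> prime_factors n \<subseteq> insert q A}"
  define S0 where "S0 = {n. n \<in> {1..N} \<and> prime_factors n \<subseteq> A}"
  have q: "prime q" and q1: "q \<ge> 2" using insert.prems prime_ge_2_nat by auto
  have fin: "finite S" "finite S0" by (auto simp: S_def S0_def)
  have sub: "S \<subseteq> S0 \<union> (\<lambda>m. q * m) ` S"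
  proof
    fix n assume n: "n \<in> S"
    show "n \<in> S0 \<union> (\<lambda>m. q * m) ` S"
    proof (cases "q dvd n")
      case False
      then have "q \<notin> prime_factors n" by auto
      then show ?thesis using n by (auto simp: S_def S0_def)
    next
      case True
      then obtain m where m: "n = q * m" by auto
      have "m dvd n" using m by simp
      moreover have "n \<noteq> 0" using n by (auto simp: S_def)
      ultimately have "prime_factors m \<subseteq> prime_factors n" by (rule dvd_prime_factors[rotated])
      moreover have "m \<ge> 1" "m \<le> n" using m \<open>n \<noteq> 0\<close> q1 by auto
      ultimately have "m \<in> S" using n unfolding S_def by (simp, blast)
      then show ?thesis using m by blast
    qed
  qed
  have inj: "inj_on (\<lambda>m. q * m) S" using q1 by (auto simp: inj_on_def)
  have "(\<Sum>n\<in>S. 1 / real n) \<le> (\<Sum>n\<in>S0 \<union> (\<lambda>m. q * m) ` S. 1 / real n)"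
    using fin sub by (intro sum_mono2) auto
  also have "\<dots> \<le> (\<Sum>n\<in>S0. 1 / real n) + (\<Sum>n\<in>(\<lambda>m. q * m) ` S. 1 / real n)"
    using sum.union_inter[of S0 "(\<lambda>m. q * m) ` S" "\<lambda>n. 1 / real n"] fin
      sum_nonneg[of "S0 \<inter> (\<lambda>m. q * m) ` S" "\<lambda>n. 1 / real n"] by simp
  also have "(\<Sum>n\<in>(\<lambda>m. q * m) ` S. 1 / real n) = (1 / q) * (\<Sum>n\<in>S. 1 / real n)"
    using inj by (simp add: sum.reindex sum_distrib_left)
  finally have "(\<Sum>n\<in>S. 1 / real n) * (1 - 1 / q) \<le> (\<Sum>n\<in>S0. 1 / real n)"
    by (simp add: algebra_simps)
  moreover have "0 \<le> (\<Prod>q\<in>A. 1 - 1 / real q)"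
    using insert.prems by (intro prod_nonneg) (auto dest!: prime_ge_1_nat simp: divide_simps)
  ultimately have "(\<Sum>n\<in>S. 1 / real n) * (1 - 1 / q) * (\<Prod>q\<in>A. 1 - 1 / real q)
     \<le> (\<Sum>n\<in>S0. 1 / real n) * (\<Prod>q\<in>A. 1 - 1 / real q)"
    by (rule mult_right_mono)
  also have "\<dots> \<le> 1" using insert by (auto simp: S0_def)
  finally show ?case using insert by (simp add: S_def mult.assoc)
qed

lemma euler_prod_upper:
  fixes N :: nat
  assumes "N \<ge> 2"
  shows "(\<Prod>q | prime q \<and> q \<le> N. 1 - 1 / real q) \<le> 1 / ln (real N)"
proof -
  let ?A = "{q. prime q \<and> q \<le> N}"
  have "prime_factors n \<subseteq> ?A" if "n \<in> {1..N}" for n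
  proof
    fix q assume "q \<in> prime_factors n"
    then have "prime q" "q dvd n" by auto
    then have "prime q" "q \<le> n" using that dvd_imp_le[of q n] by auto
    then show "q \<in> ?A" using that by simp
  qed
  then have "{n. n \<in> {1..N} \<and> prime_factors n \<subseteq> ?A} = {1..N}" by blast
  then have "(\<Sum>n\<in>{1..N}. 1 / real n) * (\<Prod>q\<in>?A. 1 - 1 / real q) \<le> 1"
    using smooth_sum_mult_euler_le_1[of ?A N] by (metis (no_types, lifting) finite_Collect_conjI finite_nat_set_iff_bounded_le mem_Collect_eq)
  moreover have "(\<Sum>n\<in>{1..N}. 1 / real n) \<ge> ln (real N)"
  proof -
    have "ln (real N) \<le> ln (real N + 1)" using assms by simp
    also have "\<dots> \<le> harm N" by (rule harm_ge_ln)
    finally show ?thesis by (simp add: harm_def divide_inverse)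
  qed
  moreover have "0 \<le> (\<Prod>q\<in>?A. 1 - 1 / real q)"
    by (intro prod_nonneg) (auto dest!: prime_ge_1_nat simp: divide_simps)
  ultimately have "ln (real N) * (\<Prod>q\<in>?A. 1 - 1 / real q) \<le> 1"
    by (meson mult_right_mono order_trans)
  moreover have "ln (real N) > 0" using assms by simp
  ultimately show ?thesis by (simp add: field_simps)
qed

lemma prod_primes_dvd:
  fixes n :: nat
  assumes "finite A" "\<And>p. p \<in> A \<Longrightarrow> prime p" "\<And>p. p \<in> A \<Longrightarrow> p dvd n"
  shows "\<Prod>A dvd n"
  using assms
proof (induction A rule: finite_induct)
  case (insert p A)
  have "coprime p (\<Prod>A)"
    by (rule prod_coprime_right) (use insert in \<open>auto intro!: primes_coprime\<close>)
  then show ?case using insert by (simp add: divides_mult)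
qed auto

text \<open>The primes in \<open>(N, 2 * N]\<close> all divide \<open>(2 * N) choose N\<close>, which is at most \<open>4 ^ N\<close>.\<close>

lemma card_primes_dyadic_block:
  assumes "i \<ge> 1"
  shows "real (card {p::nat. prime p \<and> 2 ^ i < p \<and> p \<le> 2 * 2 ^ i}) \<le> 2 * 2 ^ i / real i"
proof -
  define N :: nat where "N = 2 ^ i"
  let ?A = "{p. prime p \<and> N < p \<and> p \<le> 2 * N}"
  have fin: "finite ?A" by (rule finite_subset[of _ "{..2*N}"]) auto
  have "p dvd (2 * N) choose N" if p: "p \<in> ?A" for p
  proof -
    have "p dvd fact (2 * N)" using p by (simp add: prime_dvd_fact_iff)
    also have "fact (2 * N) = fact N * fact N * ((2 * N) choose N)"
      using binomial_fact_lemma[of N "2*N"] by (simp add: mult_2)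
    finally have "p dvd fact N \<or> p dvd ((2 * N) choose N)"
      using p by (auto simp: prime_dvd_mult_iff)
    moreover have "\<not> p dvd fact N" using p by (simp add: prime_dvd_fact_iff)
    ultimately show ?thesis by simp
  qed
  then have "\<Prod>?A dvd (2 * N) choose N" using fin by (intro prod_primes_dvd) auto
  then have "\<Prod>?A \<le> (2 * N) choose N" by (rule dvd_imp_le) auto
  also have "\<dots> \<le> 2 ^ (2 * N)" by (rule binomial_le_pow2)
  finally have "\<Prod>?A \<le> 2 ^ (2 * N)" .
  moreover have "N ^ card ?A \<le> \<Prod>?A"
    using prod_mono[of ?A "\<lambda>_. N" "\<lambda>p. p"] by (auto simp: prod_constant)
  ultimately have "(2::nat) ^ (i * card ?A) \<le> 2 ^ (2 * N)" by (simp add: N_def power_mult)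
  then have "i * card ?A \<le> 2 * N" by simp
  then have "real i * real (card ?A) \<le> 2 * real N" by (metis of_nat_le_iff of_nat_mult of_nat_numeral)
  then show ?thesis using assms by (simp add: N_def field_simps)
qed

text \<open>A bound of the form \<open>2 * ln I + O(1)\<close>. Mertens' theorem has \<open>ln I + O(1)\<close>; the factor \<open>2\<close>
  comes from the crude dyadic estimate and costs only a power of \<open>I\<close> in the applications.\<close>

lemma sum_inverse_primes_pow2_upper:
  assumes "I \<ge> 1"
  shows "(\<Sum>q | prime q \<and> q \<le> 2 ^ I. 1 / real q) \<le> 1 / 2 + 2 * harm (I - 1)"
  using assms
proof (induction I rule: dec_induct)
  case base
  have "{q::nat. prime q \<and> q \<le> 2} = {2}"
    by (auto dest: prime_ge_2_nat)
  then show ?case by (simp add: harm_def)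
next
  case (step i)
  let ?B = "{p::nat. prime p \<and> 2 ^ i < p \<and> p \<le> 2 * 2 ^ i}"
  have eq: "{q::nat. prime q \<and> q \<le> 2 ^ Suc i} = {q. prime q \<and> q \<le> 2 ^ i} \<union> ?B" by auto
  have "finite {q::nat. prime q \<and> q \<le> 2 ^ i}" "finite ?B"
    by (auto intro: finite_subset[of _ "{..2 * 2 ^ i}"] finite_subset[of _ "{..2 ^ i}"])
  then have "(\<Sum>q | prime q \<and> q \<le> 2 ^ Suc i. 1 / real q)
      = (\<Sum>q | prime q \<and> q \<le> 2 ^ i. 1 / real q) + (\<Sum>q\<in>?B. 1 / real q)"
    unfolding eq by (subst sum.union_disjoint) auto
  also have "(\<Sum>q\<in>?B. 1 / real q) \<le> (\<Sum>q\<in>?B. 1 / 2 ^ i)"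
  proof (intro sum_mono)
    fix q assume "q \<in> ?B"
    then have "2 ^ i \<le> q" by simp
    then have "real (2 ^ i) \<le> real q" by (rule of_nat_mono)
    moreover have "q > 0" using \<open>q \<in> ?B\<close> by (simp add: prime_gt_0_nat)
    ultimately show "1 / real q \<le> 1 / 2 ^ i" by (intro divide_left_mono) auto
  qed
  also have "\<dots> = real (card ?B) / 2 ^ i" by simp
  also have "\<dots> \<le> (2 * 2 ^ i / real i) / 2 ^ i"
    using card_primes_dyadic_block[of i] step by (intro divide_right_mono) auto
  also have "\<dots> = 2 / real i" by simp
  finally have "(\<Sum>q | prime q \<and> q \<le> 2 ^ Suc i. 1 / real q) \<le> 1 / 2 + 2 * harm (i - 1) + 2 / real i"
    using step.IH by linarith
  moreover have "harm (Suc i - 1) = harm (i - 1) + 1 / real i"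
    using step.hyps harm_Suc[of "i - 1", where 'a = real] by (simp add: divide_inverse)
  ultimately show ?case by (simp add: algebra_simps)
qed

lemma harm_upper: "n \<ge> 1 \<Longrightarrow> harm n \<le> 1 + ln (real n)"
proof (induction n rule: dec_induct)
  case base show ?case by (simp add: harm_def)
next
  case (step n)
  have "1 / real (Suc n) \<le> ln (real (Suc n)) - ln (real n)"
  proof -
    have "ln (real n / real (Suc n)) \<le> real n / real (Suc n) - 1"
      using step by (intro ln_le_minus_one) auto
    also have "\<dots> = - (1 / real (Suc n))" by (simp add: field_simps)
    finally show ?thesis using step by (simp add: ln_div)
  qed
  then show ?case using step by (simp add: harm_Suc divide_inverse)
qed

lemma one_minus_ge_exp:
  fixes x :: real
  assumes "0 \<le> x" "x \<le> 1 / 2"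
  shows "exp (- 2 * x) \<le> 1 - x"
proof -
  have "exp (2 * x) \<ge> 1 + 2 * x" by simp
  moreover have "(1 - x) * (1 + 2 * x) \<ge> 1"
    using mult_left_mono[of x "1/2" x] assms by (simp add: algebra_simps)
  moreover have "(1 - x) * (1 + 2 * x) \<le> (1 - x) * exp (2 * x)"
    using assms by (intro mult_left_mono) auto
  ultimately have "(1 - x) * exp (2 * x) \<ge> 1" by linarith
  then show ?thesis by (simp add: exp_minus field_simps)
qed

lemma euler_prod_lower:
  assumes "I \<ge> 2"
  shows "(\<Prod>q | prime q \<and> q \<le> 2 ^ I. 1 - 1 / real q) \<ge> exp (- 5) / real I ^ 4"
proof -
  let ?A = "{q::nat. prime q \<and> q \<le> 2 ^ I}"
  have "(\<Sum>q\<in>?A. 1 / real q) \<le> 1 / 2 + 2 * harm (I - 1)"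
    using sum_inverse_primes_pow2_upper[of I] assms by simp
  also have "harm (I - 1) \<le> 1 + ln (real (I - 1))" using assms by (intro harm_upper) auto
  also have "ln (real (I - 1)) \<le> ln (real I)" using assms by simp
  finally have le: "(\<Sum>q\<in>?A. 1 / real q) \<le> 5 / 2 + 2 * ln (real I)" by simp
  have "exp (- 5) / real I ^ 4 = exp (- 5 - 4 * ln (real I))"
    using assms exp_of_nat_mult[of 4 "ln (real I)"] by (simp add: exp_diff)
  also have "\<dots> \<le> exp (\<Sum>q\<in>?A. - 2 * (1 / real q))"
    using le by (simp only: sum_distrib_left[symmetric] exp_le_cancel_iff)
  also have "\<dots> = (\<Prod>q\<in>?A. exp (- 2 * (1 / real q)))"
    by (rule exp_sum) (rule finite_subset[of _ "{..2 ^ I}"], auto)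
  also have "\<dots> \<le> (\<Prod>q\<in>?A. 1 - 1 / real q)"
    by (intro prod_mono conjI one_minus_ge_exp) (auto dest!: prime_ge_2_nat simp: field_simps)
  finally show ?thesis .
qed

text \<open>The reciprocals of \<open>k * (n choose k)\<close> form the Leibniz harmonic triangle, in which every entry
  is a difference of two entries with smaller \<open>k\<close>. The first entries \<open>1 / n\<close> become integers after
  multiplication by the least common multiple, hence so do all the others.\<close>

lemma leibniz_dvd_Lcm:
  assumes "1 \<le> k" "k \<le> n" "n \<le> N"
  shows "k * (n choose k) dvd Lcm {1..N}"
proof -
  define L where "L = real (Lcm {1..N::nat})"
  define T where "T n k = L / (real k * real (n choose k))" for n k :: nat
  have rec: "T (Suc n) (Suc k) = T n k - T (Suc n) k" if "1 \<le> k" "k \<le> n" for n k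
  proof -
    define c where "c = real (n choose k)"
    have c: "c > 0" using that by (simp add: c_def)
    have 1: "real (Suc k) * real (Suc n choose Suc k) = real (Suc n) * c"
      using Suc_times_binomial_eq[of n k] unfolding c_def by (metis mult.commute of_nat_mult)
    have 2: "real (Suc n - k) * real (Suc n choose k) = real (Suc n) * c"
      using binomial_absorb_comp[of "Suc n" k] unfolding c_def by (metis diff_Suc_1 of_nat_mult)
    have d: "real (Suc n - k) = real n - real k + 1" using that by (simp add: of_nat_diff)
    have 3: "real (Suc n choose k) = real (Suc n) * c / (real n - real k + 1)"
      using 2 that unfolding d by (simp add: field_simps)
    show ?thesis unfolding T_def 1 unfolding 3 using that c
      by (simp add: c_def[symmetric] divide_simps) (simp add: algebra_simps)
  qed
  have "T n k \<in> \<int>" if "1 \<le> k" "k \<le> n" "n \<le> N" for n k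
    using that
  proof (induction k arbitrary: n rule: dec_induct)
    case base
    then have "n dvd Lcm {1..N}" by (intro dvd_Lcm) auto
    then obtain m where "Lcm {1..N} = n * m" by auto
    then have "T n 1 = real m" using base by (simp add: T_def L_def)
    then show ?case by simp
  next
    case (step k)
    obtain n' where n: "n = Suc n'" using step by (cases n) auto
    have "T n (Suc k) = T n' k - T n k" unfolding n by (rule rec) (use step n in auto)
    moreover have "T n' k \<in> \<int>" "T n k \<in> \<int>" using step n by auto
    ultimately show ?case by simp
  qed
  then have "T n k \<in> \<int>" using assms by simp
  then obtain z :: int where z: "T n k = of_int z" by (auto elim: Ints_cases)
  have "k * (n choose k) > 0" using assms by simp
  then have "L = of_int z * real (k * (n choose k))" using z by (simp add: T_def field_simps)
  then have "of_int (int (Lcm {1..N})) = (of_int (z * int (k * (n choose k))) :: real)"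
    by (simp add: L_def)
  then have "int (Lcm {1..N}) = z * int (k * (n choose k))" by (simp only: of_int_eq_iff)
  then show ?thesis by (metis dvd_triv_right int_dvd_int_iff)
qed

lemma prime_power_dvd_Lcm:
  fixes p :: nat
  assumes "finite A" "0 \<notin> A" "prime p" "p ^ v dvd Lcm A" "v \<ge> 1"
  shows "\<exists>a\<in>A. p ^ v dvd a"
  using assms
proof (induction A rule: finite_induct)
  case (insert a A)
  have "p ^ v dvd lcm a (Lcm A)" using insert by simp
  moreover have "Lcm A \<noteq> 0" using insert by (simp add: Lcm_0_iff)
  moreover have "a \<noteq> 0" using insert by auto
  ultimately have "v \<le> multiplicity p (lcm a (Lcm A))" using \<open>prime p\<close>
    by (subst (asm) power_dvd_iff_le_multiplicity) auto
  also have "\<dots> = max (multiplicity p a) (multiplicity p (Lcm A))"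
    using \<open>a \<noteq> 0\<close> \<open>Lcm A \<noteq> 0\<close> \<open>prime p\<close> by (simp add: multiplicity_lcm)
  finally have "p ^ v dvd a \<or> p ^ v dvd Lcm A"
    by (auto simp: max_def multiplicity_dvd' split: if_splits)
  then show ?case using insert by auto
qed (use prime_gt_1_nat in \<open>auto simp: dest: prime_gt_1_nat\<close>)

lemma Lcm_upto_le:
  fixes N :: nat
  shows "Lcm {1..N} \<le> N ^ card {p. prime p \<and> p \<le> N}"
proof -
  define L where "L = Lcm {1..N}"
  have L0: "L \<noteq> 0" by (simp add: L_def Lcm_0_iff)
  have pl: "p ^ multiplicity p L \<le> N" and pN: "p \<le> N" if "p \<in> prime_factors L" for p
  proof -
    have p: "prime p" "p dvd L" using that by auto
    then have "multiplicity p L \<ge> 1" using L0 by (simp add: Suc_le_eq prime_multiplicity_gt_zero_iff)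
    moreover have "p ^ multiplicity p L dvd L" by (rule multiplicity_dvd)
    ultimately obtain a where a: "a \<in> {1..N}" "p ^ multiplicity p L dvd a"
      using prime_power_dvd_Lcm[of "{1..N}" p "multiplicity p L"] p unfolding L_def by auto
    then have "p ^ multiplicity p L \<le> a" by (intro dvd_imp_le) auto
    then show 1: "p ^ multiplicity p L \<le> N" using a by simp
    have "p ^ 1 \<le> p ^ multiplicity p L"
      using \<open>multiplicity p L \<ge> 1\<close> p prime_ge_1_nat[of p] by (intro power_increasing) auto
    then show "p \<le> N" using 1 by simp
  qed
  have "L = (\<Prod>p\<in>prime_factors L. p ^ multiplicity p L)"
    using prod_prime_factors[OF L0] by simp
  also have "\<dots> \<le> (\<Prod>p\<in>prime_factors L. N)" using pl by (intro prod_mono) auto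
  also have "\<dots> = N ^ card (prime_factors L)" by simp
  also have "\<dots> \<le> N ^ card {p. prime p \<and> p \<le> N}"
  proof (cases "N = 0")
    case False
    have "prime_factors L \<subseteq> {p. prime p \<and> p \<le> N}" using pN by auto
    then have "card (prime_factors L) \<le> card {p. prime p \<and> p \<le> N}" by (intro card_mono) auto
    then show ?thesis using False by (intro power_increasing) auto
  next
    case True
    have "{p::nat. prime p \<and> p \<le> 0} = {}" by (auto dest: prime_gt_0_nat)
    then show ?thesis using True by (simp only: L_def) simp
  qed
  finally show ?thesis by (simp add: L_def)
qed

text \<open>Chebyshev's lower bound, from \<open>4 ^ N / 2 \<le> N * ((2 * N) choose N) \<le> Lcm {1..2 * N}\<close>.\<close>

lemma prime_count_pow2_lower:
  "real (card {p::nat. prime p \<and> p \<le> 2 ^ I}) \<ge> (2 ^ I - 1) / real I" if "I \<ge> 1"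
proof -
  define N :: nat where "N = 2 ^ (I - 1)"
  have N2: "2 * N = 2 ^ I" using that by (simp add: N_def flip: power_Suc)
  have N1: "N \<ge> 1" by (simp add: N_def)
  define c where "c = card {p::nat. prime p \<and> p \<le> 2 ^ I}"
  have "N * ((2 * N) choose N) dvd Lcm {1..2 * N}" using N1 by (intro leibniz_dvd_Lcm) auto
  then have "N * ((2 * N) choose N) \<le> Lcm {1..2 * N}"
    by (rule dvd_imp_le) (simp add: Lcm_0_iff neq0_conv[symmetric] del: neq0_conv)
  also have "\<dots> \<le> (2 * N) ^ c" using Lcm_upto_le[of "2 * N"] by (simp add: c_def N2)
  also have "\<dots> = 2 ^ (I * c)" unfolding N2 by (simp add: power_mult)
  finally have le: "N * ((2 * N) choose N) \<le> 2 ^ (I * c)" .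
  have "4 ^ N / 2 \<le> real N * real ((2 * N) choose N)"
    using central_binomial_lower_bound[of N] N1 by (simp add: field_simps)
  also have "\<dots> \<le> real (2 ^ (I * c))" using le by (metis of_nat_le_iff of_nat_mult)
  finally have "(4::real) ^ N \<le> 2 ^ (Suc (I * c))" by simp
  also have "(4::real) ^ N = 2 ^ (2 * N)" by (simp add: power_mult)
  finally have "2 * N \<le> Suc (I * c)" by (subst (asm) power_increasing_iff) auto
  then have "real (2 * N) \<le> real (Suc (I * c))" by (rule of_nat_mono)
  then have "2 ^ I - 1 \<le> real I * real c" unfolding N2 by simp
  then show ?thesis using that by (simp add: c_def field_simps)
qed

section \<open>Residues of powers along exponents with large gaps\<close>

text \<open>For a decreasing function a residue class modulo \<open>d\<close> carries at most the fraction \<open>1 / d\<close> of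
  the whole sum, up to its first term: each later term is at most the mean over the \<open>d\<close> consecutive
  integers that end there.\<close>

lemma antimono_sum_residue_class_le:
  fixes f :: "nat \<Rightarrow> real"
  assumes anti: "\<And>k. A \<le> k \<Longrightarrow> f (Suc k) \<le> f k" and nn: "\<And>k. A \<le> k \<Longrightarrow> f k \<ge> 0"
    and S: "S \<subseteq> {A..B}" "\<And>k. k \<in> S \<Longrightarrow> k mod d = c" and d: "d \<ge> 1"
  shows "real d * (\<Sum>k\<in>S. f k) \<le> real d * f A + (\<Sum>k=A..B. f k)"
proof -
  have mono: "f l \<le> f k" if "A \<le> k" "k \<le> l" for k l
    using that(2,1)
  proof (induction l rule: dec_induct)
    case (step l) then show ?case using anti[of l] by fastforce
  qed simp
  have finS: "finite S" using S(1) finite_subset by blast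
  define S1 where "S1 = {k\<in>S. k < A + d}"
  define S2 where "S2 = {k\<in>S. k \<ge> A + d}"
  have S12: "S = S1 \<union> S2" "S1 \<inter> S2 = {}" "finite S1" "finite S2" using finS by (auto simp: S1_def S2_def)
  have "k = l" if "k \<in> S1" "l \<in> S1" "k \<le> l" for k l
  proof (rule ccontr)
    assume "k \<noteq> l"
    have "k mod d = l mod d" using that S(2) by (auto simp: S1_def)
    then have "d dvd l - k" using that by (metis mod_eq_dvd_iff_nat)
    then have "d \<le> l - k" using that \<open>k \<noteq> l\<close> by (intro dvd_imp_le) auto
    moreover have "l < A + d" "A \<le> k" using that S(1) by (auto simp: S1_def)
    ultimately show False using \<open>k \<le> l\<close> d by linarith
  qed
  then have "\<exists>k0. S1 \<subseteq> {k0}" by (metis insertCI nle_le subsetI)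
  then obtain k0 where "S1 \<subseteq> {k0}" by blast
  then have "S1 = {} \<or> S1 = {k0}" by auto
  moreover have "S1 = {k0} \<Longrightarrow> f k0 \<le> f A" using S(1) by (intro mono) (auto simp: S1_def)
  ultimately have 1: "(\<Sum>k\<in>S1. f k) \<le> f A" using nn[of A] by auto
  have "real d * (\<Sum>k\<in>S2. f k) = (\<Sum>k\<in>S2. \<Sum>i\<in>{k-d<..k}. f k)"
    unfolding sum_distrib_left
  proof (intro sum.cong refl)
    fix k assume "k \<in> S2"
    then have "card {k-d<..k} = d" by (simp add: S2_def)
    then show "real d * f k = (\<Sum>i\<in>{k-d<..k}. f k)" by simp
  qed
  also have "\<dots> \<le> (\<Sum>k\<in>S2. \<Sum>i\<in>{k-d<..k}. f i)"
    by (intro sum_mono mono) (auto simp: S2_def)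
  also have "\<dots> = (\<Sum>i\<in>(\<Union>k\<in>S2. {k-d<..k}). f i)"
  proof (rule sum.UNION_disjoint[symmetric])
    have disj: "{k-d<..k} \<inter> {l-d<..l} = {}" if "k \<in> S2" "l \<in> S2" "k < l" for k l
    proof -
      have "k mod d = l mod d" using that S(2) by (auto simp: S2_def)
      then have "d dvd l - k" using that by (metis mod_eq_dvd_iff_nat less_imp_le)
      then have "d \<le> l - k" using that by (intro dvd_imp_le) auto
      then show ?thesis by auto
    qed
    show "\<forall>k\<in>S2. \<forall>l\<in>S2. k \<noteq> l \<longrightarrow> {k-d<..k} \<inter> {l-d<..l} = {}"
      using disj by (metis inf_commute linorder_neqE_nat)
  qed (use S12 in auto)
  also have "\<dots> \<le> (\<Sum>i=A..B. f i)"
  proof (rule sum_mono2)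
    show "(\<Union>k\<in>S2. {k-d<..k}) \<subseteq> {A..B}" using S(1) by (fastforce simp: S2_def)
  qed (use nn in auto)
  finally have 2: "real d * (\<Sum>k\<in>S2. f k) \<le> (\<Sum>i=A..B. f i)" .
  have "real d * (\<Sum>k\<in>S. f k) = real d * (\<Sum>k\<in>S1. f k) + real d * (\<Sum>k\<in>S2. f k)"
    using S12 by (simp add: sum.union_disjoint distrib_left)
  also have "\<dots> \<le> real d * f A + (\<Sum>i=A..B. f i)"
    by (intro add_mono mult_left_mono 1 2) auto
  finally show ?thesis .
qed

text \<open>The reals \<open>a \<ge> 0\<close> with \<open>\<lfloor>a ^ m\<rfloor> = k\<close>, as an interval between consecutive \<open>m\<close>-th roots.\<close>

definition cell :: "nat \<Rightarrow> nat \<Rightarrow> real set" where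
  "cell m k = {root m (real k)..<root m (real (Suc k))}"

text \<open>The length of \<open>cell m k\<close>.\<close>

definition cell_len :: "nat \<Rightarrow> nat \<Rightarrow> real" where
  "cell_len m k = root m (real (Suc k)) - root m (real k)"

lemma mem_cell_iff:
  assumes "m \<ge> 1" "a \<ge> 0"
  shows "a \<in> cell m k \<longleftrightarrow> nat \<lfloor>a ^ m\<rfloor> = k"
proof -
  have "a \<in> cell m k \<longleftrightarrow> real k \<le> a ^ m \<and> a ^ m < real (Suc k)"
  proof -
    have a: "a = root m (a ^ m)" using assms by (simp add: real_root_power_cancel)
    have "root m (real k) \<le> a \<longleftrightarrow> real k \<le> a ^ m"
      by (subst a) (use assms in simp)
    moreover have "a < root m (real (Suc k)) \<longleftrightarrow> a ^ m < real (Suc k)"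
      by (subst a) (use assms in simp)
    ultimately show ?thesis by (simp add: cell_def)
  qed
  also have "\<dots> \<longleftrightarrow> nat \<lfloor>a ^ m\<rfloor> = k"
  proof -
    have "a ^ m \<ge> 0" using assms by simp
    then show ?thesis by linarith
  qed
  finally show ?thesis .
qed

lemma cell_len_pos: "m \<ge> 1 \<Longrightarrow> cell_len m k > 0"
  by (simp add: cell_len_def)

lemma cell_len_Suc_le:
  assumes "m \<ge> 1"
  shows "cell_len m (Suc k) \<le> cell_len m k"
proof (rule ccontr)
  define w where "w i = root m (real (k + i))" for i
  have wp: "w i ^ m = real (k + i)" for i
    unfolding w_def using assms by (simp add: real_root_pow_pos2)
  have w0: "w i \<ge> 0" for i using assms by (simp add: w_def)
  have wm: "w 0 < w 1" "w 1 < w 2" using assms by (auto simp: w_def)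
  assume "\<not> ?thesis"
  then have gt: "w 2 - w 1 > w 1 - w 0"
    by (simp add: cell_len_def w_def add.commute[of 2] add.commute[of 1] numeral_2_eq_2)
  obtain m' where m: "m = Suc m'" using assms by (cases m) auto
  define P where "P x y = (\<Sum>p<Suc m'. x ^ p * y ^ (m' - p))" for x y :: real
  have d: "x ^ m - y ^ m = (x - y) * P x y" for x y
    unfolding m P_def by (rule diff_power_eq_sum)
  have "P (w 2) (w 1) \<ge> P (w 1) (w 0)"
    unfolding P_def using wm w0 by (intro sum_mono mult_mono power_mono) (auto intro: less_imp_le)
  moreover have "(w 1 - w 0) * P (w 1) (w 0) = 1" using d[of "w 1" "w 0"] wp by simp
  moreover from this have "P (w 1) (w 0) > 0" using wm
    by (metis diff_gt_0_iff_gt zero_less_mult_pos zero_less_one)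
  moreover have "(w 2 - w 1) * P (w 2) (w 1) = 1" using d[of "w 2" "w 1"] wp by simp
  ultimately have "(w 2 - w 1) * P (w 1) (w 0) \<le> (w 1 - w 0) * P (w 1) (w 0)"
    using wm by (metis diff_gt_0_iff_gt less_eq_real_def mult_left_mono)
  then show False using gt \<open>P (w 1) (w 0) > 0\<close> by simp
qed

text \<open>By Bernoulli's inequality the cell with index \<open>k\<close> has length about \<open>root m k / (m * k)\<close>; the
  two bounds are given here and in \<open>cell_len_lower\<close>.\<close>

lemma cell_len_upper:
  assumes "m \<ge> 1"
  shows "real m * cell_len m k * real k \<le> root m (real k)"
proof (cases "k = 0")
  case False
  define w where "w = root m (real k)"
  define v where "v = root m (real (Suc k))"
  have w: "w > 0" "w ^ m = real k" using False assms by (auto simp: w_def real_root_pow_pos2)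
  have v: "v ^ m = real (Suc k)" "v \<ge> w" using assms by (auto simp: v_def w_def real_root_pow_pos2)
  have "1 + real m * (v / w - 1) \<le> (1 + (v / w - 1)) ^ m"
    using w v by (intro Bernoulli_inequality) (auto simp: field_simps)
  also have "\<dots> = 1 + 1 / real k" using w v False by (simp add: power_divide field_simps)
  finally have "real m * (v - w) * real k \<le> w" using w False by (simp add: field_simps)
  then show ?thesis by (simp add: cell_len_def v_def w_def)
qed auto

lemma cell_len_lower:
  assumes "m \<ge> 1"
  shows "root m (real (Suc k)) \<le> real m * cell_len m k * real (Suc k)"
proof -
  define w where "w = root m (real k)"
  define v where "v = root m (real (Suc k))"
  have w: "w \<ge> 0" "w ^ m = real k" using assms by (auto simp: w_def real_root_pow_pos2)
  have v: "v ^ m = real (Suc k)" "v \<ge> w" "v > 0" using assms by (auto simp: v_def w_def real_root_pow_pos2)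
  have "1 + real m * (w / v - 1) \<le> (1 + (w / v - 1)) ^ m"
    using w v by (intro Bernoulli_inequality) (auto simp: field_simps)
  also have "\<dots> = real k / real (Suc k)" using w v by (simp add: power_divide)
  also have "\<dots> = 1 - 1 / real (Suc k)" by (simp add: field_simps)
  finally have "1 / real (Suc k) \<le> real m * ((v - w) / v)" using v by (simp add: field_simps)
  then have "v \<le> real m * (v - w) * real (Suc k)" using v by (simp add: field_simps del: of_nat_Suc)
  then show ?thesis by (simp add: cell_len_def v_def w_def)
qed

text \<open>The step from one exponent to the next: among the level-\<open>m'\<close> cells that meet a given level-\<open>m\<close>
  cell to the right of \<open>\<alpha>\<close>, those with index in one residue class modulo \<open>d\<close> have at most about the
  fraction \<open>1 / d\<close> of its length. The error consists of boundary cells, and the largest level-\<open>m'\<close>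
  cell is shorter than the level-\<open>m\<close> cell by a factor of order \<open>\<alpha> ^ G\<close>.\<close>

lemma cell_step:
  fixes \<alpha> :: real and c d :: nat
  assumes m: "m \<ge> 1" "m' \<ge> m + G" and al: "\<alpha> \<ge> 1" "\<alpha> ^ G \<ge> 2" and k: "\<alpha> ^ m < real (Suc k)" and d: "d \<ge> 1"
  defines "S \<equiv> {k'. k' mod d = c \<and> (\<exists>a\<in>cell m k. \<alpha> \<le> a \<and> a \<in> cell m' k')}"
  shows "finite S" "(\<Sum>k'\<in>S. cell_len m' k') \<le> (1 + 12 * real d / \<alpha> ^ G) / real d * cell_len m k"
proof -
  define u where "u = root m (real k)"
  define v where "v = root m (real (Suc k))"
  define t where "t = max u \<alpha>"
  define A where "A = nat \<lfloor>t ^ m'\<rfloor>"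
  define B where "B = nat \<lfloor>v ^ m'\<rfloor>"
  define len where "len = cell_len m k"
  define lam where "lam = cell_len m' A"
  have m': "m' \<ge> 1" "m' \<ge> m" using m by auto
  have um: "u ^ m = real k" "u \<ge> 0" and vm: "v ^ m = real (Suc k)" "v \<ge> 0"
    using m by (auto simp: u_def v_def real_root_pow_pos2)
  have "\<alpha> < v" using k vm al by (metis power_mono leI not_less order.trans zero_le_one)
  moreover have "u < v" using m by (simp add: u_def v_def)
  ultimately have tv: "t < v" and t: "t \<ge> \<alpha>" "t \<ge> u" "t \<ge> 1" using al by (auto simp: t_def)
  have lenp: "len > 0" "lam > 0" using m m' cell_len_pos by (auto simp: len_def lam_def)
  have S_sub: "S \<subseteq> {A..B}"
  proof
    fix k' assume "k' \<in> S"
    then obtain a where a: "a \<in> cell m k" "\<alpha> \<le> a" "a \<in> cell m' k'" by (auto simp: S_def)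
    then have "t \<le> a" "a \<le> v" by (auto simp: cell_def t_def u_def v_def)
    moreover have "nat \<lfloor>a ^ m'\<rfloor> = k'" using a al m' mem_cell_iff[of m' a k'] by simp
    ultimately show "k' \<in> {A..B}" using t al
      unfolding A_def B_def by (auto intro!: nat_mono floor_mono power_mono)
  qed
  then show "finite S" using finite_subset by blast
  have anti: "cell_len m' l \<le> cell_len m' k" if "k \<le> l" for k l
    using that
  proof (induction l rule: dec_induct)
    case (step l) then show ?case using cell_len_Suc_le[OF m'(1), of l] by simp
  qed simp
  have tA: "t \<in> cell m' A" using mem_cell_iff[of m' t A] m' t by (simp add: A_def)
  have vB: "v \<in> cell m' B" using mem_cell_iff[of m' v B] m' vm by (simp add: B_def)
  have AB: "A \<le> B" unfolding A_def B_def using tv t by (intro nat_mono floor_mono power_mono) auto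
  have "(\<Sum>i=A..B. cell_len m' i) = root m' (real (Suc B)) - root m' (real A)"
    unfolding cell_len_def using AB by (intro sum_Suc_diff) simp
  also have "root m' (real (Suc B)) \<le> v + cell_len m' B" using vB by (simp add: cell_def cell_len_def)
  also have "cell_len m' B \<le> lam" unfolding lam_def by (rule anti[OF AB])
  finally have "(\<Sum>i=A..B. cell_len m' i) \<le> v + lam - root m' (real A)" by simp
  moreover have "root m' (real A) \<ge> u - lam" using tA t by (simp add: cell_def cell_len_def lam_def)
  moreover have "len = v - u" by (simp add: len_def cell_len_def u_def v_def)
  ultimately have sumAB: "(\<Sum>i=A..B. cell_len m' i) \<le> len + 2 * lam" by linarith
  have "1 \<le> \<alpha> ^ m" using al by simp
  then have "real k > 0" using k by simp
  then have k1: "real k \<ge> 1" by simp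
  have "real k * \<alpha> ^ G \<le> t ^ m * t ^ (m' - m)"
  proof (intro mult_mono)
    show "real k \<le> t ^ m" using um t power_mono[of u t m] by simp
    have "\<alpha> ^ G \<le> \<alpha> ^ (m' - m)" using al m by (intro power_increasing) auto
    also have "\<dots> \<le> t ^ (m' - m)" using t al by (intro power_mono) auto
    finally show "\<alpha> ^ G \<le> t ^ (m' - m)" .
  qed (use t al in auto)
  also have "\<dots> = t ^ m'" using m' by (simp flip: power_add)
  also have "\<dots> \<le> real A + 1" unfolding A_def by linarith
  finally have "real k * \<alpha> ^ G \<le> real A + 1" .
  moreover have "real k * \<alpha> ^ G \<ge> 2" using mult_mono[of 1 "real k" 2 "\<alpha> ^ G"] k1 al by simp
  ultimately have A: "real A \<ge> real k * \<alpha> ^ G / 2" by linarith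
  have "real m * (lam * real A) \<le> real m' * (lam * real A)"
    using m' lenp by (intro mult_right_mono) auto
  also have "\<dots> \<le> root m' (real A)" using cell_len_upper[of m' A] m' by (simp add: lam_def mult.assoc)
  also have "\<dots> \<le> v" using tA tv by (simp add: cell_def)
  also have "\<dots> \<le> real m * (len * real (Suc k))"
    using cell_len_lower[of m k] m by (simp add: len_def v_def mult.assoc)
  finally have "lam * real A \<le> len * real (Suc k)" using m by simp
  also have "\<dots> \<le> len * (2 * real k)" using k1 lenp by (intro mult_left_mono) auto
  finally have "lam * (real k * \<alpha> ^ G / 2) \<le> len * (2 * real k)"
    using A lenp by (meson mult_left_mono less_imp_le order_trans)
  then have "real k * (lam * \<alpha> ^ G) \<le> real k * (4 * len)" by (simp add: algebra_simps)
  then have lam: "lam * \<alpha> ^ G \<le> 4 * len" using k1 by simp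
  have "real d * (\<Sum>k'\<in>S. cell_len m' k') \<le> real d * cell_len m' A + (\<Sum>i=A..B. cell_len m' i)"
    using S_sub d cell_len_Suc_le[OF m'(1)] less_imp_le[OF cell_len_pos[OF m'(1)]]
    by (intro antimono_sum_residue_class_le[where c = c]) (auto simp: S_def)
  also have "\<dots> \<le> real d * lam + (len + 2 * lam)" using sumAB by (simp add: lam_def)
  also have "\<dots> \<le> len + 3 * real d * lam"
    using d lenp mult_right_mono[of 1 "real d" lam] by (simp add: algebra_simps)
  also have "\<dots> \<le> len + 3 * real d * (4 * len / \<alpha> ^ G)"
    using lam al lenp by (intro add_left_mono mult_left_mono) (auto simp: field_simps)
  also have "\<dots> = (1 + 12 * real d / \<alpha> ^ G) * len" by (simp add: algebra_simps)
  finally show "(\<Sum>k'\<in>S. cell_len m' k') \<le> (1 + 12 * real d / \<alpha> ^ G) / real d * cell_len m k"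
    using d by (simp add: len_def field_simps)
qed

lemma sets_cell [measurable]: "cell m k \<in> sets borel"
  by (simp add: cell_def)

lemma fmeasurable_cell: "cell m k \<in> fmeasurable lborel"
  unfolding cell_def by (intro fmeasurableI emeasure_bounded_finite) auto

lemma measure_cell: "m \<ge> 1 \<Longrightarrow> measure lborel (cell m k) = cell_len m k"
  by (simp add: cell_def cell_len_def real_root_le_mono)

lemma measurable_nat_floor_power [measurable]:
  "(\<lambda>a::real. nat \<lfloor>a ^ m\<rfloor>) \<in> measurable borel (count_space UNIV)"
  by measurable

text \<open>Iteration of \<open>cell_step\<close> along exponents with gaps of at least \<open>G\<close>.\<close>

lemma cell_residues_measure_le:
  fixes \<alpha> :: real and d :: nat and e c :: "nat \<Rightarrow> nat"
  assumes "m \<ge> 1" "\<alpha> \<ge> 1" "\<alpha> ^ G \<ge> 2" "\<alpha> ^ m < real (Suc k)" "d \<ge> 1"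
    and "e 0 \<ge> m + G" "\<And>i. e (Suc i) \<ge> e i + G"
  shows "measure lborel {a \<in> cell m k. \<alpha> \<le> a \<and> (\<forall>i<n. nat \<lfloor>a ^ e i\<rfloor> mod d = c i)}
     \<le> ((1 + 12 * real d / \<alpha> ^ G) / real d) ^ n * cell_len m k"
  using assms
proof (induction n arbitrary: m k e c)
  case 0
  have "measure lborel {a \<in> cell m k. \<alpha> \<le> a} \<le> measure lborel (cell m k)"
    by (intro measure_mono_fmeasurable fmeasurable_cell) auto
  then show ?case using 0 by (simp add: measure_cell)
next
  case (Suc n)
  define S where "S = {k'. k' mod d = c 0 \<and> (\<exists>a\<in>cell m k. \<alpha> \<le> a \<and> a \<in> cell (e 0) k')}"
  note step = cell_step[OF Suc.prems(1) Suc.prems(6) Suc.prems(2,3,4,5), of "c 0", folded S_def]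
  define D where "D k' = {a \<in> cell (e 0) k'. \<alpha> \<le> a \<and> (\<forall>i<n. nat \<lfloor>a ^ e (Suc i)\<rfloor> mod d = c (Suc i))}" for k'
  have e0: "e 0 \<ge> 1" using Suc.prems by auto
  have Dm: "D k' \<in> sets lborel" for k' unfolding D_def by measurable
  have bnd: "measure lborel (D k') \<le> ((1 + 12 * real d / \<alpha> ^ G) / real d) ^ n * cell_len (e 0) k'"
    if "k' \<in> S" for k'
  proof -
    from that obtain a where a: "\<alpha> \<le> a" "a \<in> cell (e 0) k'" by (auto simp: S_def)
    have "\<alpha> ^ e 0 \<le> a ^ e 0" using a Suc.prems by (intro power_mono) auto
    also have "\<dots> < real (Suc k')" using a e0 mem_cell_iff[of "e 0" a k'] Suc.prems by simp linarith
    finally show ?thesis unfolding D_def using Suc.prems e0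
      by (intro Suc.IH[of "e 0" k' "\<lambda>i. e (Suc i)" "\<lambda>i. c (Suc i)"]) auto
  qed
  have "{a \<in> cell m k. \<alpha> \<le> a \<and> (\<forall>i<Suc n. nat \<lfloor>a ^ e i\<rfloor> mod d = c i)} \<subseteq> (\<Union>k'\<in>S. D k')"
  proof
    fix a assume a: "a \<in> {a \<in> cell m k. \<alpha> \<le> a \<and> (\<forall>i<Suc n. nat \<lfloor>a ^ e i\<rfloor> mod d = c i)}"
    define k' where "k' = nat \<lfloor>a ^ e 0\<rfloor>"
    have "a \<in> cell (e 0) k'" using mem_cell_iff[of "e 0" a k'] e0 a Suc.prems by (simp add: k'_def)
    moreover have "k' mod d = c 0" using a by (auto simp: k'_def)
    ultimately show "a \<in> (\<Union>k'\<in>S. D k')" using a by (auto simp: S_def D_def)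
  qed
  moreover have "(\<Union>k'\<in>S. D k') \<in> fmeasurable lborel"
  proof (rule fmeasurable_UN[where F = D and A = "\<Union>k'\<in>S. cell (e 0) k'"])
    show "countable S" by simp
    show "(\<Union>k'\<in>S. cell (e 0) k') \<in> fmeasurable lborel"
      using step(1) by (intro fmeasurable.finite_UN) (auto intro: fmeasurable_cell)
  qed (use Dm in \<open>auto simp: D_def\<close>)
  ultimately have "measure lborel {a \<in> cell m k. \<alpha> \<le> a \<and> (\<forall>i<Suc n. nat \<lfloor>a ^ e i\<rfloor> mod d = c i)}
      \<le> measure lborel (\<Union>k'\<in>S. D k')"
    by (intro measure_mono_fmeasurable) measurable
  also have "\<dots> \<le> (\<Sum>k'\<in>S. measure lborel (D k'))"
    using step(1) Dm by (intro measure_UNION_le) auto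
  also have "\<dots> \<le> (\<Sum>k'\<in>S. ((1 + 12 * real d / \<alpha> ^ G) / real d) ^ n * cell_len (e 0) k')"
    by (intro sum_mono bnd)
  also have "\<dots> = ((1 + 12 * real d / \<alpha> ^ G) / real d) ^ n * (\<Sum>k'\<in>S. cell_len (e 0) k')"
    by (simp add: sum_distrib_left)
  also have "\<dots> \<le> ((1 + 12 * real d / \<alpha> ^ G) / real d) ^ n * ((1 + 12 * real d / \<alpha> ^ G) / real d * cell_len m k)"
    using Suc.prems by (intro mult_left_mono step(2)) auto
  finally show ?case by (simp add: mult_ac)
qed

text \<open>For \<open>a\<close> uniform in an interval, the residues of \<open>\<lfloor>a ^ e i\<rfloor>\<close> modulo \<open>d\<close> follow any prescribed
  pattern with probability at most slightly more than \<open>1 / d ^ n\<close>, as long as \<open>n * d\<close> is small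
  compared with \<open>\<alpha> ^ G\<close>. The extra exponent \<open>m\<close> supplies the initial cells; the last factor accounts
  for those that stick out of the interval.\<close>

lemma interval_residues_measure_le:
  fixes \<alpha> \<beta> :: real and d :: nat and e c :: "nat \<Rightarrow> nat"
  assumes m: "m \<ge> 1" and al: "\<alpha> \<ge> 1" "\<alpha> ^ G \<ge> 2" "\<alpha> ^ m \<ge> 2" "\<alpha> < \<beta>" and d: "d \<ge> 1"
    and e: "e 0 \<ge> m + G" "\<And>i. e (Suc i) \<ge> e i + G"
  shows "measure lborel {a \<in> {\<alpha>..<\<beta>}. \<forall>i<n. nat \<lfloor>a ^ e i\<rfloor> mod d = c i}
     \<le> ((1 + 12 * real d / \<alpha> ^ G) / real d) ^ n * (\<beta> - \<alpha> + 4 * \<alpha> / \<alpha> ^ m)"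
proof -
  define k0 where "k0 = nat \<lfloor>\<alpha> ^ m\<rfloor>"
  define k1 where "k1 = nat \<lfloor>\<beta> ^ m\<rfloor>"
  define D where "D k = {a \<in> cell m k. \<alpha> \<le> a \<and> (\<forall>i<n. nat \<lfloor>a ^ e i\<rfloor> mod d = c i)}" for k
  define C where "C = ((1 + 12 * real d / \<alpha> ^ G) / real d) ^ n"
  have C: "C \<ge> 0" using al by (simp add: C_def)
  have Dm: "D k \<in> sets lborel" for k unfolding D_def by measurable
  have k01: "k0 \<le> k1" unfolding k0_def k1_def using al by (intro nat_mono floor_mono power_mono) auto
  have anti: "cell_len m l \<le> cell_len m k" if "k \<le> l" for k l
    using that
  proof (induction l rule: dec_induct)
    case (step l) then show ?case using cell_len_Suc_le[OF m, of l] by simp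
  qed simp
  have a0: "\<alpha> \<in> cell m k0" using mem_cell_iff[of m \<alpha> k0] m al by (simp add: k0_def)
  have b1: "\<beta> \<in> cell m k1" using mem_cell_iff[of m \<beta> k1] m al by (simp add: k1_def)
  have "real k0 \<ge> \<alpha> ^ m - 1" unfolding k0_def by linarith
  then have k0: "real k0 \<ge> \<alpha> ^ m / 2" using al by linarith
  define lam where "lam = cell_len m k0"
  have lam0: "lam > 0" unfolding lam_def by (rule cell_len_pos[OF m])
  have "lam * (\<alpha> ^ m / 2) \<le> real m * (lam * real k0)"
    using k0 lam0 m mult_mono[of 1 "real m" "lam * (\<alpha> ^ m / 2)" "lam * real k0"] al by simp
  also have "\<dots> \<le> root m (real k0)" using cell_len_upper[OF m, of k0] by (simp add: lam_def mult.assoc)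
  also have "\<dots> \<le> \<alpha>" using a0 by (simp add: cell_def)
  finally have lam: "lam \<le> 2 * \<alpha> / \<alpha> ^ m" using al by (simp add: field_simps)
  have "(\<Sum>k=k0..k1. cell_len m k) = root m (real (Suc k1)) - root m (real k0)"
    unfolding cell_len_def using k01 by (intro sum_Suc_diff) simp
  also have "root m (real (Suc k1)) \<le> \<beta> + cell_len m k1" using b1 by (simp add: cell_def cell_len_def)
  also have "cell_len m k1 \<le> lam" unfolding lam_def by (rule anti[OF k01])
  finally have "(\<Sum>k=k0..k1. cell_len m k) \<le> \<beta> + lam - root m (real k0)" by simp
  moreover have "root m (real k0) \<ge> \<alpha> - lam" using a0 by (simp add: cell_def cell_len_def lam_def)
  ultimately have sum: "(\<Sum>k=k0..k1. cell_len m k) \<le> \<beta> - \<alpha> + 4 * \<alpha> / \<alpha> ^ m" using lam by simp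
  have "{a \<in> {\<alpha>..<\<beta>}. \<forall>i<n. nat \<lfloor>a ^ e i\<rfloor> mod d = c i} \<subseteq> (\<Union>k\<in>{k0..k1}. D k)"
  proof
    fix a assume a: "a \<in> {a \<in> {\<alpha>..<\<beta>}. \<forall>i<n. nat \<lfloor>a ^ e i\<rfloor> mod d = c i}"
    define k where "k = nat \<lfloor>a ^ m\<rfloor>"
    have "a \<in> cell m k" using mem_cell_iff[of m a k] m a al by (simp add: k_def)
    moreover have "k0 \<le> k" "k \<le> k1" unfolding k0_def k1_def k_def
      using a al by (auto intro!: nat_mono floor_mono power_mono)
    ultimately show "a \<in> (\<Union>k\<in>{k0..k1}. D k)" using a by (auto simp: D_def)
  qed
  moreover have "(\<Union>k\<in>{k0..k1}. D k) \<in> fmeasurable lborel"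
  proof (rule fmeasurable_UN[where F = D and A = "\<Union>k\<in>{k0..k1}. cell m k"])
    show "(\<Union>k\<in>{k0..k1}. cell m k) \<in> fmeasurable lborel"
      by (intro fmeasurable.finite_UN) (auto intro: fmeasurable_cell)
  qed (use Dm in \<open>auto simp: D_def\<close>)
  ultimately have "measure lborel {a \<in> {\<alpha>..<\<beta>}. \<forall>i<n. nat \<lfloor>a ^ e i\<rfloor> mod d = c i}
      \<le> measure lborel (\<Union>k\<in>{k0..k1}. D k)"
    by (intro measure_mono_fmeasurable) measurable
  also have "\<dots> \<le> (\<Sum>k=k0..k1. measure lborel (D k))"
    using Dm by (intro measure_UNION_le) auto
  also have "\<dots> \<le> (\<Sum>k=k0..k1. C * cell_len m k)"
  proof (rule sum_mono)
    fix k assume "k \<in> {k0..k1}"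
    then have "\<alpha> ^ m < real (Suc k)" unfolding k0_def using al by simp linarith
    then show "measure lborel (D k) \<le> C * cell_len m k"
      unfolding D_def C_def using m al d e by (intro cell_residues_measure_le) auto
  qed
  also have "\<dots> = C * (\<Sum>k=k0..k1. cell_len m k)" by (simp add: sum_distrib_left)
  also have "\<dots> \<le> C * (\<beta> - \<alpha> + 4 * \<alpha> / \<alpha> ^ m)" using sum C by (rule mult_left_mono)
  finally show ?thesis by (simp add: C_def)
qed

section \<open>Residue vectors and bins of prescribed size\<close>

text \<open>The vectors of \<open>n\<close> residues modulo \<open>d\<close>, as extensional functions on \<open>{..<n}\<close>, so that there
  are exactly \<open>d ^ n\<close> of them.\<close>

definition residue_vectors :: "nat \<Rightarrow> nat \<Rightarrow> (nat \<Rightarrow> nat) set" where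
  "residue_vectors n d = PiE {..<n} (\<lambda>_. {..<d})"

text \<open>The positions at which a vector takes the value \<open>c\<close>.\<close>

definition bin :: "nat \<Rightarrow> (nat \<Rightarrow> nat) \<Rightarrow> nat \<Rightarrow> nat set" where
  "bin n u c = {i. i < n \<and> u i = c}"

text \<open>The values modulo \<open>p\<close> whose bin is full, that is, has exactly \<open>M\<close> elements. Prescribing the
  exact size makes the moments below explicit.\<close>

definition full_bins :: "nat \<Rightarrow> nat \<Rightarrow> nat \<Rightarrow> (nat \<Rightarrow> nat) \<Rightarrow> nat set" where
  "full_bins M n p u = {c. c < p \<and> card (bin n u c) = M}"

text \<open>Position \<open>r\<close> lies in a full bin.\<close>

definition in_full_bin :: "nat \<Rightarrow> nat \<Rightarrow> (nat \<Rightarrow> nat) \<Rightarrow> nat \<Rightarrow> bool" where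
  "in_full_bin M n u r \<longleftrightarrow> card (bin n u (u r)) = M"

lemma finite_residue_vectors [simp]: "finite (residue_vectors n d)"
  by (simp add: residue_vectors_def finite_PiE)

lemma card_residue_vectors: "card (residue_vectors n d) = d ^ n"
  by (simp add: residue_vectors_def card_PiE)

lemma finite_bin [simp]: "finite (bin n u c)"
  by (simp add: bin_def)

lemma bin_subset: "bin n u c \<subseteq> {..<n}"
  by (auto simp: bin_def)

lemma finite_full_bins [simp]: "finite (full_bins M n p u)"
  by (simp add: full_bins_def)

lemma prod_if_1_const:
  assumes "finite A"
  shows "(\<Prod>k\<in>A. if k \<in> S then 1 else c) = (c::nat) ^ card (A - S)"
  using assms by (simp add: prod.If_cases Diff_eq)

lemma card_fixed_bin:
  assumes "I \<subseteq> {..<n}" "c < p"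
  shows "card {u \<in> residue_vectors n p. bin n u c = I} = (p - 1) ^ (n - card I)"
proof -
  have fI: "finite I" using assms finite_subset by blast
  have "{u \<in> residue_vectors n p. bin n u c = I} = PiE {..<n} (\<lambda>i. if i \<in> I then {c} else {..<p} - {c})"
    using assms by (auto simp: residue_vectors_def bin_def PiE_iff extensional_def split: if_splits)
  also have "card \<dots> = (\<Prod>i<n. if i \<in> I then 1 else p - 1)"
    using assms by (subst card_PiE) (auto intro!: prod.cong)
  also have "\<dots> = (p - 1) ^ card ({..<n} - I)"
    by (rule prod_if_1_const) simp
  also have "card ({..<n} - I) = n - card I" using assms fI by (simp add: card_Diff_subset)
  finally show ?thesis .
qed

lemma card_two_fixed_bins:
  assumes "I \<subseteq> {..<n}" "J \<subseteq> {..<n}" "I \<inter> J = {}" "c < p" "c' < p" "c \<noteq> c'"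
  shows "card {u \<in> residue_vectors n p. bin n u c = I \<and> bin n u c' = J} = (p - 2) ^ (n - card I - card J)"
proof -
  have fI: "finite I" "finite J" using assms finite_subset by blast+
  have IJ: "i \<notin> I" if "i \<in> J" for i using assms that by auto
  have "{u \<in> residue_vectors n p. bin n u c = I \<and> bin n u c' = J}
      = PiE {..<n} (\<lambda>i. if i \<in> I then {c} else if i \<in> J then {c'} else {..<p} - {c, c'})"
    using assms IJ by (fastforce simp: residue_vectors_def bin_def PiE_iff extensional_def split: if_splits)
  also have "card \<dots> = (\<Prod>i<n. if i \<in> I \<union> J then 1 else p - 2)"
    using assms by (subst card_PiE) (auto intro!: prod.cong simp: card_Diff_subset)
  also have "\<dots> = (p - 2) ^ card ({..<n} - (I \<union> J))"
    by (rule prod_if_1_const) simp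
  also have "card ({..<n} - (I \<union> J)) = n - card I - card J"
    using assms fI by (subst card_Diff_subset) (auto simp: card_Un_disjoint)
  finally show ?thesis .
qed

lemma card_full_bin:
  assumes "c < p"
  shows "card {u \<in> residue_vectors n p. card (bin n u c) = M} = (n choose M) * (p - 1) ^ (n - M)"
proof -
  let ?B = "{I. I \<subseteq> {..<n} \<and> card I = M}"
  have "{u \<in> residue_vectors n p. card (bin n u c) = M} = (\<Union>I\<in>?B. {u \<in> residue_vectors n p. bin n u c = I})"
    by (auto simp: bin_def)
  also have "card \<dots> = (\<Sum>I\<in>?B. card {u \<in> residue_vectors n p. bin n u c = I})"
    by (intro card_UN_disjoint) auto
  also have "\<dots> = (\<Sum>I\<in>?B. (p - 1) ^ (n - M))"
    using assms by (intro sum.cong refl) (auto simp: card_fixed_bin)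
  also have "\<dots> = (n choose M) * (p - 1) ^ (n - M)" by (simp add: n_subsets)
  finally show ?thesis .
qed

lemma card_two_full_bins:
  assumes "c < p" "c' < p" "c \<noteq> c'"
  shows "card {u \<in> residue_vectors n p. card (bin n u c) = M \<and> card (bin n u c') = M}
     = (n choose M) * ((n - M) choose M) * (p - 2) ^ (n - 2 * M)"
proof -
  define B where "B = (SIGMA I:{I. I \<subseteq> {..<n} \<and> card I = M}. {J. J \<subseteq> {..<n} - I \<and> card J = M})"
  have finB: "finite B" unfolding B_def by (intro finite_SigmaI) auto
  define D where "D x = {u \<in> residue_vectors n p. bin n u c = fst x \<and> bin n u c' = snd x}" for x
  have "{u \<in> residue_vectors n p. card (bin n u c) = M \<and> card (bin n u c') = M} = (\<Union>x\<in>B. D x)"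
  proof (intro equalityI subsetI)
    fix u assume u: "u \<in> {u \<in> residue_vectors n p. card (bin n u c) = M \<and> card (bin n u c') = M}"
    have "bin n u c' \<subseteq> {..<n} - bin n u c" using assms by (auto simp: bin_def)
    then have "(bin n u c, bin n u c') \<in> B" using u bin_subset by (simp add: B_def)
    moreover have "u \<in> D (bin n u c, bin n u c')" using u by (simp add: D_def)
    ultimately show "u \<in> (\<Union>x\<in>B. D x)" by blast
  next
    fix u assume "u \<in> (\<Union>x\<in>B. D x)"
    then show "u \<in> {u \<in> residue_vectors n p. card (bin n u c) = M \<and> card (bin n u c') = M}"
      by (auto simp: B_def D_def)
  qed
  also have "card \<dots> = (\<Sum>x\<in>B. card (D x))"
    by (rule card_UN_disjoint) (use finB in \<open>auto simp: D_def\<close>)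
  also have "\<dots> = (\<Sum>x\<in>B. (p - 2) ^ (n - 2 * M))"
  proof (intro sum.cong refl)
    fix x assume "x \<in> B"
    then have "fst x \<subseteq> {..<n}" "snd x \<subseteq> {..<n}" "fst x \<inter> snd x = {}" "card (fst x) = M" "card (snd x) = M"
      by (auto simp: B_def)
    then show "card (D x) = (p - 2) ^ (n - 2 * M)"
      unfolding D_def using card_two_fixed_bins[of "fst x" n "snd x" c p c'] assms by (simp add: mult_2)
  qed
  also have "\<dots> = card B * (p - 2) ^ (n - 2 * M)" by simp
  also have "card B = (\<Sum>I\<in>{I. I \<subseteq> {..<n} \<and> card I = M}. card {J. J \<subseteq> {..<n} - I \<and> card J = M})"
    unfolding B_def by (intro card_SigmaI) auto
  also have "\<dots> = (\<Sum>I\<in>{I. I \<subseteq> {..<n} \<and> card I = M}. (n - M) choose M)"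
  proof (intro sum.cong refl)
    fix I assume "I \<in> {I. I \<subseteq> {..<n} \<and> card I = M}"
    then have I: "I \<subseteq> {..<n}" "card I = M" "finite I" using finite_subset by auto
    then show "card {J. J \<subseteq> {..<n} - I \<and> card J = M} = (n - M) choose M"
      by (subst n_subsets) (auto simp: card_Diff_subset)
  qed
  also have "\<dots> = (n choose M) * ((n - M) choose M)" by (simp add: n_subsets)
  finally show ?thesis by simp
qed

lemma card_in_full_bin:
  assumes "r < n" "M \<ge> 1"
  shows "card {u \<in> residue_vectors n p. in_full_bin M n u r} = p * ((n - 1) choose (M - 1)) * (p - 1) ^ (n - M)"
proof -
  let ?B = "{I. I \<subseteq> {..<n} \<and> r \<in> I \<and> card I = M}"
  have cB: "card ?B = (n - 1) choose (M - 1)"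
  proof -
    have "bij_betw (insert r) {I. I \<subseteq> {..<n} - {r} \<and> card I = M - 1} ?B"
    proof (rule bij_betwI[where g = "\<lambda>I. I - {r}"])
      show "insert r \<in> {I. I \<subseteq> {..<n} - {r} \<and> card I = M - 1} \<rightarrow> ?B"
      proof
        fix I assume "I \<in> {I. I \<subseteq> {..<n} - {r} \<and> card I = M - 1}"
        then have "I \<subseteq> {..<n} - {r}" "card I = M - 1" "finite I" using finite_subset by auto
        then show "insert r I \<in> ?B" using assms by (auto simp: card_insert_if)
      qed
      show "(\<lambda>I. I - {r}) \<in> ?B \<rightarrow> {I. I \<subseteq> {..<n} - {r} \<and> card I = M - 1}"
        using assms by (auto simp: card_Diff_singleton)
    qed auto
    then have "card ?B = card {I. I \<subseteq> {..<n} - {r} \<and> card I = M - 1}" by (rule bij_betw_same_card[symmetric])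
    also have "\<dots> = (n - 1) choose (M - 1)" using assms by (subst n_subsets) auto
    finally show ?thesis .
  qed
  define D where "D x = {u \<in> residue_vectors n p. bin n u (snd x) = fst x}" for x
  have "{u \<in> residue_vectors n p. in_full_bin M n u r}
      = (\<Union>x\<in>?B \<times> {..<p}. D x)" (is "?L = ?R")
  proof
    show "?L \<subseteq> ?R"
    proof
      fix u assume u: "u \<in> ?L"
      then have "(bin n u (u r), u r) \<in> ?B \<times> {..<p}" "u \<in> residue_vectors n p"
        using assms by (auto simp: in_full_bin_def residue_vectors_def PiE_iff) (auto simp: bin_def)
      moreover have "u \<in> D (bin n u (u r), u r)" using u by (simp add: D_def)
      ultimately show "u \<in> ?R" by blast
    qed
    show "?R \<subseteq> ?L" by (auto simp: bin_def in_full_bin_def D_def)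
  qed
  also have "card \<dots> = (\<Sum>x\<in>?B \<times> {..<p}. card (D x))"
  proof (rule card_UN_disjoint)
    show "\<forall>x\<in>?B \<times> {..<p}. \<forall>y\<in>?B \<times> {..<p}. x \<noteq> y \<longrightarrow> D x \<inter> D y = {}"
      by (auto simp: bin_def D_def)
  qed (auto simp: D_def)
  also have "\<dots> = (\<Sum>x\<in>?B \<times> {..<p}. (p - 1) ^ (n - M))"
  proof (intro sum.cong refl)
    fix x assume "x \<in> ?B \<times> {..<p}"
    then show "card (D x) = (p - 1) ^ (n - M)"
      unfolding D_def using card_fixed_bin[of "fst x" n "snd x" p] by auto
  qed
  also have "\<dots> = p * ((n - 1) choose (M - 1)) * (p - 1) ^ (n - M)"
    by (simp add: cB)
  finally show ?thesis .
qed

text \<open>The expected number of full bins of a uniformly random residue vector modulo \<open>p\<close>, see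
  \<open>sum_full_bins\<close>.\<close>

definition exp_bins :: "nat \<Rightarrow> nat \<Rightarrow> nat \<Rightarrow> real" where
  "exp_bins M n p = real p * real (n choose M) * (real p - 1) ^ (n - M) / real p ^ n"

text \<open>The probability that a given position lies in a full bin, see \<open>sum_in_full_bin\<close>.\<close>

definition prob_full :: "nat \<Rightarrow> nat \<Rightarrow> nat \<Rightarrow> real" where
  "prob_full M n p = real p * real ((n - 1) choose (M - 1)) * (real p - 1) ^ (n - M) / real p ^ n"

lemma prob_full_exp_bins:
  assumes "M \<ge> 1" "n \<ge> 1"
  shows "real n * prob_full M n p = real M * exp_bins M n p"
proof -
  have "n * ((n - 1) choose (M - 1)) = M * (n choose M)"
    using times_binomial_minus1_eq[of M n] assms by simp
  then have "real n * real ((n - 1) choose (M - 1)) = real M * real (n choose M)"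
    by (metis of_nat_mult)
  then show ?thesis by (simp add: prob_full_def exp_bins_def mult_ac)
qed

lemma sum_in_full_bin:
  assumes "r < n" "M \<ge> 1" "p \<ge> 1"
  shows "(\<Sum>u\<in>residue_vectors n p. of_bool (in_full_bin M n u r)) = prob_full M n p * real p ^ n"
proof -
  have "(\<Sum>u\<in>residue_vectors n p. of_bool (in_full_bin M n u r) :: real)
      = real (card {u \<in> residue_vectors n p. in_full_bin M n u r})"
    by (simp add: sum.If_cases of_bool_def Int_def)
  also have "\<dots> = prob_full M n p * real p ^ n"
    using assms by (simp add: card_in_full_bin prob_full_def of_nat_diff)
  finally show ?thesis .
qed

lemma sum_full_bins:
  assumes "p \<ge> 1"
  shows "(\<Sum>u\<in>residue_vectors n p. real (card (full_bins M n p u))) = exp_bins M n p * real p ^ n"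
proof -
  have "(\<Sum>u\<in>residue_vectors n p. real (card (full_bins M n p u)))
      = (\<Sum>u\<in>residue_vectors n p. \<Sum>c<p. of_bool (card (bin n u c) = M))"
    by (simp add: sum.If_cases of_bool_def full_bins_def Int_def conj_commute)
  also have "\<dots> = (\<Sum>c<p. \<Sum>u\<in>residue_vectors n p. of_bool (card (bin n u c) = M))" by (rule sum.swap)
  also have "\<dots> = (\<Sum>c<p. real (card {u \<in> residue_vectors n p. card (bin n u c) = M}))"
    by (simp add: sum.If_cases of_bool_def Int_def)
  also have "\<dots> = (\<Sum>c<p. real ((n choose M) * (p - 1) ^ (n - M)))"
    by (intro sum.cong refl) (subst card_full_bin, auto)
  also have "\<dots> = exp_bins M n p * real p ^ n" using assms by (simp add: exp_bins_def of_nat_diff)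
  finally show ?thesis .
qed

lemma sum_full_bins_sq:
  assumes "p \<ge> 2"
  shows "(\<Sum>u\<in>residue_vectors n p. real (card (full_bins M n p u)) ^ 2) =
     exp_bins M n p * real p ^ n
     + real p * (real p - 1) * real ((n choose M) * ((n - M) choose M)) * (real p - 2) ^ (n - 2 * M)"
proof -
  let ?b = "\<lambda>u c. of_bool (card (bin n u c) = M) :: real"
  let ?V = "residue_vectors n p"
  have card: "real (card (full_bins M n p u)) = (\<Sum>c<p. ?b u c)" for u
    by (simp add: sum.If_cases of_bool_def full_bins_def Int_def conj_commute)
  have sq: "real (card (full_bins M n p u)) ^ 2 = (\<Sum>c<p. ?b u c) + (\<Sum>c<p. \<Sum>c'\<in>{..<p} - {c}. ?b u c * ?b u c')" for u
  proof -
    have "real (card (full_bins M n p u)) ^ 2 = (\<Sum>c<p. \<Sum>c'<p. ?b u c * ?b u c')"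
      unfolding card power2_eq_square sum_product ..
    also have "\<dots> = (\<Sum>c<p. ?b u c * ?b u c + (\<Sum>c'\<in>{..<p} - {c}. ?b u c * ?b u c'))"
      by (intro sum.cong refl sum.remove) auto
    also have "\<dots> = (\<Sum>c<p. ?b u c + (\<Sum>c'\<in>{..<p} - {c}. ?b u c * ?b u c'))"
      by (intro sum.cong refl) auto
    finally show ?thesis by (simp only: sum.distrib)
  qed
  have "(\<Sum>u\<in>?V. real (card (full_bins M n p u)) ^ 2)
      = (\<Sum>u\<in>?V. (\<Sum>c<p. ?b u c) + (\<Sum>c<p. \<Sum>c'\<in>{..<p} - {c}. ?b u c * ?b u c'))"
    by (rule sum.cong[OF refl sq])
  also have "\<dots> = (\<Sum>u\<in>?V. \<Sum>c<p. ?b u c) + (\<Sum>u\<in>?V. \<Sum>c<p. \<Sum>c'\<in>{..<p} - {c}. ?b u c * ?b u c')"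
    by (rule sum.distrib)
  also have "(\<Sum>u\<in>?V. \<Sum>c<p. ?b u c) = exp_bins M n p * real p ^ n"
    using sum_full_bins[of p M n] assms by (simp only: card)
  also have "(\<Sum>u\<in>?V. \<Sum>c<p. \<Sum>c'\<in>{..<p} - {c}. ?b u c * ?b u c')
      = (\<Sum>c<p. \<Sum>u\<in>?V. \<Sum>c'\<in>{..<p} - {c}. ?b u c * ?b u c')" by (rule sum.swap)
  also have "\<dots> = (\<Sum>c<p. \<Sum>c'\<in>{..<p} - {c}. \<Sum>u\<in>?V. ?b u c * ?b u c')"
    by (intro sum.cong refl sum.swap)
  also have "\<dots> = (\<Sum>c<p. \<Sum>c'\<in>{..<p} - {c}. real ((n choose M) * ((n - M) choose M) * (p - 2) ^ (n - 2 * M)))"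
  proof (intro sum.cong refl)
    fix c c' assume "c \<in> {..<p}" "c' \<in> {..<p} - {c}"
    then have "card {u \<in> ?V. card (bin n u c) = M \<and> card (bin n u c') = M}
        = (n choose M) * ((n - M) choose M) * (p - 2) ^ (n - 2 * M)"
      by (intro card_two_full_bins) auto
    moreover have "(\<Sum>u\<in>?V. ?b u c * ?b u c') = (\<Sum>u\<in>?V. of_bool (card (bin n u c) = M \<and> card (bin n u c') = M))"
      by (intro sum.cong) auto
    moreover have "\<dots> = real (card {u \<in> ?V. card (bin n u c) = M \<and> card (bin n u c') = M})"
      by (simp add: sum.If_cases of_bool_def Int_def)
    ultimately show "(\<Sum>u\<in>?V. ?b u c * ?b u c') = real ((n choose M) * ((n - M) choose M) * (p - 2) ^ (n - 2 * M))"
      by simp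
  qed
  also have "\<dots> = real p * (real p - 1) * real ((n choose M) * ((n - M) choose M)) * (real p - 2) ^ (n - 2 * M)"
    using assms by (simp add: of_nat_diff)
  finally show ?thesis .
qed

text \<open>The relative variance of the number of full bins is small, because two different values modulo
  \<open>p\<close> are full almost independently of each other.\<close>

lemma full_bins_variance:
  assumes p: "p \<ge> 2" "p \<ge> 4 * M" and M: "M \<ge> 1" "2 * M \<le> n"
  shows "(\<Sum>u\<in>residue_vectors n p. (real (card (full_bins M n p u)) / exp_bins M n p - 1) ^ 2)
     \<le> (1 / exp_bins M n p + 8 * real M / real p) * real p ^ n"
proof -
  define t where "t = exp_bins M n p"
  define q where "q = real p - 1"
  define Cn where "Cn = real (n choose M)"
  define Cm where "Cm = real ((n - M) choose M)"
  have q: "q \<ge> 1" "q > 0" using p by (auto simp: q_def)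
  have Cn: "Cn > 0" using M by (simp add: Cn_def)
  have CC: "Cm \<le> Cn" unfolding Cm_def Cn_def by (simp add: binomial_right_mono)
  have t: "t = real p * Cn * q ^ (n - M) / real p ^ n" by (simp add: t_def exp_bins_def q_def Cn_def)
  have t0: "t > 0" unfolding t using q Cn p by simp
  have pairs: "real p * q * (Cn * Cm) * (real p - 2) ^ (n - 2 * M) \<le> t ^ 2 * (1 + 8 * real M / real p) * real p ^ n"
  proof -
    define k where "k = n - 2 * M"
    have nk: "n = k + 2 * M" "n - M = k + M" using M by (auto simp: k_def)
    \<comment> \<open>This is where the near independence of two bins comes from: the number \<open>(p - 2) ^ k\<close> for a
      pair is compared with \<open>(p - 1) ^ (2 * k) / p ^ k\<close> for two independent bins.\<close>
    have "(real p - 2) * real p \<le> q ^ 2" by (simp add: q_def power2_eq_square algebra_simps)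
    then have "((real p - 2) * real p) ^ k \<le> (q ^ 2) ^ k" using p by (intro power_mono) auto
    then have 1: "(real p - 2) ^ k * real p ^ k \<le> q ^ (2 * k)" by (simp add: power_mult_distrib power_mult)
    \<comment> \<open>The remaining \<open>2 * M\<close> factors cost at most \<open>(1 + 1 / (p - 1)) ^ (2 * M)\<close>, and \<open>4 * M \<le> p\<close>.\<close>
    have 2: "real p ^ (2 * M) \<le> (1 + 8 * real M / real p) * q ^ (2 * M)"
    proof -
      define x where "x = 2 * real M / q"
      have "2 * real M \<le> q" using p M unfolding q_def by linarith
      then have x: "0 \<le> x" "x \<le> 1" using q by (auto simp: x_def field_simps)
      have "real p / q = 1 + 1 / q" using q by (simp add: q_def field_simps)
      also have "\<dots> \<le> exp (1 / q)" by simp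
      finally have "(real p / q) ^ (2 * M) \<le> exp (1 / q) ^ (2 * M)" using q by (intro power_mono) auto
      also have "\<dots> = exp x" by (simp add: x_def flip: exp_of_nat_mult)
      also have "\<dots> \<le> 1 + x + x ^ 2" using x by (intro exp_bound) auto
      also have "\<dots> \<le> 1 + 2 * x" using x by (simp add: power2_eq_square mult_left_le)
      also have "2 * x \<le> 8 * real M / real p"
      proof -
        have "real p \<le> 2 * q" using p by (simp add: q_def)
        then have "4 * real M / q \<le> 4 * real M / (real p / 2)" using p q by (intro divide_left_mono) auto
        then show ?thesis by (simp add: x_def)
      qed
      finally show ?thesis using q by (simp add: power_divide field_simps)
    qed
    have "real p * q * (Cn * Cm) * (real p - 2) ^ k * real p ^ n
        = real p * q * (Cn * Cm) * ((real p - 2) ^ k * real p ^ k) * real p ^ (2 * M)"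
      by (simp add: nk power_add)
    also have "\<dots> \<le> real p * real p * (Cn * Cn) * q ^ (2 * k) * ((1 + 8 * real M / real p) * q ^ (2 * M))"
      using p q Cn CC 1 2 by (intro mult_mono mult_nonneg_nonneg) (auto simp: q_def Cm_def)
    also have "\<dots> = (t * real p ^ n) ^ 2 * (1 + 8 * real M / real p)"
      using p by (simp add: t nk power2_eq_square power_add power_mult mult_ac)
    finally have "real p * q * (Cn * Cm) * (real p - 2) ^ k * real p ^ n
       \<le> t ^ 2 * (1 + 8 * real M / real p) * real p ^ n * real p ^ n"
      by (simp add: power2_eq_square mult_ac)
    then show ?thesis using p by (simp add: k_def)
  qed
  have "(\<Sum>u\<in>residue_vectors n p. (real (card (full_bins M n p u)) / t - 1) ^ 2)
     = (\<Sum>u\<in>residue_vectors n p. real (card (full_bins M n p u)) ^ 2) / t ^ 2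
       - 2 * (\<Sum>u\<in>residue_vectors n p. real (card (full_bins M n p u))) / t + real p ^ n"
  proof -
    have "(x / t - 1) ^ 2 = x ^ 2 / t ^ 2 - 2 * x / t + 1" for x
      by (simp add: power2_diff power_divide)
    then show ?thesis
      by (simp only: sum.distrib sum_subtractf sum_divide_distrib[symmetric] sum_distrib_left[symmetric])
         (simp add: card_residue_vectors)
  qed
  also have "\<dots> = (t * real p ^ n + real p * q * (Cn * Cm) * (real p - 2) ^ (n - 2 * M)) / t ^ 2 - real p ^ n"
    using p t0 by (simp add: sum_full_bins sum_full_bins_sq t_def[symmetric] q_def Cn_def Cm_def)
  also have "\<dots> \<le> (t * real p ^ n + t ^ 2 * (1 + 8 * real M / real p) * real p ^ n) / t ^ 2 - real p ^ n"
    using pairs by (intro diff_right_mono divide_right_mono add_left_mono) auto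
  also have "\<dots> = (1 / t + 8 * real M / real p) * real p ^ n"
    using t0 p by (simp add: field_simps power2_eq_square)
  finally show ?thesis by (simp add: t_def)
qed

lemma bij_betw_residue_vectors_crt:
  assumes "coprime p p'" "p \<ge> 1" "p' \<ge> 1"
  shows "bij_betw (\<lambda>u. (restrict (\<lambda>i. u i mod p) {..<n}, restrict (\<lambda>i. u i mod p') {..<n}))
     (residue_vectors n (p * p')) (residue_vectors n p \<times> residue_vectors n p')" (is "bij_betw ?f ?A ?B")
proof -
  have inj: "inj_on ?f ?A"
  proof (rule inj_onI)
    fix u v assume uv: "u \<in> ?A" "v \<in> ?A" "?f u = ?f v"
    show "u = v"
    proof (rule PiE_ext)
      show "u \<in> PiE {..<n} (\<lambda>_. {..<p*p'})" "v \<in> PiE {..<n} (\<lambda>_. {..<p*p'})"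
        using uv by (auto simp: residue_vectors_def)
      fix i assume i: "i \<in> {..<n}"
      have "u i mod p = v i mod p" "u i mod p' = v i mod p'"
        using uv(3) i by (auto simp: fun_eq_iff restrict_def split: if_splits)
      then have "[u i = v i] (mod (p * p'))"
        using assms by (auto simp: cong_def intro: coprime_cong_mult_nat[unfolded cong_def])
      moreover have "u i < p * p'" "v i < p * p'" using uv i by (auto simp: residue_vectors_def PiE_iff)
      ultimately show "u i = v i" by (simp add: cong_def)
    qed
  qed
  moreover have "?f ` ?A \<subseteq> ?B" using assms by (intro image_subsetI) (simp add: residue_vectors_def)
  moreover have "card ?A = card ?B" by (simp add: card_residue_vectors power_mult_distrib)
  ultimately have "?f ` ?A = ?B"
    by (intro card_subset_eq) (auto simp: card_image)
  then show ?thesis using inj by (simp add: bij_betw_def)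
qed

lemma sum_residue_vectors_crt:
  fixes g h :: "(nat \<Rightarrow> nat) \<Rightarrow> real"
  assumes "coprime p p'" "p \<ge> 1" "p' \<ge> 1"
  shows "(\<Sum>u\<in>residue_vectors n (p * p'). g (restrict (\<lambda>i. u i mod p) {..<n}) * h (restrict (\<lambda>i. u i mod p') {..<n}))
    = (\<Sum>v\<in>residue_vectors n p. g v) * (\<Sum>w\<in>residue_vectors n p'. h w)"
proof -
  have "(\<Sum>u\<in>residue_vectors n (p * p'). g (restrict (\<lambda>i. u i mod p) {..<n}) * h (restrict (\<lambda>i. u i mod p') {..<n}))
     = (\<Sum>x\<in>residue_vectors n p \<times> residue_vectors n p'. g (fst x) * h (snd x))"
    using sum.reindex_bij_betw[OF bij_betw_residue_vectors_crt[OF assms, of n], of "\<lambda>x. g (fst x) * h (snd x)"]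
    by simp
  also have "\<dots> = (\<Sum>v\<in>residue_vectors n p. \<Sum>w\<in>residue_vectors n p'. g v * h w)"
    by (simp add: sum.cartesian_product case_prod_beta)
  finally show ?thesis by (simp add: sum_product)
qed

lemma card_coinciding_residue_vectors:
  assumes "i < n" "j < n" "i \<noteq> j"
  shows "card {u \<in> residue_vectors n d. u i = u j} = d ^ (n - 1)"
proof -
  define P where "P c = PiE {..<n} (\<lambda>k. if k \<in> {i, j} then {c} else {..<d})" for c
  have Pij: "u i = c" "u j = c" if "u \<in> P c" for u c
    using PiE_mem[OF that[unfolded P_def], of i] PiE_mem[OF that[unfolded P_def], of j] assms by simp_all
  have Pd: "u k < d" if "u \<in> P c" "c < d" "k < n" for u c k
    using PiE_mem[OF that(1)[unfolded P_def], of k] that by (simp split: if_splits)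
  have "{u \<in> residue_vectors n d. u i = u j} = (\<Union>c\<in>{..<d}. P c)"
  proof (intro equalityI subsetI)
    fix u assume "u \<in> {u \<in> residue_vectors n d. u i = u j}"
    then have u: "u \<in> PiE {..<n} (\<lambda>_. {..<d})" "u i = u j" by (auto simp: residue_vectors_def)
    have "u i < d" using PiE_mem[OF u(1), of i] assms by simp
    moreover have "u \<in> P (u i)" using u unfolding P_def by (simp add: PiE_iff)
    ultimately show "u \<in> (\<Union>c\<in>{..<d}. P c)" by blast
  next
    fix u assume "u \<in> (\<Union>c\<in>{..<d}. P c)"
    then obtain c where c: "c < d" "u \<in> P c" by blast
    have "u \<in> extensional {..<n}" using c(2) by (simp add: P_def PiE_iff)
    then show "u \<in> {u \<in> residue_vectors n d. u i = u j}"
      using c Pd[OF c(2) c(1)] Pij[OF c(2)] by (simp add: residue_vectors_def PiE_iff)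
  qed
  also have "card \<dots> = (\<Sum>c<d. card (P c))"
  proof (rule card_UN_disjoint)
    show "\<forall>c\<in>{..<d}. \<forall>c'\<in>{..<d}. c \<noteq> c' \<longrightarrow> P c \<inter> P c' = {}"
      using Pij by blast
    show "\<forall>c\<in>{..<d}. finite (P c)" unfolding P_def by (intro ballI finite_PiE) simp_all
  qed simp
  also have "\<dots> = (\<Sum>c<d. d ^ (n - 2))"
  proof (rule sum.cong[OF refl])
    fix c
    have "card (P c) = (\<Prod>k<n. if k \<in> {i, j} then 1 else d)"
      unfolding P_def by (subst card_PiE) (simp, intro prod.cong, simp_all)
    also have "\<dots> = d ^ card ({..<n} - {i, j})"
      by (rule prod_if_1_const) simp
    also have "card ({..<n} - {i, j}) = n - 2" using assms by (subst card_Diff_subset) auto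
    finally show "card (P c) = d ^ (n - 2)" .
  qed
  also have "\<dots> = d ^ (n - 1)"
  proof -
    have "n - 1 = Suc (n - 2)" using assms by linarith
    then show ?thesis by simp
  qed
  finally show ?thesis .
qed

section \<open>Moments for almost uniform residues\<close>

text \<open>An upper bound for the probability of every single pattern of residues is enough to bound the
  expectation of any nonnegative function of the residues by a constant times its sum over all
  residue vectors.\<close>

lemma residue_vector_expectation:
  fixes X :: "nat \<Rightarrow> 'a \<Rightarrow> nat" and \<phi> :: "(nat \<Rightarrow> nat) \<Rightarrow> real"
  assumes P: "prob_space P" and X: "\<And>i. i < n \<Longrightarrow> X i \<in> measurable P (count_space UNIV)"
    and d: "d \<ge> 1"
    and quasi: "\<And>c. measure P {a \<in> space P. \<forall>i<n. X i a mod d = c i} \<le> C"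
    and nn: "\<And>u. u \<in> residue_vectors n d \<Longrightarrow> \<phi> u \<ge> 0"
  shows "integrable P (\<lambda>a. \<phi> (restrict (\<lambda>i. X i a mod d) {..<n}))"
    and "(\<integral>a. \<phi> (restrict (\<lambda>i. X i a mod d) {..<n}) \<partial>P) \<le> C * (\<Sum>u\<in>residue_vectors n d. \<phi> u)"
proof -
  interpret prob_space P by (rule P)
  define E where "E u = {a \<in> space P. \<forall>i<n. X i a mod d = u i}" for u
  have E: "E u \<in> sets P" for u
  proof -
    have "(\<lambda>a. X i a mod d) \<in> measurable P (count_space UNIV)" if "i < n" for i
      using measurable_compose[OF X[OF that], of "\<lambda>x. x mod d"] by simp
    then have "(\<lambda>a. X i a mod d) -` {u i} \<inter> space P \<in> sets P" if "i < n" for i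
      using that by (intro measurable_sets[of _ P "count_space UNIV"]) auto
    moreover have "(\<lambda>a. X i a mod d) -` {u i} \<inter> space P = {a \<in> space P. X i a mod d = u i}" for i
      by auto
    ultimately have *: "{a \<in> space P. X i a mod d = u i} \<in> sets P" if "i < n" for i
      using that by simp
    have "{a \<in> space P. \<forall>i\<in>{..<n}. X i a mod d = u i} \<in> sets P"
      by (intro sets.sets_Collect_finite_All *) auto
    moreover have "E u = {a \<in> space P. \<forall>i\<in>{..<n}. X i a mod d = u i}" unfolding E_def by blast
    ultimately show ?thesis by (simp only:)
  qed
  have eq: "\<phi> (restrict (\<lambda>i. X i a mod d) {..<n}) = (\<Sum>u\<in>residue_vectors n d. \<phi> u * indicator (E u) a)"
    if "a \<in> space P" for a
  proof -
    let ?u = "restrict (\<lambda>i. X i a mod d) {..<n}"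
    have u: "?u \<in> residue_vectors n d" using d by (simp add: residue_vectors_def)
    have "indicator (E u) a = (if u = ?u then 1 else 0 :: real)" if "u \<in> residue_vectors n d" for u
    proof -
      have "u \<in> extensional {..<n}" using that by (simp add: residue_vectors_def PiE_iff)
      then have "(\<forall>i<n. X i a mod d = u i) \<longleftrightarrow> u = ?u"
        by (auto simp: fun_eq_iff restrict_def extensional_def)
      then show ?thesis using \<open>a \<in> space P\<close> by (simp add: E_def indicator_def)
    qed
    then have "(\<Sum>u\<in>residue_vectors n d. \<phi> u * indicator (E u) a)
        = (\<Sum>u\<in>residue_vectors n d. if u = ?u then \<phi> u else 0)"
      by (intro sum.cong refl) auto
    then show ?thesis using u by (simp add: sum.delta')
  qed
  have int: "integrable P (\<lambda>a. \<Sum>u\<in>residue_vectors n d. \<phi> u * indicator (E u) a)"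
    using E by (intro Bochner_Integration.integrable_sum) (simp add: emeasure_eq_measure)
  show "integrable P (\<lambda>a. \<phi> (restrict (\<lambda>i. X i a mod d) {..<n}))"
    using int by (subst Bochner_Integration.integrable_cong[OF refl eq]) auto
  have "(\<integral>a. \<phi> (restrict (\<lambda>i. X i a mod d) {..<n}) \<partial>P) = (\<integral>a. (\<Sum>u\<in>residue_vectors n d. \<phi> u * indicator (E u) a) \<partial>P)"
    by (rule Bochner_Integration.integral_cong[OF refl eq])
  also have "\<dots> = (\<Sum>u\<in>residue_vectors n d. \<phi> u * measure P (E u))"
    using E by (subst Bochner_Integration.integral_sum) (auto simp: emeasure_eq_measure)
  also have "\<dots> \<le> (\<Sum>u\<in>residue_vectors n d. \<phi> u * C)"
    using nn quasi by (intro sum_mono mult_left_mono) (auto simp: E_def)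
  finally show "(\<integral>a. \<phi> (restrict (\<lambda>i. X i a mod d) {..<n}) \<partial>P) \<le> C * (\<Sum>u\<in>residue_vectors n d. \<phi> u)"
    by (simp add: sum_distrib_left mult.commute)
qed

text \<open>If two of the numbers agree modulo at least \<open>h\<close> primes, then they agree modulo the product of
  some \<open>h\<close> of them. The union bound over all such products loses only
  \<open>exp (2 * (\<Sum>q\<in>Q. 1 / q)) / 2 ^ h\<close>.\<close>

lemma prob_many_common_primes:
  fixes X :: "nat \<Rightarrow> 'a \<Rightarrow> nat"
  assumes P: "prob_space P" and X: "\<And>i. i < n \<Longrightarrow> X i \<in> measurable P (count_space UNIV)"
    and Q: "finite Q" "\<And>q. q \<in> Q \<Longrightarrow> prime q" and n: "n \<ge> 1" and \<delta>: "\<delta> \<ge> 0"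
    and quasi: "\<And>B c. B \<subseteq> Q \<Longrightarrow> card B = h \<Longrightarrow>
       measure P {a \<in> space P. \<forall>i<n. X i a mod \<Prod>B = c i} \<le> (1 + \<delta>) / real (\<Prod>B) ^ n"
  shows "\<exists>N\<in>sets P. measure P N \<le> real n ^ 2 * (1 + \<delta>) * exp (2 * (\<Sum>q\<in>Q. 1 / real q)) / 2 ^ h \<and>
     (\<forall>a\<in>space P - N. \<forall>i<n. \<forall>j<n. i \<noteq> j \<longrightarrow> card {q\<in>Q. X i a mod q = X j a mod q} < h)"
proof -
  interpret prob_space P by (rule P)
  define Bs where "Bs = {B. B \<subseteq> Q \<and> card B = h}"
  have finBs: "finite Bs" using Q by (auto simp: Bs_def)
  define J where "J = {(i,j). i < n \<and> j < n \<and> i \<noteq> j}"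
  have finJ: "finite J" by (rule finite_subset[of _ "{..<n} \<times> {..<n}"]) (auto simp: J_def)
  define E where "E B z = {a \<in> space P. X (fst z) a mod \<Prod>B = X (snd z) a mod \<Prod>B}" for B z
  define N where "N = (\<Union>z\<in>J. \<Union>B\<in>Bs. E B z)"
  have E: "E B z \<in> sets P" if "z \<in> J" for B z
  proof -
    have "fst z < n" "snd z < n" using that by (auto simp: J_def)
    note [measurable] = X[OF this(1)] X[OF this(2)]
    show ?thesis unfolding E_def by measurable
  qed
  have mE: "measure P (E B z) \<le> (1 + \<delta>) / real (\<Prod>B)" if z: "z \<in> J" and B: "B \<in> Bs" for B z
  proof -
    obtain i j where ij: "z = (i, j)" "i < n" "j < n" "i \<noteq> j" using z by (auto simp: J_def)
    have d1: "\<Prod>B \<ge> 1" using B Q by (auto simp: Bs_def Suc_le_eq intro!: prod_pos) (meson prime_gt_0_nat subsetD)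
    let ?\<phi> = "\<lambda>u. of_bool (u i = u j) :: real"
    have "measure P (E B z) = (\<integral>a. indicator (E B z) a \<partial>P)" using E[OF z] by simp
    also have "\<dots> = (\<integral>a. ?\<phi> (restrict (\<lambda>i. X i a mod \<Prod>B) {..<n}) \<partial>P)"
      using ij by (intro Bochner_Integration.integral_cong) (auto simp: E_def indicator_def)
    also have "\<dots> \<le> (1 + \<delta>) / real (\<Prod>B) ^ n * (\<Sum>u\<in>residue_vectors n (\<Prod>B). ?\<phi> u)"
      by (rule residue_vector_expectation(2)[OF P X]) (use d1 quasi B in \<open>auto simp: Bs_def\<close>)
    also have "(\<Sum>u\<in>residue_vectors n (\<Prod>B). ?\<phi> u) = real (card {u \<in> residue_vectors n (\<Prod>B). u i = u j})"
      by (simp add: sum.If_cases of_bool_def Int_def)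
    also have "\<dots> = real (\<Prod>B) ^ (n - 1)" using ij by (simp add: card_coinciding_residue_vectors)
    also have "(1 + \<delta>) / real (\<Prod>B) ^ n * real (\<Prod>B) ^ (n - 1) = (1 + \<delta>) / real (\<Prod>B)"
    proof -
      have "x / D ^ n * D ^ (n - 1) = x / D" if "D > 0" for x D :: real
        using that n by (cases n) auto
      moreover have "real (\<Prod>B) > 0" using d1 by linarith
      ultimately show ?thesis by blast
    qed
    finally show ?thesis .
  qed
  have sumB: "(\<Sum>B\<in>Bs. 1 / real (\<Prod>B)) \<le> exp (2 * (\<Sum>q\<in>Q. 1 / real q)) / 2 ^ h"
  proof -
    \<comment> \<open>Rankin's trick: the weight \<open>2 ^ h\<close> turns the sum over \<open>h\<close>-element sets into part of an Euler
      product.\<close>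
    have "2 ^ h * (\<Sum>B\<in>Bs. 1 / real (\<Prod>B)) = (\<Sum>B\<in>Bs. \<Prod>q\<in>B. 2 / real q)"
      by (simp add: sum_distrib_left prod_dividef Bs_def prod_constant)
    also have "\<dots> \<le> (\<Sum>B\<in>Pow Q. \<Prod>q\<in>B. 2 / real q)"
      using Q by (intro sum_mono2) (auto simp: Bs_def intro!: prod_nonneg)
    also have "\<dots> = (\<Prod>q\<in>Q. 2 / real q + 1)"
      using Q by (subst prod_add) auto
    also have "\<dots> \<le> (\<Prod>q\<in>Q. exp (2 / real q))"
      by (intro prod_mono) (auto intro: exp_ge_add_one_self simp: add.commute)
    also have "\<dots> = exp (2 * (\<Sum>q\<in>Q. 1 / real q))" using Q by (simp add: exp_sum sum_distrib_left)
    finally show ?thesis by (simp add: field_simps)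
  qed
  have "measure P N \<le> (\<Sum>z\<in>J. measure P (\<Union>B\<in>Bs. E B z))"
    unfolding N_def using finJ finBs E by (intro measure_UNION_le) auto
  also have "\<dots> \<le> (\<Sum>z\<in>J. \<Sum>B\<in>Bs. measure P (E B z))"
    using finBs E by (intro sum_mono measure_UNION_le) auto
  also have "\<dots> \<le> (\<Sum>z\<in>J. \<Sum>B\<in>Bs. (1 + \<delta>) * (1 / real (\<Prod>B)))"
    using mE by (intro sum_mono) auto
  also have "\<dots> = real (card J) * ((1 + \<delta>) * (\<Sum>B\<in>Bs. 1 / real (\<Prod>B)))"
    by (simp add: sum_distrib_left)
  also have "\<dots> \<le> real n ^ 2 * ((1 + \<delta>) * (exp (2 * (\<Sum>q\<in>Q. 1 / real q)) / 2 ^ h))"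
  proof (intro mult_mono sumB order.refl)
    have "card J \<le> card ({..<n} \<times> {..<n})" by (intro card_mono) (auto simp: J_def)
    then show "real (card J) \<le> real n ^ 2" by (simp add: power2_eq_square flip: of_nat_mult)
  qed (use \<delta> in \<open>auto intro!: mult_nonneg_nonneg sum_nonneg prod_nonneg\<close>)
  finally have mN: "measure P N \<le> real n ^ 2 * (1 + \<delta>) * exp (2 * (\<Sum>q\<in>Q. 1 / real q)) / 2 ^ h" by simp
  have "card {q\<in>Q. X i a mod q = X j a mod q} < h"
    if a: "a \<in> space P - N" and ij: "i < n" "j < n" "i \<noteq> j" for a i j
  proof (rule ccontr)
    assume "\<not> ?thesis"
    then have "h \<le> card {q\<in>Q. X i a mod q = X j a mod q}" by simp
    then obtain B where B: "B \<subseteq> {q\<in>Q. X i a mod q = X j a mod q}" "card B = h" "finite B"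
      by (rule obtain_subset_with_card_n)
    have "[X i a = X j a] (mod \<Prod>q\<in>B. q)"
      by (rule coprime_cong_prod_nat) (use B Q in \<open>auto simp: cong_def intro!: primes_coprime\<close>)
    then have "a \<in> E B (i, j)" using a by (auto simp: E_def cong_def)
    moreover have "(i, j) \<in> J" "B \<in> Bs" using ij B by (auto simp: J_def Bs_def)
    ultimately have "a \<in> N" by (auto simp: N_def)
    then show False using a by simp
  qed
  moreover have "N \<in> sets P" unfolding N_def using finJ finBs E by (intro sets.finite_UN) auto
  ultimately show ?thesis using mN by blast
qed

lemma full_bins_second_moment:
  fixes X :: "nat \<Rightarrow> 'a \<Rightarrow> nat"
  assumes P: "prob_space P" and X: "\<And>i. i < n \<Longrightarrow> X i \<in> measurable P (count_space UNIV)"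
    and p: "p \<ge> 2" "p \<ge> 4 * M" and M: "M \<ge> 1" "2 * M \<le> n" and \<delta>: "\<delta> \<ge> 0"
    and quasi: "\<And>c. measure P {a \<in> space P. \<forall>i<n. X i a mod p = c i} \<le> (1 + \<delta>) / real p ^ n"
  defines "F \<equiv> \<lambda>a. (real (card (full_bins M n p (restrict (\<lambda>i. X i a mod p) {..<n}))) / exp_bins M n p - 1) ^ 2"
  shows "integrable P F" "(\<integral>a. F a \<partial>P) \<le> (1 + \<delta>) * (1 / exp_bins M n p + 8 * real M / real p)"
proof -
  show "integrable P F" unfolding F_def
    by (rule residue_vector_expectation(1)[OF P X _ quasi, where \<phi> = "\<lambda>u. (real (card (full_bins M n p u)) / exp_bins M n p - 1) ^ 2"])
       (use p in auto)
  have "(\<integral>a. F a \<partial>P) \<le> (1 + \<delta>) / real p ^ n * (\<Sum>u\<in>residue_vectors n p. (real (card (full_bins M n p u)) / exp_bins M n p - 1) ^ 2)"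
    unfolding F_def
    by (rule residue_vector_expectation(2)[OF P X _ quasi, where \<phi> = "\<lambda>u. (real (card (full_bins M n p u)) / exp_bins M n p - 1) ^ 2"])
       (use p in auto)
  also have "\<dots> \<le> (1 + \<delta>) / real p ^ n * ((1 / exp_bins M n p + 8 * real M / real p) * real p ^ n)"
    using p M \<delta> by (intro mult_left_mono full_bins_variance) auto
  finally show "(\<integral>a. F a \<partial>P) \<le> (1 + \<delta>) * (1 / exp_bins M n p + 8 * real M / real p)"
    using p by simp
qed

text \<open>The normalised indicators \<open>g p\<close> of the event that \<open>r\<close> lies in a full bin modulo \<open>p\<close> are almost
  uncorrelated for different primes. For exactly uniform residues they are independent with mean
  zero by the Chinese remainder theorem. Since only upper bounds for probabilities are assumed, the
  product \<open>g p * g p'\<close> is shifted by \<open>1 / m ^ 2\<close> to make it nonnegative, which costs \<open>\<delta> / m ^ 2\<close>.\<close>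

lemma in_full_bin_covariance:
  fixes X :: "nat \<Rightarrow> 'a \<Rightarrow> nat"
  assumes P: "prob_space P" and X: "\<And>i. i < n \<Longrightarrow> X i \<in> measurable P (count_space UNIV)"
    and p: "p \<ge> 1" "p' \<ge> 1" and r: "r < n" and M: "M \<ge> 1" and \<delta>: "\<delta> \<ge> 0"
    and m: "0 < m" "m \<le> 1" "m \<le> prob_full M n p" "m \<le> prob_full M n p'"
    and quasi: "\<And>c. measure P {a \<in> space P. \<forall>i<n. X i a mod p = c i} \<le> (1 + \<delta>) / real p ^ n"
    and quasi2: "\<And>c. p \<noteq> p' \<Longrightarrow> measure P {a \<in> space P. \<forall>i<n. X i a mod (p * p') = c i} \<le> (1 + \<delta>) / real (p * p') ^ n"
    and cop: "p \<noteq> p' \<Longrightarrow> coprime p p'"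
  defines "g \<equiv> \<lambda>p a. of_bool (in_full_bin M n (restrict (\<lambda>i. X i a mod p) {..<n}) r) / prob_full M n p - (1::real)"
  shows "integrable P (\<lambda>a. g p a * g p' a)"
    "(\<integral>a. g p a * g p' a \<partial>P) \<le> (if p = p' then (1 + \<delta>) / m else \<delta> / m ^ 2)"
proof -
  interpret prob_space P by (rule P)
  define \<phi> where "\<phi> p u = of_bool (in_full_bin M n u r) / prob_full M n p - (1::real)" for p u
  have g: "g p a = \<phi> p (restrict (\<lambda>i. X i a mod p) {..<n})" for p a by (simp add: g_def \<phi>_def)
  have sum\<phi>: "(\<Sum>u\<in>residue_vectors n p. \<phi> p u) = 0" if "p \<ge> 1" "m \<le> prob_full M n p" for p
    using sum_in_full_bin[of r n M p] that r M m
    by (simp add: \<phi>_def sum_subtractf card_residue_vectors flip: sum_divide_distrib)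
  have "integrable P (\<lambda>a. g p a * g p' a) \<and>
    (\<integral>a. g p a * g p' a \<partial>P) \<le> (if p = p' then (1 + \<delta>) / m else \<delta> / m ^ 2)"
  proof (cases "p = p'")
    case True
    note E = residue_vector_expectation[OF P X _ quasi, where \<phi> = "\<lambda>u. \<phi> p u * \<phi> p u"]
    have "(\<integral>a. g p a * g p a \<partial>P) \<le> (1 + \<delta>) / real p ^ n * (\<Sum>u\<in>residue_vectors n p. \<phi> p u * \<phi> p u)"
      unfolding g by (rule E(2)) (use p in auto)
    also have "\<dots> \<le> (1 + \<delta>) / real p ^ n * (real p ^ n / m)"
    proof (intro mult_left_mono)
      have "\<phi> p u * \<phi> p u \<le> of_bool (in_full_bin M n u r) / prob_full M n p / m - \<phi> p u - of_bool (in_full_bin M n u r) / prob_full M n p" for u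
      proof (cases "in_full_bin M n u r")
        case True
        define x where "x = 1 / prob_full M n p"
        have x: "x \<le> 1 / m" "x > 0" using m by (auto simp: x_def field_simps)
        have "x * x \<le> x * (1 / m)" using x by (intro mult_left_mono) auto
        moreover have "\<phi> p u = x - 1" "of_bool (in_full_bin M n u r) / prob_full M n p = x"
          using True by (auto simp: \<phi>_def x_def)
        ultimately show ?thesis by (simp only:) (simp add: algebra_simps)
      qed (simp add: \<phi>_def)
      then have "(\<Sum>u\<in>residue_vectors n p. \<phi> p u * \<phi> p u) \<le>
         (\<Sum>u\<in>residue_vectors n p. of_bool (in_full_bin M n u r) / prob_full M n p / m - \<phi> p u - of_bool (in_full_bin M n u r) / prob_full M n p)"
        by (intro sum_mono)
      also have "\<dots> \<le> real p ^ n / m"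
        using sum_in_full_bin[of r n M p] sum\<phi>[of p] r M m p
        by (simp add: sum_subtractf flip: sum_divide_distrib)
      finally show "(\<Sum>u\<in>residue_vectors n p. \<phi> p u * \<phi> p u) \<le> real p ^ n / m" .
    qed (use \<delta> in auto)
    also have "\<dots> = (1 + \<delta>) / m" using p by simp
    finally have "(\<integral>a. g p a * g p a \<partial>P) \<le> (1 + \<delta>) / m" .
    moreover have "integrable P (\<lambda>a. g p a * g p a)" unfolding g by (rule E(1)) (use p in auto)
    ultimately show ?thesis using True by simp
  next
    case False
    let ?d = "p * p'"
    define \<psi> where "\<psi> u = \<phi> p (restrict (\<lambda>i. u i mod p) {..<n}) * \<phi> p' (restrict (\<lambda>i. u i mod p') {..<n}) + 1 / m ^ 2" for u
    have abs: "\<bar>\<phi> p u\<bar> \<le> 1 / m" if "m \<le> prob_full M n p" for p u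
    proof -
      define x where "x = 1 / prob_full M n p"
      have "1 \<le> 1 / m" using m by simp
      moreover have "0 < x" "x \<le> 1 / m" using m that by (auto simp: x_def field_simps)
      moreover have "\<phi> p u = (if in_full_bin M n u r then x else 0) - 1" by (simp add: \<phi>_def x_def)
      ultimately show ?thesis by (cases "in_full_bin M n u r") (simp_all only: abs_le_iff if_True if_False, linarith+)
    qed
    have nn: "\<psi> u \<ge> 0" for u
    proof -
      have "\<bar>\<phi> p (restrict (\<lambda>i. u i mod p) {..<n}) * \<phi> p' (restrict (\<lambda>i. u i mod p') {..<n})\<bar> \<le> (1 / m) * (1 / m)"
        unfolding abs_mult using m by (intro mult_mono abs) auto
      then show ?thesis by (simp add: \<psi>_def power2_eq_square)
    qed
    have eq: "\<psi> (restrict (\<lambda>i. X i a mod ?d) {..<n}) = g p a * g p' a + 1 / m ^ 2" for a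
      by (simp add: \<psi>_def g mod_mod_cancel restrict_def cong: if_cong)
    note E = residue_vector_expectation[OF P X _ quasi2[OF False], where \<phi> = \<psi>]
    have int: "integrable P (\<lambda>a. g p a * g p' a + 1 / m ^ 2)"
      unfolding eq[symmetric] by (rule E(1)) (use p nn in auto)
    have "integrable P (\<lambda>a. (g p a * g p' a + 1 / m ^ 2) - 1 / m ^ 2)"
      by (intro Bochner_Integration.integrable_diff int) simp
    then have int': "integrable P (\<lambda>a. g p a * g p' a)" by simp
    have "(\<integral>a. g p a * g p' a + 1 / m ^ 2 \<partial>P) \<le> (1 + \<delta>) / real ?d ^ n * (\<Sum>u\<in>residue_vectors n ?d. \<psi> u)"
      unfolding eq[symmetric] by (rule E(2)) (use p nn in auto)
    also have "(\<Sum>u\<in>residue_vectors n ?d. \<psi> u) = real ?d ^ n / m ^ 2"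
      unfolding \<psi>_def sum.distrib sum_residue_vectors_crt[OF cop[OF False] p]
      unfolding sum\<phi>[OF p(1) m(3)] by (simp add: card_residue_vectors power_mult_distrib)
    also have "(1 + \<delta>) / real ?d ^ n * (real ?d ^ n / m ^ 2) = (1 + \<delta>) / m ^ 2" using p by simp
    also have "(\<integral>a. g p a * g p' a + 1 / m ^ 2 \<partial>P) = (\<integral>a. g p a * g p' a \<partial>P) + 1 / m ^ 2"
      using int' by (simp add: prob_space)
    finally show ?thesis using False int' by (simp add: add_divide_distrib)
  qed
  then show "integrable P (\<lambda>a. g p a * g p' a)"
    "(\<integral>a. g p a * g p' a \<partial>P) \<le> (if p = p' then (1 + \<delta>) / m else \<delta> / m ^ 2)" by auto
qed

text \<open>By Markov's inequality, outside a set of small probability the number of full bins modulo \<open>p\<close>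
  is close to its mean for most \<open>p \<in> R\<close>, and most positions \<open>r\<close> lie in full bins for about the
  expected number of \<open>p \<in> R\<close>.\<close>

lemma prob_irregular_full_bins:
  fixes X :: "nat \<Rightarrow> 'a \<Rightarrow> nat"
  assumes P: "prob_space P" and X: "\<And>i. i < n \<Longrightarrow> X i \<in> measurable P (count_space UNIV)"
    and R: "finite R" "R \<noteq> {}" "\<And>p. p \<in> R \<Longrightarrow> prime p \<and> 4 * M \<le> p \<and> L \<le> real p" and L: "L > 0"
    and M: "M \<ge> 1" "2 * M \<le> n" and \<delta>: "0 \<le> \<delta>" "\<delta> \<le> 1" and \<kappa>: "\<kappa> > 0"
    and m: "0 < m" "m \<le> 1" "\<And>p. p \<in> R \<Longrightarrow> m \<le> prob_full M n p"
    and quasi: "\<And>p c. p \<in> R \<Longrightarrow> measure P {a \<in> space P. \<forall>i<n. X i a mod p = c i} \<le> (1 + \<delta>) / real p ^ n"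
    and quasi2: "\<And>p p' c. p \<in> R \<Longrightarrow> p' \<in> R \<Longrightarrow> p \<noteq> p' \<Longrightarrow>
       measure P {a \<in> space P. \<forall>i<n. X i a mod (p * p') = c i} \<le> (1 + \<delta>) / real (p * p') ^ n"
  defines "u \<equiv> \<lambda>a p. restrict (\<lambda>i. X i a mod p) {..<n}"
  shows "\<exists>N\<in>sets P. measure P N \<le> (2 * real M / (real n * m) + 16 * real M / L) / \<kappa>
        + (2 / (real (card R) * m) + \<delta> / m ^ 2) / \<kappa> \<and>
     (\<forall>a\<in>space P - N.
        (\<Sum>p\<in>R. (real (card (full_bins M n p (u a p))) / exp_bins M n p - 1) ^ 2) \<le> \<kappa> * real (card R) \<and>
        (\<Sum>r<n. ((\<Sum>p\<in>R. of_bool (in_full_bin M n (u a p) r) / prob_full M n p) - real (card R)) ^ 2)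
           \<le> \<kappa> * real n * real (card R) ^ 2)"
proof -
  interpret prob_space P by (rule P)
  define s where "s = real (card R)"
  have s: "s \<ge> 1" using R by (simp add: s_def Suc_le_eq card_gt_0_iff)
  have n: "n \<ge> 1" using M by linarith
  have p2: "p \<ge> 2" if "p \<in> R" for p using R(3)[OF that] prime_ge_2_nat by auto
  have t: "real M / (real n * m) \<ge> 1 / exp_bins M n p" if "p \<in> R" for p
  proof -
    have "real n * m \<le> real M * exp_bins M n p"
      using prob_full_exp_bins[of M n p] m(3)[OF that] M n by (metis mult_left_mono of_nat_0_le_iff)
    moreover have "exp_bins M n p > 0"
      using calculation m n M by (smt (verit) mult_nonneg_nonpos mult_pos_pos of_nat_0_le_iff of_nat_0_less_iff One_nat_def Suc_le_eq)
    ultimately show ?thesis using m n M by (simp add: field_simps)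
  qed
  define F1 where "F1 a = (\<Sum>p\<in>R. (real (card (full_bins M n p (u a p))) / exp_bins M n p - 1) ^ 2)" for a
  define g where "g r p a = of_bool (in_full_bin M n (u a p) r) / prob_full M n p - (1::real)" for r p a
  define F2 where "F2 a = (\<Sum>r<n. (\<Sum>p\<in>R. g r p a) ^ 2)" for a
  have E1: "integrable P F1 \<and> (\<integral>a. F1 a \<partial>P) \<le> s * (2 * real M / (real n * m) + 16 * real M / L)"
  proof -
    have E: "integrable P (\<lambda>a. (real (card (full_bins M n p (u a p))) / exp_bins M n p - 1) ^ 2)"
      "(\<integral>a. (real (card (full_bins M n p (u a p))) / exp_bins M n p - 1) ^ 2 \<partial>P)
          \<le> (1 + \<delta>) * (1 / exp_bins M n p + 8 * real M / real p)" if "p \<in> R" for p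
      unfolding u_def using full_bins_second_moment[OF P X p2[OF that] _ M \<delta>(1) quasi[OF that]] R(3)[OF that]
      by auto
    have "(\<integral>a. F1 a \<partial>P) = (\<Sum>p\<in>R. \<integral>a. (real (card (full_bins M n p (u a p))) / exp_bins M n p - 1) ^ 2 \<partial>P)"
      unfolding F1_def by (intro Bochner_Integration.integral_sum E(1))
    also have "\<dots> \<le> (\<Sum>p\<in>R. 2 * real M / (real n * m) + 16 * real M / L)"
    proof (rule sum_mono)
      fix p assume p: "p \<in> R"
      have "8 * real M / real p \<le> 8 * real M / L" using R(3)[OF p] L by (intro divide_left_mono) auto
      then have "1 / exp_bins M n p + 8 * real M / real p \<le> real M / (real n * m) + 8 * real M / L"
        using t[OF p] by linarith
      moreover have "0 \<le> real M / (real n * m) + 8 * real M / L" using m L by simp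
      moreover have "(1 + \<delta>) * (real M / (real n * m) + 8 * real M / L) \<le> 2 * (real M / (real n * m) + 8 * real M / L)"
        using \<delta> calculation(2) by (intro mult_right_mono) auto
      moreover have "(1 + \<delta>) * (1 / exp_bins M n p + 8 * real M / real p) \<le> (1 + \<delta>) * (real M / (real n * m) + 8 * real M / L)"
        using \<delta> calculation(1) by (intro mult_left_mono) auto
      ultimately have "(1 + \<delta>) * (1 / exp_bins M n p + 8 * real M / real p) \<le> 2 * (real M / (real n * m) + 8 * real M / L)"
        by linarith
      moreover have "(\<integral>a. (real (card (full_bins M n p (u a p))) / exp_bins M n p - 1) ^ 2 \<partial>P)
          \<le> (1 + \<delta>) * (1 / exp_bins M n p + 8 * real M / real p)"
        by (rule E(2)[OF p])
      ultimately show "(\<integral>a. (real (card (full_bins M n p (u a p))) / exp_bins M n p - 1) ^ 2 \<partial>P)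
          \<le> 2 * real M / (real n * m) + 16 * real M / L" by (simp add: algebra_simps)
    qed
    finally show ?thesis unfolding F1_def
      by (auto simp: s_def intro!: Bochner_Integration.integrable_sum E(1))
  qed
  have E2: "integrable P F2 \<and> (\<integral>a. F2 a \<partial>P) \<le> real n * (2 * s / m + s ^ 2 * \<delta> / m ^ 2)"
  proof -
    have F2: "F2 a = (\<Sum>r<n. \<Sum>p\<in>R. \<Sum>p'\<in>R. g r p a * g r p' a)" for a
      by (simp add: F2_def power2_eq_square sum_product)
    have cov: "integrable P (\<lambda>a. g r p a * g r p' a) \<and>
       (\<integral>a. g r p a * g r p' a \<partial>P) \<le> (if p = p' then (1 + \<delta>) / m else \<delta> / m ^ 2)"
      if "r < n" "p \<in> R" "p' \<in> R" for r p p'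
    proof -
      have *: "p \<ge> 1" "p' \<ge> 1" using p2[OF that(2)] p2[OF that(3)] by auto
      have **: "p \<noteq> p' \<Longrightarrow> coprime p p'" using R(3)[OF that(2)] R(3)[OF that(3)] by (auto intro: primes_coprime)
      show ?thesis unfolding g_def u_def
        using in_full_bin_covariance[OF P X * that(1) M(1) \<delta>(1) m(1,2) m(3)[OF that(2)] m(3)[OF that(3)]
            quasi[OF that(2)] quasi2[OF that(2,3)] **] by blast
    qed
    have "(\<integral>a. F2 a \<partial>P) = (\<Sum>r<n. \<Sum>p\<in>R. \<Sum>p'\<in>R. \<integral>a. g r p a * g r p' a \<partial>P)"
      unfolding F2 using cov by (simp add: Bochner_Integration.integral_sum Bochner_Integration.integrable_sum)
    also have "\<dots> \<le> (\<Sum>r<n. \<Sum>p\<in>R. \<Sum>p'\<in>R. (if p = p' then 2 / m else 0) + \<delta> / m ^ 2)"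
    proof (intro sum_mono)
      fix r p p' assume "r \<in> {..<n}" "p \<in> R" "p' \<in> R"
      then have "(\<integral>a. g r p a * g r p' a \<partial>P) \<le> (if p = p' then (1 + \<delta>) / m else \<delta> / m ^ 2)"
        using cov by auto
      also have "\<dots> \<le> (if p = p' then 2 / m else 0) + \<delta> / m ^ 2"
      proof -
        have "(1 + \<delta>) / m \<le> 2 / m" using \<delta> m by (intro divide_right_mono) auto
        moreover have "0 \<le> \<delta> / m ^ 2" using \<delta> by simp
        ultimately show ?thesis by (cases "p = p'") auto
      qed
      finally show "(\<integral>a. g r p a * g r p' a \<partial>P) \<le> (if p = p' then 2 / m else 0) + \<delta> / m ^ 2" .
    qed
    also have "\<dots> = real n * (2 * s / m + s ^ 2 * \<delta> / m ^ 2)"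
    proof -
      have "(\<Sum>p'\<in>R. (if p = p' then 2 / m else 0) + \<delta> / m ^ 2) = 2 / m + s * (\<delta> / m ^ 2)" if "p \<in> R" for p
        using R that by (simp add: sum.distrib s_def sum.delta)
      then have "(\<Sum>p\<in>R. \<Sum>p'\<in>R. (if p = p' then 2 / m else 0) + \<delta> / m ^ 2) = s * (2 / m + s * (\<delta> / m ^ 2))"
        by (simp add: s_def)
      then show ?thesis by (simp add: power2_eq_square distrib_left mult_ac)
    qed
    finally show ?thesis unfolding F2 using cov
      by (auto intro!: Bochner_Integration.integrable_sum)
  qed
  define N1 where "N1 = {a \<in> space P. F1 a \<ge> \<kappa> * s}"
  define N2 where "N2 = {a \<in> space P. F2 a \<ge> \<kappa> * real n * s ^ 2}"
  have [measurable]: "F1 \<in> borel_measurable P" "F2 \<in> borel_measurable P" using E1 E2 by auto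
  have N1: "N1 \<in> sets P" unfolding N1_def by measurable
  have N2: "N2 \<in> sets P" unfolding N2_def by measurable
  have "measure P N1 \<le> (\<integral>a. F1 a \<partial>P) / (\<kappa> * s)"
  proof -
    have "AE a in P. 0 \<le> F1 a" by (simp add: F1_def sum_nonneg)
    moreover have "0 < \<kappa> * s" using \<kappa> s by simp
    ultimately show ?thesis
      unfolding N1_def by (rule integral_Markov_inequality_measure[OF conjunct1[OF E1] sets.top])
  qed
  also have "\<dots> \<le> s * (2 * real M / (real n * m) + 16 * real M / L) / (\<kappa> * s)"
    using E1 \<kappa> s by (intro divide_right_mono) auto
  also have "\<dots> = (2 * real M / (real n * m) + 16 * real M / L) / \<kappa>" using s by simp
  finally have m1: "measure P N1 \<le> (2 * real M / (real n * m) + 16 * real M / L) / \<kappa>" .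
  have "measure P N2 \<le> (\<integral>a. F2 a \<partial>P) / (\<kappa> * real n * s ^ 2)"
  proof -
    have "AE a in P. 0 \<le> F2 a" by (simp add: F2_def sum_nonneg)
    moreover have "0 < \<kappa> * real n * s ^ 2" using \<kappa> s n by simp
    ultimately show ?thesis
      unfolding N2_def by (rule integral_Markov_inequality_measure[OF conjunct1[OF E2] sets.top])
  qed
  also have "\<dots> \<le> real n * (2 * s / m + s ^ 2 * \<delta> / m ^ 2) / (\<kappa> * real n * s ^ 2)"
    using E2 \<kappa> s by (intro divide_right_mono) auto
  also have "\<dots> = (2 / (s * m) + \<delta> / m ^ 2) / \<kappa>"
    using s n \<kappa> m by (simp add: field_simps power2_eq_square)
  finally have m2: "measure P N2 \<le> (2 / (s * m) + \<delta> / m ^ 2) / \<kappa>" .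
  have "measure P (N1 \<union> N2) \<le> measure P N1 + measure P N2"
    using N1 N2 by (rule measure_Un_le)
  then have "measure P (N1 \<union> N2) \<le> (2 * real M / (real n * m) + 16 * real M / L) / \<kappa> + (2 / (s * m) + \<delta> / m ^ 2) / \<kappa>"
    using m1 m2 by linarith
  moreover have "F1 a \<le> \<kappa> * s \<and> F2 a \<le> \<kappa> * real n * s ^ 2" if "a \<in> space P - (N1 \<union> N2)" for a
    using that by (auto simp: N1_def N2_def)
  moreover have "F2 a = (\<Sum>r<n. ((\<Sum>p\<in>R. of_bool (in_full_bin M n (u a p) r) / prob_full M n p) - real (card R)) ^ 2)" for a
    by (simp add: F2_def g_def sum_subtractf)
  ultimately show ?thesis using N1 N2 unfolding F1_def s_def by (intro bexI[of _ "N1 \<union> N2"]) auto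
qed

section \<open>Averages over the residues of the sieve primes\<close>

text \<open>The mean of \<open>f\<close> over the finite set \<open>A\<close>; the random choices below are all uniform on finite
  sets.\<close>

definition avg :: "'c set \<Rightarrow> ('c \<Rightarrow> real) \<Rightarrow> real" where
  "avg A f = (\<Sum>c\<in>A. f c) / real (card A)"

lemma avg_mono: "(\<And>c. c \<in> A \<Longrightarrow> f c \<le> g c) \<Longrightarrow> avg A f \<le> avg A g"
  by (simp add: avg_def sum_mono divide_right_mono)

lemma avg_add: "avg A (\<lambda>c. f c + g c) = avg A f + avg A g"
  by (simp add: avg_def sum.distrib add_divide_distrib)

lemma avg_diff: "avg A (\<lambda>c. f c - g c) = avg A f - avg A g"
  by (simp add: avg_def sum_subtractf diff_divide_distrib)

lemma avg_cmult: "avg A (\<lambda>c. k * f c) = k * avg A f"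
  by (simp add: avg_def sum_distrib_left[symmetric])

lemma avg_sum: "avg A (\<lambda>c. \<Sum>i\<in>I. f i c) = (\<Sum>i\<in>I. avg A (f i))"
  unfolding avg_def by (subst sum.swap) (simp add: sum_divide_distrib)

lemma avg_const: "finite A \<Longrightarrow> A \<noteq> {} \<Longrightarrow> avg A (\<lambda>c. k) = k"
  by (simp add: avg_def)

lemma avg_le_exists:
  assumes "finite A" "A \<noteq> {}"
  shows "\<exists>c\<in>A. f c \<le> avg A f"
proof (rule ccontr)
  assume "\<not> ?thesis"
  then have "\<And>c. c \<in> A \<Longrightarrow> avg A f < f c" by auto
  then have "(\<Sum>c\<in>A. avg A f) < (\<Sum>c\<in>A. f c)" using assms by (intro sum_strict_mono) auto
  then show False using assms by (simp add: avg_def)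
qed

lemma sum_inverse_squares_le:
  assumes "finite Q" "\<And>q. q \<in> Q \<Longrightarrow> z < q" "z \<ge> 1"
  shows "(\<Sum>q\<in>Q. 1 / real q ^ 2) \<le> 1 / real z"
proof -
  obtain N where N: "Q \<subseteq> {z<..N}" "z \<le> N"
  proof -
    have "Q \<subseteq> {z<..Max (insert z Q)}" "z \<le> Max (insert z Q)" using assms by auto
    then show ?thesis using that by blast
  qed
  have "(\<Sum>q\<in>Q. 1 / real q ^ 2) \<le> (\<Sum>q\<in>{z<..N}. 1 / real q ^ 2)"
    using N by (intro sum_mono2) auto
  also have "\<dots> \<le> (\<Sum>q\<in>{z<..N}. 1 / real (q - 1) - 1 / real q)"
  proof (rule sum_mono)
    fix q assume "q \<in> {z<..N}"
    then have q: "real q > 1" "real (q - 1) = real q - 1" using assms by (auto simp: of_nat_diff)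
    have "1 / real (q - 1) - 1 / real q = 1 / ((real q - 1) * real q)" using q by (simp add: field_simps)
    also have "\<dots> \<ge> 1 / real q ^ 2" using q unfolding power2_eq_square
      by (intro divide_left_mono mult_right_mono) auto
    finally show "1 / real q ^ 2 \<le> 1 / real (q - 1) - 1 / real q" .
  qed
  also have "\<dots> = 1 / real z - 1 / real N"
    using N(2)
  proof (induction N rule: dec_induct)
    case (step k)
    have "{z<..Suc k} = insert (Suc k) {z<..k}" using step by auto
    then show ?case using step by simp
  qed simp
  also have "\<dots> \<le> 1 / real z" by simp
  finally show ?thesis .
qed

text \<open>All choices of one residue \<open>c q\<close> for every sieve prime \<open>q\<close>.\<close>

definition sieve_space :: "nat set \<Rightarrow> (nat \<Rightarrow> nat) set" where
  "sieve_space Q = PiE Q (\<lambda>q. {..<q})"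

text \<open>The positions \<open>i < n\<close> for which \<open>x i\<close> avoids all chosen residues.\<close>

definition survivors :: "nat set \<Rightarrow> nat \<Rightarrow> (nat \<Rightarrow> nat) \<Rightarrow> (nat \<Rightarrow> nat) \<Rightarrow> nat set" where
  "survivors Q n x c = {i. i < n \<and> (\<forall>q\<in>Q. c q \<noteq> x i mod q)}"

lemma sieve_space_finite:
  assumes "finite Q" "\<And>q. q \<in> Q \<Longrightarrow> prime q"
  shows "finite (sieve_space Q)" "sieve_space Q \<noteq> {}"
  using assms by (auto simp: sieve_space_def finite_PiE PiE_eq_empty_iff dest!: prime_gt_0_nat)

lemma survival_probability:
  assumes "finite Q" "\<And>q. q \<in> Q \<Longrightarrow> prime q" "I \<subseteq> {..<n}"
  shows "avg (sieve_space Q) (\<lambda>c. of_bool (I \<subseteq> survivors Q n x c))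
     = (\<Prod>q\<in>Q. 1 - real (card ((\<lambda>i. x i mod q) ` I)) / real q)"
proof -
  have q0: "q > 0" if "q \<in> Q" for q using assms that prime_gt_0_nat by auto
  have "(\<Sum>c\<in>sieve_space Q. of_bool (I \<subseteq> survivors Q n x c) :: real)
      = real (card {c \<in> sieve_space Q. I \<subseteq> survivors Q n x c})"
    using sieve_space_finite[OF assms(1,2)] by (simp add: sum.If_cases of_bool_def Int_def)
  also have "{c \<in> sieve_space Q. I \<subseteq> survivors Q n x c} = PiE Q (\<lambda>q. {..<q} - (\<lambda>i. x i mod q) ` I)"
    using assms(3) by (fastforce simp: sieve_space_def survivors_def PiE_iff extensional_def)
  also have "real (card \<dots>) = (\<Prod>q\<in>Q. real q - real (card ((\<lambda>i. x i mod q) ` I)))"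
  proof -
    have fI: "finite I" using assms(3) finite_subset by blast
    have "real (card ({..<q} - (\<lambda>i. x i mod q) ` I)) = real q - real (card ((\<lambda>i. x i mod q) ` I))" if "q \<in> Q" for q
    proof -
      have sub: "(\<lambda>i. x i mod q) ` I \<subseteq> {..<q}" using q0[OF that] by auto
      then have "card ((\<lambda>i. x i mod q) ` I) \<le> q" using card_mono[OF _ sub] by simp
      then show ?thesis using fI sub by (simp add: card_Diff_subset of_nat_diff)
    qed
    then show ?thesis using assms(1) by (simp add: card_PiE)
  qed
  finally have "avg (sieve_space Q) (\<lambda>c. of_bool (I \<subseteq> survivors Q n x c))
     = (\<Prod>q\<in>Q. real q - real (card ((\<lambda>i. x i mod q) ` I))) / (\<Prod>q\<in>Q. real q)"
    using assms(1) by (simp add: avg_def sieve_space_def card_PiE)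
  also have "\<dots> = (\<Prod>q\<in>Q. 1 - real (card ((\<lambda>i. x i mod q) ` I)) / real q)"
    unfolding prod_dividef[symmetric] using q0 by (intro prod.cong refl) (auto simp: field_simps)
  finally show ?thesis .
qed

text \<open>The number of values that \<open>f\<close> loses on \<open>I\<close> is at most the number of its coincidences.\<close>

lemma card_minus_card_image_le:
  fixes f :: "nat \<Rightarrow> nat"
  assumes "finite I"
  shows "card I - card (f ` I) \<le> card {z \<in> I \<times> I. fst z < snd z \<and> f (fst z) = f (snd z)}" (is "_ \<le> card ?C")
proof -
  define D where "D = snd ` ?C"
  have D: "D \<subseteq> I" by (auto simp: D_def)
  have finC: "finite ?C" using assms by simp
  have "inj_on f (I - D)"
  proof (rule inj_onI)
    fix i j assume *: "i \<in> I - D" "j \<in> I - D" "f i = f j"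
    have "\<not> i < j"
    proof
      assume "i < j"
      then have "(i, j) \<in> ?C" using * by auto
      then have "j \<in> D" unfolding D_def by force
      then show False using * by auto
    qed
    moreover have "\<not> j < i"
    proof
      assume "j < i"
      then have "(j, i) \<in> ?C" using * by auto
      then have "i \<in> D" unfolding D_def by force
      then show False using * by auto
    qed
    ultimately show "i = j" by simp
  qed
  then have "card (I - D) = card (f ` (I - D))" by (simp add: card_image)
  also have "\<dots> \<le> card (f ` I)" using assms by (intro card_mono) auto
  finally have "card I - card D \<le> card (f ` I)"
    using D assms by (simp add: card_Diff_subset finite_subset)
  moreover have "card D \<le> card ?C" unfolding D_def using finC by (rule card_image_le)
  ultimately show ?thesis by linarith
qed

text \<open>If no two of the numbers \<open>x i\<close> agree modulo many sieve primes, then small sets \<open>I\<close> survive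
  almost with the probability \<open>W ^ card I\<close> of independent events. A prime \<open>q\<close> contributes the factor
  \<open>1 - \<nu> q / q\<close>, where \<open>\<nu> q\<close> is the number of residues that \<open>I\<close> occupies. The lower bound uses
  \<open>\<nu> q \<le> card I\<close>; in the upper bound the total defect \<open>\<Sum>q\<in>Q. card I - \<nu> q\<close> is at most the number of
  coincidences.\<close>

lemma survival_probability_bounds:
  fixes x :: "nat \<Rightarrow> nat" and Q :: "nat set"
  assumes Q: "finite Q" "\<And>q. q \<in> Q \<Longrightarrow> prime q" "\<And>q. q \<in> Q \<Longrightarrow> z < q" "z \<ge> 1"
    and I: "I \<subseteq> {..<n}" "card I \<le> k" and z: "2 * k \<le> z" "2 * real k ^ 2 * real h \<le> real z" and h: "h \<ge> 1"
    and coll: "\<And>i j. i \<in> I \<Longrightarrow> j \<in> I \<Longrightarrow> i \<noteq> j \<Longrightarrow> card {q\<in>Q. x i mod q = x j mod q} \<le> h"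
  defines "W \<equiv> (\<Prod>q\<in>Q. 1 - 1 / real q)"
    and "p \<equiv> avg (sieve_space Q) (\<lambda>c. of_bool (I \<subseteq> survivors Q n x c))"
  shows "W ^ card I * (1 - 4 * real k ^ 2 * real h / real z) \<le> p"
    and "p \<le> W ^ card I * (1 + 4 * real k ^ 2 * real h / real z)"
proof -
  define l where "l = card I"
  define \<nu> where "\<nu> q = card ((\<lambda>i. x i mod q) ` I)" for q
  have fI: "finite I" using I finite_subset by blast
  have lk: "l \<le> k" using I by (simp add: l_def)
  have q2: "real q \<ge> 2" if "q \<in> Q" for q using Q(2)[OF that] prime_ge_2_nat[of q] by simp
  have \<nu>l: "\<nu> q \<le> l" for q using fI by (simp add: \<nu>_def l_def card_image_le)
  have p: "p = (\<Prod>q\<in>Q. 1 - real (\<nu> q) / real q)"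
    unfolding p_def \<nu>_def using Q I by (intro survival_probability) auto
  have lz: "2 * real l \<le> real z" using lk z(1) by linarith
  have W0: "W \<ge> 0" unfolding W_def by (intro prod_nonneg) (use q2 in \<open>force simp: field_simps\<close>)
  have half: "real l / real q \<le> 1 / 2" if "q \<in> Q" for q
    using Q(3)[OF that] lz q2[OF that] by (simp add: field_simps)
  show "W ^ card I * (1 - 4 * real k ^ 2 * real h / real z) \<le> p"
  proof -
    have "W ^ l * (1 - 4 * real k ^ 2 * real h / real z) \<le> W ^ l * exp (- 2 * real l ^ 2 * (\<Sum>q\<in>Q. 1 / real q ^ 2))"
    proof (intro mult_left_mono)
      have "2 * real l ^ 2 * (\<Sum>q\<in>Q. 1 / real q ^ 2) \<le> 2 * real k ^ 2 * (1 / real z)"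
        using lk sum_inverse_squares_le[of Q z] Q by (intro mult_mono power_mono) (auto intro: sum_nonneg)
      also have "\<dots> \<le> 4 * real k ^ 2 * real h / real z"
        using h Q(4) mult_mono[of 2 "4 * real h" "real k ^ 2" "real k ^ 2"]
        by (simp add: divide_right_mono mult_ac)
      finally have "1 - 4 * real k ^ 2 * real h / real z \<le> 1 + (- 2 * real l ^ 2 * (\<Sum>q\<in>Q. 1 / real q ^ 2))" by simp
      also have "\<dots> \<le> exp (- 2 * real l ^ 2 * (\<Sum>q\<in>Q. 1 / real q ^ 2))" by (rule exp_ge_add_one_self)
      finally show "1 - 4 * real k ^ 2 * real h / real z \<le> exp (- 2 * real l ^ 2 * (\<Sum>q\<in>Q. 1 / real q ^ 2))" .
    qed (use W0 in auto)
    also have "\<dots> = (\<Prod>q\<in>Q. (1 - 1 / real q) ^ l * exp (- 2 * real l ^ 2 * (1 / real q ^ 2)))"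
      using Q(1) by (simp add: W_def prod.distrib prod_power_distrib exp_sum sum_distrib_left)
    also have "\<dots> \<le> (\<Prod>q\<in>Q. 1 - real (\<nu> q) / real q)"
    proof (intro prod_mono conjI)
      fix q assume q: "q \<in> Q"
      show "0 \<le> (1 - 1 / real q) ^ l * exp (- 2 * real l ^ 2 * (1 / real q ^ 2))"
        using q2[OF q] by (simp add: field_simps)
      have "(1 - 1 / real q) ^ l \<le> exp (- (1 / real q)) ^ l"
        using q2[OF q] exp_ge_add_one_self[of "- (1 / real q)"] by (intro power_mono) (auto simp: field_simps)
      also have "\<dots> = exp (- (real l / real q))" by (simp flip: exp_of_nat_mult)
      finally have "(1 - 1 / real q) ^ l * exp (- 2 * real l ^ 2 * (1 / real q ^ 2))
          \<le> exp (- (real l / real q)) * exp (- 2 * real l ^ 2 * (1 / real q ^ 2))"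
        by (intro mult_right_mono) auto
      also have "\<dots> = exp (- (real l / real q) - 2 * (real l / real q) ^ 2)"
        by (simp add: power_divide flip: exp_add)
      also have "\<dots> \<le> exp (ln (1 - real l / real q))"
        using half[OF q] ln_one_minus_pos_lower_bound[of "real l / real q"] by simp
      also have "\<dots> = 1 - real l / real q"
      proof -
        have "real l / real q < 1" using half[OF q] by linarith
        then show ?thesis by simp
      qed
      also have "\<dots> \<le> 1 - real (\<nu> q) / real q" using \<nu>l[of q] q2[OF q] by (simp add: divide_right_mono)
      finally show "(1 - 1 / real q) ^ l * exp (- 2 * real l ^ 2 * (1 / real q ^ 2)) \<le> 1 - real (\<nu> q) / real q" .
    qed
    finally show ?thesis using p by (simp add: l_def)
  qed
  show "p \<le> W ^ card I * (1 + 4 * real k ^ 2 * real h / real z)"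
  proof -
    have "p \<le> (\<Prod>q\<in>Q. (1 - 1 / real q) ^ l * exp (2 / real z * real (l - \<nu> q)))"
      unfolding p
    proof (intro prod_mono conjI)
      fix q assume q: "q \<in> Q"
      have "real (\<nu> q) / real q \<le> real l / real q" using \<nu>l[of q] by (intro divide_right_mono) auto
      then show "0 \<le> 1 - real (\<nu> q) / real q" using half[OF q] by linarith
      define y where "y = 1 - 1 / real q"
      have y: "y > 0" using q2[OF q] by (simp add: y_def field_simps)
      have "1 - real (\<nu> q) / real q = 1 + real (\<nu> q) * (- (1 / real q))" by simp
      also have "\<dots> \<le> (1 + - (1 / real q)) ^ \<nu> q"
        using q2[OF q] by (intro Bernoulli_inequality) (auto simp: field_simps)
      also have "\<dots> = y ^ \<nu> q" by (simp add: y_def)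
      also have "\<dots> = y ^ l * (1 / y) ^ (l - \<nu> q)"
        using y \<nu>l[of q] by (simp add: power_divide field_simps flip: power_add)
      also have "\<dots> \<le> y ^ l * exp (2 / real z) ^ (l - \<nu> q)"
      proof (intro mult_left_mono power_mono)
        have "exp (- 2 * (1 / real q)) \<le> y" unfolding y_def
          using q2[OF q] by (intro one_minus_ge_exp) (auto simp: field_simps)
        then have "1 / y \<le> 1 / exp (- 2 * (1 / real q))" using y by (intro divide_left_mono) auto
        also have "\<dots> = exp (2 / real q)" by (simp add: exp_minus field_simps)
        also have "\<dots> \<le> exp (2 / real z)" using Q(3)[OF q] Q(4) by (simp add: frac_le)
        finally show "1 / y \<le> exp (2 / real z)" .
      qed (use y in auto)
      also have "exp (2 / real z) ^ (l - \<nu> q) = exp (2 / real z * real (l - \<nu> q))"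
        by (simp add: mult.commute flip: exp_of_nat_mult)
      finally show "1 - real (\<nu> q) / real q \<le> (1 - 1 / real q) ^ l * exp (2 / real z * real (l - \<nu> q))"
        by (simp add: y_def)
    qed
    also have "\<dots> = W ^ l * exp (2 / real z * (\<Sum>q\<in>Q. real (l - \<nu> q)))"
      using Q(1) by (simp add: W_def prod.distrib prod_power_distrib exp_sum sum_distrib_left)
    also have "\<dots> \<le> W ^ l * (1 + 4 * real k ^ 2 * real h / real z)"
    proof (intro mult_left_mono)
      let ?P = "{z \<in> I \<times> I. fst z < snd z}"
      have "(\<Sum>q\<in>Q. l - \<nu> q) \<le> (\<Sum>q\<in>Q. card {z \<in> I \<times> I. fst z < snd z \<and> x (fst z) mod q = x (snd z) mod q})"
        unfolding l_def \<nu>_def using fI by (intro sum_mono card_minus_card_image_le)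
      also have "\<dots> = (\<Sum>q\<in>Q. \<Sum>z\<in>?P. of_bool (x (fst z) mod q = x (snd z) mod q))"
        using fI by (intro sum.cong refl) (auto simp: sum.If_cases of_bool_def Int_def conj_assoc intro!: arg_cong[of _ _ card])
      also have "\<dots> = (\<Sum>z\<in>?P. \<Sum>q\<in>Q. of_bool (x (fst z) mod q = x (snd z) mod q))"
        by (rule sum.swap)
      also have "\<dots> = (\<Sum>z\<in>?P. card {q\<in>Q. x (fst z) mod q = x (snd z) mod q})"
        using Q(1) by (intro sum.cong refl) (auto simp: sum.If_cases of_bool_def Int_def)
      also have "\<dots> \<le> (\<Sum>z\<in>?P. h)" by (intro sum_mono coll) auto
      also have "\<dots> = card ?P * h" by simp
      also have "card ?P \<le> card (I \<times> I)" using fI by (intro card_mono) auto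
      finally have "(\<Sum>q\<in>Q. l - \<nu> q) \<le> l * l * h" by (simp add: l_def card_cartesian_product)
      also have "\<dots> \<le> k * k * h" using lk by (intro mult_mono) auto
      finally have "real (\<Sum>q\<in>Q. l - \<nu> q) \<le> real (k * k * h)" by (rule of_nat_mono)
      then have le: "(\<Sum>q\<in>Q. real (l - \<nu> q)) \<le> real k ^ 2 * real h" by (simp add: power2_eq_square)
      define t where "t = 2 / real z * (real k ^ 2 * real h)"
      have t: "0 \<le> t" "t \<le> 1" using z(2) Q(4) by (auto simp: t_def field_simps)
      have "exp (2 / real z * (\<Sum>q\<in>Q. real (l - \<nu> q))) \<le> exp t"
        unfolding exp_le_cancel_iff t_def
        using le by (intro mult_left_mono) auto
      also have "\<dots> \<le> 1 + t + t ^ 2" using t by (intro exp_bound) auto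
      also have "\<dots> \<le> 1 + 2 * t" using t by (simp add: power2_eq_square mult_left_le)
      finally show "exp (2 / real z * (\<Sum>q\<in>Q. real (l - \<nu> q))) \<le> 1 + 4 * real k ^ 2 * real h / real z"
        by (simp add: t_def)
    qed (use W0 in auto)
    finally show ?thesis by (simp add: l_def)
  qed
qed

section \<open>Edges that survive a random thinning\<close>

text \<open>The left side is \<open>(x - 1) ^ 2\<close> with perturbed coefficients; both second moments below have
  this form.\<close>

lemma perturbed_square_le:
  fixes x \<epsilon> \<kappa> :: real
  assumes "x \<ge> 0" "0 \<le> \<epsilon>" "0 \<le> \<kappa>" "\<epsilon> + \<kappa> \<le> 1"
  shows "(1 + \<epsilon>) * x ^ 2 + (1 + \<epsilon>) * (x * \<kappa>) - 2 * (1 - \<epsilon>) * x + (1 + \<epsilon>) \<le> 3 * (x - 1) ^ 2 + 8 * (\<epsilon> + \<kappa>)"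
proof -
  have "(1 + \<epsilon>) * (x * \<kappa>) \<le> 2 * (x * \<kappa>)" using assms by (intro mult_right_mono) auto
  then have "(1 + \<epsilon>) * x ^ 2 + (1 + \<epsilon>) * (x * \<kappa>) - 2 * (1 - \<epsilon>) * x + (1 + \<epsilon>)
      \<le> (x - 1) ^ 2 + \<epsilon> * (x + 1) ^ 2 + 2 * (x * \<kappa>)"
    by (simp add: power2_eq_square algebra_simps)
  also have "2 * (x * \<kappa>) \<le> \<kappa> * (x + 1) ^ 2"
    using assms mult_left_mono[of "2 * x" "(x + 1) ^ 2" \<kappa>] by (simp add: power2_eq_square algebra_simps)
  also have "(x - 1) ^ 2 + \<epsilon> * (x + 1) ^ 2 + \<kappa> * (x + 1) ^ 2 = (x - 1) ^ 2 + (\<epsilon> + \<kappa>) * (x + 1) ^ 2"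
    by (simp add: algebra_simps)
  also have "(x + 1) ^ 2 \<le> 2 * (x - 1) ^ 2 + 8"
  proof -
    have "2 * (x - 1) ^ 2 + 8 - (x + 1) ^ 2 = (x - 3) ^ 2" by (simp add: power2_eq_square algebra_simps)
    then show ?thesis by (metis diff_ge_0_iff_ge zero_le_power2)
  qed
  then have "(\<epsilon> + \<kappa>) * (x + 1) ^ 2 \<le> (\<epsilon> + \<kappa>) * (2 * (x - 1) ^ 2 + 8)" using assms by (intro mult_left_mono) auto
  also have "(\<epsilon> + \<kappa>) * (2 * (x - 1) ^ 2 + 8) \<le> 2 * (x - 1) ^ 2 + 8 * (\<epsilon> + \<kappa>)"
    using assms mult_right_mono[of "\<epsilon> + \<kappa>" 1 "2 * (x - 1) ^ 2"] by (simp add: distrib_left)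
  finally show ?thesis by simp
qed

text \<open>A random subset \<open>Rr c\<close> of the vertices \<open>{..<n}\<close>, with \<open>c\<close> uniform in \<open>Om\<close>, contains any set of
  at most \<open>2 * M\<close> vertices almost with the probability of a random set of density \<open>W\<close>. For every
  index \<open>p \<in> PP\<close> the set \<open>E p\<close> consists of pairwise disjoint edges with \<open>M\<close> vertices each, and
  \<open>mu p\<close> stands for the proportion of vertices that they cover. On average over \<open>p\<close>, respectively
  over the vertices, the number of edges is close to its ideal value \<open>n * mu p / M\<close> (\<open>A1\<close>), and the
  number of edges at a vertex, weighted by \<open>1 / mu p\<close>, is close to \<open>card PP\<close> (\<open>A2\<close>). Two vertices
  have at most \<open>h\<close> edges in common. The assumptions \<open>k1\<close> and \<open>k2\<close> make the contribution of dependent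
  pairs of edges negligible.\<close>

locale thinned_hypergraph =
  fixes Om :: "'c set" and Rr :: "'c \<Rightarrow> nat set" and E :: "nat \<Rightarrow> nat set set" and PP :: "nat set"
    and n M h :: nat and W \<epsilon> m \<kappa> :: real and mu :: "nat \<Rightarrow> real"
  assumes Om: "finite Om" "Om \<noteq> {}" and PP: "finite PP" "PP \<noteq> {}" and n: "n \<ge> 1" and M: "M \<ge> 2"
    and edge: "\<And>p e. p \<in> PP \<Longrightarrow> e \<in> E p \<Longrightarrow> e \<subseteq> {..<n} \<and> card e = M"
    and disj: "\<And>p e e'. p \<in> PP \<Longrightarrow> e \<in> E p \<Longrightarrow> e' \<in> E p \<Longrightarrow> e \<noteq> e' \<Longrightarrow> e \<inter> e' = {}"
    and codeg: "\<And>r t. r < n \<Longrightarrow> t < n \<Longrightarrow> r \<noteq> t \<Longrightarrow> (\<Sum>p\<in>PP. \<Sum>e\<in>E p. of_bool (r \<in> e \<and> t \<in> e)) \<le> real h"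
    and W: "0 < W" "W \<le> 1" and eps: "0 \<le> \<epsilon>" and kap: "0 \<le> \<kappa>" "\<epsilon> + \<kappa> \<le> 1"
    and prob: "\<And>I. I \<subseteq> {..<n} \<Longrightarrow> card I \<le> 2 * M \<Longrightarrow>
       W ^ card I * (1 - \<epsilon>) \<le> avg Om (\<lambda>c. of_bool (I \<subseteq> Rr c)) \<and> avg Om (\<lambda>c. of_bool (I \<subseteq> Rr c)) \<le> W ^ card I * (1 + \<epsilon>)"
    and m: "0 < m" "\<And>p. p \<in> PP \<Longrightarrow> m \<le> mu p"
    and A1: "(\<Sum>p\<in>PP. (real (card (E p)) / (real n * mu p / real M) - 1) ^ 2) \<le> \<kappa> * real (card PP)"
    and A2: "(\<Sum>r<n. ((\<Sum>p\<in>PP. (\<Sum>e\<in>E p. of_bool (r \<in> e)) / mu p) - real (card PP)) ^ 2) \<le> \<kappa> * real n * real (card PP) ^ 2"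
    and k1: "real M * real h \<le> \<kappa> * real (card PP) * m * W ^ (M - 1)"
    and k2: "real M \<le> \<kappa> * real n * m * W ^ M"
begin

text \<open>The number of indices.\<close>

definition s :: real where "s = real (card PP)"
text \<open>The ideal number of edges in \<open>E p\<close>.\<close>

definition t :: "nat \<Rightarrow> real" where "t p = real n * mu p / real M"
text \<open>The number of surviving edges of \<open>E p\<close> at the vertex \<open>r\<close>. It is at most \<open>1\<close>, but real-valued
  for use in averages.\<close>

definition N :: "nat \<Rightarrow> nat \<Rightarrow> 'c \<Rightarrow> real" where "N p r c = (\<Sum>e\<in>E p. of_bool (r \<in> e \<and> e \<subseteq> Rr c))"
text \<open>The number of surviving edges of \<open>E p\<close>, ideally \<open>t p * W ^ M\<close>.\<close>

definition T :: "nat \<Rightarrow> 'c \<Rightarrow> real" where "T p c = (\<Sum>e\<in>E p. of_bool (e \<subseteq> Rr c))"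
text \<open>The inverse of the probability with which a surviving edge of \<open>E p\<close> will be selected. The
  factor \<open>4\<close> leaves room for an excess of surviving edges, so that \<open>T p c \<le> w p\<close> for most \<open>p\<close>.\<close>

definition w :: "nat \<Rightarrow> real" where "w p = 4 * t p * W ^ M"
text \<open>The ideal value of the expected number of selected edges at a surviving vertex.\<close>

definition \<Lambda> :: real where "\<Lambda> = s * real M / (4 * real n * W)"
text \<open>The weighted number of surviving edges at \<open>r\<close>, normalised to be close to \<open>1\<close> for surviving
  \<open>r\<close>.\<close>

definition Z :: "nat \<Rightarrow> 'c \<Rightarrow> real" where "Z r c = (\<Sum>p\<in>PP. N p r c / mu p) / (s * W ^ (M - 1))"
text \<open>The weighted number of all edges at \<open>r\<close>, normalised to be close to \<open>1\<close>.\<close>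

definition S :: "nat \<Rightarrow> real" where "S r = (\<Sum>p\<in>PP. (\<Sum>e\<in>E p. of_bool (r \<in> e)) / mu p) / s"
text \<open>The number of surviving edges of \<open>E p\<close>, normalised to be close to \<open>1\<close>.\<close>

definition X :: "nat \<Rightarrow> 'c \<Rightarrow> real" where "X p c = T p c / (t p * W ^ M)"
text \<open>The probability that all vertices in \<open>I\<close> survive.\<close>

definition Pr :: "nat set \<Rightarrow> real" where "Pr I = avg Om (\<lambda>c. of_bool (I \<subseteq> Rr c))"

lemma s_pos: "s \<ge> 1" "s > 0"
  using PP by (auto simp: s_def Suc_le_eq card_gt_0_iff)

lemma mu_pos: "p \<in> PP \<Longrightarrow> mu p > 0"
  using m by force

lemma t_pos: "p \<in> PP \<Longrightarrow> t p > 0"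
  using mu_pos n M by (simp add: t_def)

lemma w_pos: "p \<in> PP \<Longrightarrow> w p > 0"
  using t_pos W by (simp add: w_def)

lemma \<Lambda>_pos: "\<Lambda> > 0"
  using s_pos n M W by (simp add: \<Lambda>_def)

lemma finE: "p \<in> PP \<Longrightarrow> finite (E p)"
  by (rule finite_subset[of _ "Pow {..<n}"]) (use edge in blast, simp)

lemma N_nonneg: "N p r c \<ge> 0"
  by (simp add: N_def sum_nonneg)

lemma N_le_T: "p \<in> PP \<Longrightarrow> N p r c \<le> T p c"
  unfolding N_def T_def by (intro sum_mono) auto

lemma N_outside: "r \<notin> Rr c \<Longrightarrow> N p r c = 0"
  unfolding N_def by (intro sum.neutral) auto

lemma sum_N: "p \<in> PP \<Longrightarrow> (\<Sum>r<n. N p r c) = real M * T p c"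
proof -
  assume p: "p \<in> PP"
  have "(\<Sum>r<n. N p r c) = (\<Sum>e\<in>E p. \<Sum>r<n. of_bool (r \<in> e \<and> e \<subseteq> Rr c))"
    unfolding N_def by (rule sum.swap)
  also have "\<dots> = (\<Sum>e\<in>E p. real M * of_bool (e \<subseteq> Rr c))"
  proof (intro sum.cong refl)
    fix e assume e: "e \<in> E p"
    have "(\<Sum>r<n. of_bool (r \<in> e \<and> e \<subseteq> Rr c) :: real) = of_bool (e \<subseteq> Rr c) * (\<Sum>r<n. of_bool (r \<in> e))"
      by (auto simp: sum_distrib_left intro!: sum.cong)
    also have "(\<Sum>r<n. of_bool (r \<in> e) :: real) = real (card ({..<n} \<inter> e))"
      by (simp add: sum.If_cases of_bool_def)
    also have "{..<n} \<inter> e = e" using edge[OF p e] by blast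
    finally show "(\<Sum>r<n. of_bool (r \<in> e \<and> e \<subseteq> Rr c)) = real M * of_bool (e \<subseteq> Rr c)"
      using edge[OF p e] by (simp add: mult.commute)
  qed
  finally show ?thesis by (simp add: T_def sum_distrib_left)
qed

lemma Z_altdef: "Z r c * \<Lambda> = (\<Sum>p\<in>PP. N p r c / w p)"
proof -
  have "Z r c * \<Lambda> = (\<Sum>p\<in>PP. N p r c / mu p * (\<Lambda> / (s * W ^ (M - 1))))"
    unfolding Z_def times_divide_eq_left times_divide_eq_right sum_divide_distrib sum_distrib_right ..
  also have "\<dots> = (\<Sum>p\<in>PP. N p r c / w p)"
  proof (intro sum.cong refl)
    fix p assume p: "p \<in> PP"
    have "W ^ M = W * W ^ (M - 1)" using M by (cases M) auto
    then have weq: "w p = 4 * (real n * mu p / real M) * (W * W ^ (M - 1))" by (simp add: w_def t_def)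
    show "N p r c / mu p * (\<Lambda> / (s * W ^ (M - 1))) = N p r c / w p"
      unfolding weq \<Lambda>_def using s_pos W mu_pos[OF p] n M by (simp add: field_simps)
  qed
  finally show ?thesis .
qed

text \<open>If for each \<open>p\<close> with \<open>T p c \<le> w p\<close> every surviving edge is selected with probability
  \<open>1 / w p\<close>, then the left side is the expected number of surviving vertices on no selected edge. A
  typical vertex contributes at most \<open>exp (- \<Lambda> / 4)\<close>; the exceptions are vertices with
  \<open>Z r c < 1 / 2\<close> and vertices that lose many edges to indices with \<open>T p c > w p\<close>.\<close>

lemma uncovered_pointwise:
  assumes c: "c \<in> Om"
  shows "(\<Sum>r\<in>{..<n} \<inter> Rr c. \<Prod>p\<in>{p\<in>PP. T p c \<le> w p}. 1 - N p r c / w p)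
    \<le> (\<Sum>r<n. of_bool (r \<in> Rr c)) * exp (- \<Lambda> / 4)
      + 4 * (\<Sum>r<n. of_bool (r \<in> Rr c) * (Z r c - 1) ^ 2)
      + 4 * real n * W / s * (\<Sum>p\<in>PP. (X p c - 1) ^ 2)"
proof -
  \<comment> \<open>\<open>Y1 r\<close> is what the vertex \<open>r\<close> loses to indices with too many surviving edges.\<close>
  define Y1 where "Y1 r = (\<Sum>p\<in>{p\<in>PP. \<not> T p c \<le> w p}. N p r c / w p)" for r
  have Y1: "Y1 r \<ge> 0" for r unfolding Y1_def
    using N_nonneg w_pos by (intro sum_nonneg divide_nonneg_nonneg) (auto simp: less_imp_le)
  have pw: "(\<Prod>p\<in>{p\<in>PP. T p c \<le> w p}. 1 - N p r c / w p) \<le> exp (- \<Lambda> / 4) + 4 * (Z r c - 1) ^ 2 + 4 / \<Lambda> * Y1 r" for r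
  proof -
    define Y where "Y = (\<Sum>p\<in>{p\<in>PP. T p c \<le> w p}. N p r c / w p)"
    have le1: "0 \<le> N p r c / w p" "N p r c / w p \<le> 1" if "p \<in> {p\<in>PP. T p c \<le> w p}" for p
      using that N_nonneg[of p r c] N_le_T[of p r c] w_pos[of p] by (auto simp: divide_simps)
    have "(\<Prod>p\<in>{p\<in>PP. T p c \<le> w p}. 1 - N p r c / w p) \<le> (\<Prod>p\<in>{p\<in>PP. T p c \<le> w p}. exp (- (N p r c / w p)))"
    proof (intro prod_mono conjI)
      fix p assume p: "p \<in> {p\<in>PP. T p c \<le> w p}"
      show "0 \<le> 1 - N p r c / w p" using le1(2)[OF p] by linarith
      show "1 - N p r c / w p \<le> exp (- (N p r c / w p))"
        using exp_ge_add_one_self[of "- (N p r c / w p)"] by linarith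
    qed
    also have "\<dots> = exp (- Y)" using PP by (simp add: exp_sum Y_def flip: sum_negf)
    finally have le: "(\<Prod>p\<in>{p\<in>PP. T p c \<le> w p}. 1 - N p r c / w p) \<le> exp (- Y)" .
    have Ynn: "Y \<ge> 0" unfolding Y_def using le1 by (intro sum_nonneg) auto
    have YZ: "Y + Y1 r = Z r c * \<Lambda>"
    proof -
      have "PP = {p\<in>PP. T p c \<le> w p} \<union> {p\<in>PP. \<not> T p c \<le> w p}" by auto
      then have "(\<Sum>p\<in>PP. N p r c / w p) = (\<Sum>p\<in>{p\<in>PP. T p c \<le> w p} \<union> {p\<in>PP. \<not> T p c \<le> w p}. N p r c / w p)" by simp
      also have "\<dots> = Y + Y1 r" unfolding Y_def Y1_def using PP by (subst sum.union_disjoint) auto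
      finally show ?thesis by (simp add: Z_altdef)
    qed
    show ?thesis
    proof (cases "Y \<ge> \<Lambda> / 4")
      case True
      then have "exp (- Y) \<le> exp (- \<Lambda> / 4)" by simp
      moreover have "4 / \<Lambda> * Y1 r \<ge> 0" using Y1[of r] \<Lambda>_pos by simp
      ultimately show ?thesis using le zero_le_power2[of "Z r c - 1"] by linarith
    next
      case False
      have le': "(\<Prod>p\<in>{p\<in>PP. T p c \<le> w p}. 1 - N p r c / w p) \<le> 1"
        using le Ynn by (meson exp_le_one_iff neg_le_0_iff_le order_trans)
      show ?thesis
      proof (cases "Y1 r \<ge> \<Lambda> / 4")
        case True
        then have "4 / \<Lambda> * Y1 r \<ge> 1" using \<Lambda>_pos by (simp add: field_simps)
        then show ?thesis using le' zero_le_power2[of "Z r c - 1"] exp_gt_zero[of "- \<Lambda> / 4"] by linarith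
      next
        case F: False
        then have "Z r c * \<Lambda> < 1 / 2 * \<Lambda>" using False YZ by linarith
        then have "Z r c < 1 / 2" using \<Lambda>_pos by (meson mult_less_cancel_right_pos)
        then have "1 / 2 \<le> 1 - Z r c" by linarith
        then have "(1 / 2) ^ 2 \<le> (1 - Z r c) ^ 2" by (intro power_mono) auto
        then have "4 * (Z r c - 1) ^ 2 \<ge> 1" by (simp add: power2_commute power_divide)
        moreover have "4 / \<Lambda> * Y1 r \<ge> 0" using Y1[of r] \<Lambda>_pos by simp
        ultimately show ?thesis using le' exp_gt_zero[of "- \<Lambda> / 4"] by linarith
      qed
    qed
  qed
  have "(\<Sum>r\<in>{..<n} \<inter> Rr c. \<Prod>p\<in>{p\<in>PP. T p c \<le> w p}. 1 - N p r c / w p)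
      = (\<Sum>r<n. of_bool (r \<in> Rr c) * (\<Prod>p\<in>{p\<in>PP. T p c \<le> w p}. 1 - N p r c / w p))"
    by (subst sum.inter_restrict) (auto intro!: sum.cong simp: of_bool_def)
  also have "\<dots> \<le> (\<Sum>r<n. of_bool (r \<in> Rr c) * exp (- \<Lambda> / 4) + 4 * (of_bool (r \<in> Rr c) * (Z r c - 1) ^ 2) + 4 / \<Lambda> * Y1 r)"
  proof (rule sum_mono)
    fix r
    have "4 / \<Lambda> * Y1 r \<ge> 0" using Y1[of r] \<Lambda>_pos by simp
    then show "of_bool (r \<in> Rr c) * (\<Prod>p\<in>{p\<in>PP. T p c \<le> w p}. 1 - N p r c / w p)
       \<le> of_bool (r \<in> Rr c) * exp (- \<Lambda> / 4) + 4 * (of_bool (r \<in> Rr c) * (Z r c - 1) ^ 2) + 4 / \<Lambda> * Y1 r"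
      using pw[of r] by (cases "r \<in> Rr c") (simp_all)
  qed
  also have "\<dots> = (\<Sum>r<n. of_bool (r \<in> Rr c)) * exp (- \<Lambda> / 4)
      + 4 * (\<Sum>r<n. of_bool (r \<in> Rr c) * (Z r c - 1) ^ 2) + 4 / \<Lambda> * (\<Sum>r<n. Y1 r)"
    by (simp only: sum.distrib sum_distrib_left sum_distrib_right)
  also have "4 / \<Lambda> * (\<Sum>r<n. Y1 r) \<le> 4 * real n * W / s * (\<Sum>p\<in>PP. (X p c - 1) ^ 2)"
  proof -
    have "(\<Sum>r<n. Y1 r) = (\<Sum>p\<in>{p\<in>PP. \<not> T p c \<le> w p}. (\<Sum>r<n. N p r c) / w p)"
      unfolding Y1_def by (subst sum.swap) (simp add: sum_divide_distrib)
    also have "\<dots> \<le> (\<Sum>p\<in>{p\<in>PP. \<not> T p c \<le> w p}. real M / 4 * (X p c - 1) ^ 2)"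
    proof (rule sum_mono)
      fix p assume p: "p \<in> {p\<in>PP. \<not> T p c \<le> w p}"
      define x where "x = X p c"
      have wX: "T p c = w p * (x / 4)" using t_pos[of p] W p by (simp add: X_def w_def x_def)
      then have "w p * 1 < w p * (x / 4)" using p by simp
      then have "x > 4" using p w_pos[of p] by (subst (asm) mult_less_cancel_left_pos) auto
      \<comment> \<open>The choice \<open>w p = 4 * t p * W ^ M\<close> makes the loss a large deviation, here \<open>X p c > 4\<close>, so
        it is bounded by the variance.\<close>
      then have "x \<le> (x - 1) ^ 2" using mult_mono[of 3 "x - 1" 3 "x - 1"] mult_right_mono[of 3 "x - 1" "x - 1"]
        by (simp add: power2_eq_square)
      then have "real M / 4 * x \<le> real M / 4 * (x - 1) ^ 2" by (intro mult_left_mono) auto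
      moreover have "(\<Sum>r<n. N p r c) / w p = real M / 4 * x"
        using sum_N[of p c] p w_pos[of p] by (simp add: wX)
      ultimately show "(\<Sum>r<n. N p r c) / w p \<le> real M / 4 * (X p c - 1) ^ 2" by (simp add: x_def)
    qed
    also have "\<dots> \<le> (\<Sum>p\<in>PP. real M / 4 * (X p c - 1) ^ 2)" using PP by (intro sum_mono2) auto
    finally have "4 / \<Lambda> * (\<Sum>r<n. Y1 r) \<le> 4 / \<Lambda> * (\<Sum>p\<in>PP. real M / 4 * (X p c - 1) ^ 2)"
      using \<Lambda>_pos by (intro mult_left_mono) auto
    also have "\<dots> = (real M / \<Lambda>) * (\<Sum>p\<in>PP. (X p c - 1) ^ 2)" by (simp add: sum_distrib_left)
    also have "real M / \<Lambda> = 4 * real n * W / s" using s_pos n M W by (simp add: \<Lambda>_def field_simps)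
    finally show ?thesis .
  qed
  finally show ?thesis by simp
qed

lemma Pr_bounds:
  "I \<subseteq> {..<n} \<Longrightarrow> card I \<le> 2 * M \<Longrightarrow> W ^ card I * (1 - \<epsilon>) \<le> Pr I"
  "I \<subseteq> {..<n} \<Longrightarrow> card I \<le> 2 * M \<Longrightarrow> Pr I \<le> W ^ card I * (1 + \<epsilon>)"
  using prob by (auto simp: Pr_def)

lemma Pr_mono: "I \<subseteq> J \<Longrightarrow> Pr J \<le> Pr I"
  unfolding Pr_def by (intro avg_mono) auto

lemma avg_N: "avg Om (N p r) = (\<Sum>e\<in>E p. of_bool (r \<in> e) * Pr e)"
proof -
  have "N p r = (\<lambda>c. \<Sum>e\<in>E p. of_bool (r \<in> e) * of_bool (e \<subseteq> Rr c))"
    by (intro ext) (simp add: N_def of_bool_conj)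
  then show ?thesis by (simp only: avg_sum avg_cmult Pr_def)
qed

lemma avg_NN: "avg Om (\<lambda>c. N p r c * N p' r c) = (\<Sum>e\<in>E p. \<Sum>e'\<in>E p'. of_bool (r \<in> e) * of_bool (r \<in> e') * Pr (e \<union> e'))"
proof -
  have "N p r c * N p' r c = (\<Sum>e\<in>E p. \<Sum>e'\<in>E p'. of_bool (r \<in> e) * of_bool (r \<in> e') * of_bool (e \<union> e' \<subseteq> Rr c))" for c
    unfolding N_def sum_product by (intro sum.cong refl) auto
  then have "(\<lambda>c. N p r c * N p' r c) = (\<lambda>c. \<Sum>e\<in>E p. \<Sum>e'\<in>E p'. of_bool (r \<in> e) * of_bool (r \<in> e') * of_bool (e \<union> e' \<subseteq> Rr c))" by blast
  then show ?thesis by (simp only: avg_sum avg_cmult Pr_def)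
qed

text \<open>The second moment of \<open>Z r\<close> is a sum over pairs of edges at \<open>r\<close>. Pairs that meet only in \<open>r\<close>
  have \<open>2 * M - 1\<close> vertices and give the main term; the others are rare, since two vertices have at
  most \<open>h\<close> common edges.\<close>

lemma avg_Z:
  assumes r: "r < n"
  shows "avg Om (\<lambda>c. of_bool (r \<in> Rr c) * (Z r c - 1) ^ 2) \<le> W * (3 * (S r - 1) ^ 2 + 8 * (\<epsilon> + \<kappa>))"
proof -
  define B where "B = s * W ^ (M - 1)"
  have B: "B > 0" using s_pos W by (simp add: B_def)
  have Snn: "S r \<ge> 0" unfolding S_def using s_pos mu_pos
    by (intro divide_nonneg_nonneg sum_nonneg) (auto simp: less_imp_le)
  have WM: "W ^ M = W * W ^ (M - 1)" using M by (cases M) auto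
  have Zexp: "of_bool (r \<in> Rr c) * (Z r c - 1) ^ 2 = Z r c ^ 2 - 2 * Z r c + of_bool ({r} \<subseteq> Rr c)" for c
    by (cases "r \<in> Rr c") (auto simp: Z_def N_outside power2_diff)
  have z0: "avg Om (\<lambda>c. of_bool (r \<in> Rr c) * (Z r c - 1) ^ 2) = avg Om (\<lambda>c. Z r c ^ 2) - 2 * avg Om (Z r) + Pr {r}"
    unfolding Zexp by (simp only: avg_add avg_diff avg_cmult Pr_def)
  have z1: "Pr {r} \<le> W * (1 + \<epsilon>)" using Pr_bounds(2)[of "{r}"] r M by simp
  have z2: "avg Om (Z r) \<ge> (1 - \<epsilon>) * W * S r"
  proof -
    have "avg Om (Z r) = (\<Sum>p\<in>PP. (\<Sum>e\<in>E p. of_bool (r \<in> e) * Pr e) / mu p) / B"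
    proof -
      have "Z r = (\<lambda>c. 1 / B * (\<Sum>p\<in>PP. 1 / mu p * N p r c))" by (auto simp: Z_def B_def)
      then have "avg Om (Z r) = 1 / B * (\<Sum>p\<in>PP. 1 / mu p * avg Om (N p r))" by (simp only: avg_sum avg_cmult)
      then show ?thesis by (simp add: avg_N)
    qed
    also have "\<dots> \<ge> (\<Sum>p\<in>PP. (\<Sum>e\<in>E p. of_bool (r \<in> e) * (W ^ M * (1 - \<epsilon>))) / mu p) / B"
    proof (intro divide_right_mono sum_mono mult_left_mono)
      fix p e assume "p \<in> PP" "e \<in> E p"
      then show "W ^ M * (1 - \<epsilon>) \<le> Pr e" using Pr_bounds(1)[of e] edge[of p e] by auto
    qed (use B mu_pos in \<open>auto simp: less_imp_le\<close>)
    also have "(\<Sum>p\<in>PP. (\<Sum>e\<in>E p. of_bool (r \<in> e) * (W ^ M * (1 - \<epsilon>))) / mu p) / B = (1 - \<epsilon>) * W * S r"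
    proof -
      have "(\<Sum>p\<in>PP. (\<Sum>e\<in>E p. of_bool (r \<in> e) * (W ^ M * (1 - \<epsilon>))) / mu p) = (S r * s) * (W ^ M * (1 - \<epsilon>))"
      proof -
        have "(\<Sum>e\<in>E p. of_bool (r \<in> e) * (W ^ M * (1 - \<epsilon>))) / mu p
            = (\<Sum>e\<in>E p. of_bool (r \<in> e)) / mu p * (W ^ M * (1 - \<epsilon>))" for p
          by (simp add: sum_distrib_right)
        then have "(\<Sum>p\<in>PP. (\<Sum>e\<in>E p. of_bool (r \<in> e) * (W ^ M * (1 - \<epsilon>))) / mu p)
            = (\<Sum>p\<in>PP. (\<Sum>e\<in>E p. of_bool (r \<in> e)) / mu p) * (W ^ M * (1 - \<epsilon>))"
          by (simp only: sum_distrib_right)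
        then show ?thesis using s_pos by (simp only: S_def) simp
      qed
      then show ?thesis using B s_pos W by (simp add: B_def WM)
    qed
    finally show ?thesis .
  qed
  have z3: "avg Om (\<lambda>c. Z r c ^ 2) \<le> (1 + \<epsilon>) * W * (S r ^ 2 + S r * \<kappa>)"
  proof -
    have z31: "avg Om (\<lambda>c. Z r c ^ 2) = 1 / B ^ 2 * (\<Sum>p\<in>PP. \<Sum>p'\<in>PP. 1 / (mu p * mu p') * avg Om (\<lambda>c. N p r c * N p' r c))"
    proof -
      have "Z r c ^ 2 = 1 / B ^ 2 * (\<Sum>p\<in>PP. \<Sum>p'\<in>PP. 1 / (mu p * mu p') * (N p r c * N p' r c))" for c
      proof -
        have "Z r c ^ 2 = 1 / B ^ 2 * ((\<Sum>p\<in>PP. N p r c / mu p) * (\<Sum>p\<in>PP. N p r c / mu p))"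
          by (simp add: Z_def B_def power2_eq_square)
        also have "(\<Sum>p\<in>PP. N p r c / mu p) * (\<Sum>p\<in>PP. N p r c / mu p)
            = (\<Sum>p\<in>PP. \<Sum>p'\<in>PP. 1 / (mu p * mu p') * (N p r c * N p' r c))"
          unfolding sum_product by (intro sum.cong refl) simp
        finally show ?thesis .
      qed
      then have "(\<lambda>c. Z r c ^ 2) = (\<lambda>c. 1 / B ^ 2 * (\<Sum>p\<in>PP. \<Sum>p'\<in>PP. 1 / (mu p * mu p') * (N p r c * N p' r c)))"
        by blast
      then show ?thesis by (simp only: avg_sum avg_cmult)
    qed
    have "(\<Sum>p\<in>PP. \<Sum>p'\<in>PP. 1 / (mu p * mu p') * avg Om (\<lambda>c. N p r c * N p' r c))
       \<le> (\<Sum>p\<in>PP. \<Sum>p'\<in>PP. \<Sum>e\<in>E p. \<Sum>e'\<in>E p'. (1 + \<epsilon>) * W ^ (2 * M - 1) * (of_bool (r \<in> e) / mu p * (of_bool (r \<in> e') / mu p'))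
            + (1 + \<epsilon>) * W ^ M / m * (of_bool (r \<in> e) / mu p * of_bool (r \<in> e' \<and> e \<inter> e' \<noteq> {r})))"
      unfolding avg_NN sum_distrib_left
    proof (intro sum_mono)
      fix p p' e e' assume p: "p \<in> PP" "p' \<in> PP" and e: "e \<in> E p" "e' \<in> E p'"
      note ed = edge[OF p(1) e(1)] edge[OF p(2) e(2)]
      have mp: "mu p > 0" "mu p' > 0" using p mu_pos by auto
      have fin: "finite e" "finite e'" using ed finite_subset by auto
      show "1 / (mu p * mu p') * (of_bool (r \<in> e) * of_bool (r \<in> e') * Pr (e \<union> e'))
        \<le> (1 + \<epsilon>) * W ^ (2 * M - 1) * (of_bool (r \<in> e) / mu p * (of_bool (r \<in> e') / mu p'))
            + (1 + \<epsilon>) * W ^ M / m * (of_bool (r \<in> e) / mu p * of_bool (r \<in> e' \<and> e \<inter> e' \<noteq> {r}))"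
      proof (cases "r \<in> e \<and> r \<in> e'")
        case True
        show ?thesis
        proof (cases "e \<inter> e' = {r}")
          case eq: True
          have "card (e \<union> e') + card (e \<inter> e') = 2 * M" using fin ed card_Un_Int[of e e'] by simp
          then have "card (e \<union> e') = 2 * M - 1" using eq by simp
          then have "Pr (e \<union> e') \<le> W ^ (2 * M - 1) * (1 + \<epsilon>)" using Pr_bounds(2)[of "e \<union> e'"] ed by simp
          then have "1 / (mu p * mu p') * Pr (e \<union> e') \<le> 1 / (mu p * mu p') * (W ^ (2 * M - 1) * (1 + \<epsilon>))"
            using mp by (intro mult_left_mono) auto
          then show ?thesis using True eq by (simp add: mult_ac)
        next
          case neq: False
          have "Pr (e \<union> e') \<le> Pr e" by (rule Pr_mono) auto
          also have "\<dots> \<le> W ^ M * (1 + \<epsilon>)" using Pr_bounds(2)[of e] ed by simp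
          finally have "1 / (mu p * mu p') * Pr (e \<union> e') \<le> 1 / (mu p * mu p') * (W ^ M * (1 + \<epsilon>))"
            using mp by (intro mult_left_mono) auto
          also have "\<dots> \<le> 1 / (mu p * m) * (W ^ M * (1 + \<epsilon>))"
            using mp m(1) m(2)[OF p(2)] W eps by (intro mult_right_mono divide_left_mono mult_left_mono) auto
          finally have "1 / (mu p * mu p') * Pr (e \<union> e') \<le> (1 + \<epsilon>) * W ^ M / m * (1 / mu p)" by (simp add: mult_ac)
          moreover have "(1 + \<epsilon>) * W ^ (2 * M - 1) * (1 / mu p * (1 / mu p')) \<ge> 0" using mp eps W by simp
          ultimately show ?thesis using True neq by simp
        qed
      next
        case False
        moreover have "(1 + \<epsilon>) * W ^ M / m * (of_bool (r \<in> e) / mu p * of_bool (r \<in> e' \<and> e \<inter> e' \<noteq> {r})) \<ge> 0"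
          using mp eps W m by simp
        ultimately show ?thesis by auto
      qed
    qed
    also have "\<dots> = (1 + \<epsilon>) * W ^ (2 * M - 1) * (S r * s) ^ 2
        + (1 + \<epsilon>) * W ^ M / m * (\<Sum>p\<in>PP. \<Sum>e\<in>E p. of_bool (r \<in> e) / mu p * (\<Sum>p'\<in>PP. \<Sum>e'\<in>E p'. of_bool (r \<in> e' \<and> e \<inter> e' \<noteq> {r})))"
    proof -
      have 1: "(\<Sum>p\<in>PP. \<Sum>p'\<in>PP. \<Sum>e\<in>E p. \<Sum>e'\<in>E p'. of_bool (r \<in> e) / mu p * (of_bool (r \<in> e') / mu p')) = (S r * s) ^ 2"
      proof -
        have "S r * s = (\<Sum>p\<in>PP. \<Sum>e\<in>E p. of_bool (r \<in> e) / mu p)"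
          unfolding sum_divide_distrib[symmetric] using s_pos(2) by (simp add: S_def)
        then show ?thesis by (simp only: power2_eq_square sum_product)
      qed
      have 2: "(\<Sum>p\<in>PP. \<Sum>p'\<in>PP. \<Sum>e\<in>E p. \<Sum>e'\<in>E p'. of_bool (r \<in> e) / mu p * of_bool (r \<in> e' \<and> e \<inter> e' \<noteq> {r}))
          = (\<Sum>p\<in>PP. \<Sum>e\<in>E p. of_bool (r \<in> e) / mu p * (\<Sum>p'\<in>PP. \<Sum>e'\<in>E p'. of_bool (r \<in> e' \<and> e \<inter> e' \<noteq> {r})))"
        unfolding sum_distrib_left by (intro sum.cong refl sum.swap)
      show ?thesis unfolding 1[symmetric] 2[symmetric] by (simp only: sum.distrib sum_distrib_left)
    qed
    also have "\<dots> \<le> (1 + \<epsilon>) * W ^ (2 * M - 1) * (S r * s) ^ 2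
        + (1 + \<epsilon>) * W ^ M / m * (\<Sum>p\<in>PP. \<Sum>e\<in>E p. of_bool (r \<in> e) / mu p * (real M * real h))"
    proof (rule add_left_mono, rule mult_left_mono, rule sum_mono, rule sum_mono)
      fix p e assume p: "p \<in> PP" and e: "e \<in> E p"
      show "of_bool (r \<in> e) / mu p * (\<Sum>p'\<in>PP. \<Sum>e'\<in>E p'. of_bool (r \<in> e' \<and> e \<inter> e' \<noteq> {r})) \<le> of_bool (r \<in> e) / mu p * (real M * real h)"
      proof (cases "r \<in> e")
        case True
        have fe: "finite e" using edge[OF p e] finite_subset by auto
        have "(\<Sum>p'\<in>PP. \<Sum>e'\<in>E p'. of_bool (r \<in> e' \<and> e \<inter> e' \<noteq> {r}) :: real)
          \<le> (\<Sum>p'\<in>PP. \<Sum>e'\<in>E p'. \<Sum>v\<in>e - {r}. of_bool (r \<in> e' \<and> v \<in> e'))"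
        proof (intro sum_mono)
          fix p' e'
          show "of_bool (r \<in> e' \<and> e \<inter> e' \<noteq> {r}) \<le> (\<Sum>v\<in>e - {r}. of_bool (r \<in> e' \<and> v \<in> e') :: real)"
          proof (cases "r \<in> e' \<and> e \<inter> e' \<noteq> {r}")
            case T: True
            then obtain v where v: "v \<in> e - {r}" "v \<in> e'" using True by blast
            have "(of_bool (r \<in> e' \<and> v \<in> e') :: real) \<le> (\<Sum>v\<in>e - {r}. of_bool (r \<in> e' \<and> v \<in> e'))"
              using fe v by (intro member_le_sum) auto
            then show ?thesis using T v by simp
          qed (auto intro: sum_nonneg)
        qed
        also have "\<dots> = (\<Sum>v\<in>e - {r}. \<Sum>p'\<in>PP. \<Sum>e'\<in>E p'. of_bool (r \<in> e' \<and> v \<in> e'))"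
        proof -
          have "(\<Sum>p'\<in>PP. \<Sum>e'\<in>E p'. \<Sum>v\<in>e - {r}. of_bool (r \<in> e' \<and> v \<in> e') :: real)
            = (\<Sum>p'\<in>PP. \<Sum>v\<in>e - {r}. \<Sum>e'\<in>E p'. of_bool (r \<in> e' \<and> v \<in> e'))"
            by (intro sum.cong refl sum.swap)
          also have "\<dots> = (\<Sum>v\<in>e - {r}. \<Sum>p'\<in>PP. \<Sum>e'\<in>E p'. of_bool (r \<in> e' \<and> v \<in> e'))" by (rule sum.swap)
          finally show ?thesis .
        qed
        also have "\<dots> \<le> (\<Sum>v\<in>e - {r}. real h)"
          using edge[OF p e] r by (intro sum_mono codeg) auto
        also have "\<dots> = real (card (e - {r})) * real h" by simp
        also have "\<dots> \<le> real M * real h"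
          using edge[OF p e] fe card_mono[of e "e - {r}"] by (intro mult_right_mono) auto
        finally show ?thesis using True mu_pos[OF p] by (intro mult_left_mono) auto
      qed simp
    qed (use eps W m in auto)
    also have "(\<Sum>p\<in>PP. \<Sum>e\<in>E p. of_bool (r \<in> e) / mu p * (real M * real h)) = S r * s * (real M * real h)"
      unfolding sum_distrib_right[symmetric] sum_divide_distrib[symmetric] using s_pos(2) by (simp add: S_def)
    finally have *: "(\<Sum>p\<in>PP. \<Sum>p'\<in>PP. 1 / (mu p * mu p') * avg Om (\<lambda>c. N p r c * N p' r c))
      \<le> (1 + \<epsilon>) * W ^ (2 * M - 1) * (S r * s) ^ 2 + (1 + \<epsilon>) * W ^ M / m * (S r * s * (real M * real h))"
      .
    have "avg Om (\<lambda>c. Z r c ^ 2) \<le> 1 / B ^ 2 * ((1 + \<epsilon>) * W ^ (2 * M - 1) * (S r * s) ^ 2 + (1 + \<epsilon>) * W ^ M / m * (S r * s * (real M * real h)))"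
      unfolding z31 using * by (intro mult_left_mono) auto
    also have "\<dots> \<le> (1 + \<epsilon>) * W * (S r ^ 2 + S r * \<kappa>)"
    proof -
      define U where "U = W ^ (M - 1)"
      have U: "U > 0" using W by (simp add: U_def)
      have W2: "W ^ (2 * M - 1) = W * (U * U)"
      proof -
        have "2 * M - 1 = Suc ((M - 1) + (M - 1))" using M by simp
        then show ?thesis by (simp only: U_def power_add power_Suc)
      qed
      have "1 / B ^ 2 * ((1 + \<epsilon>) * W ^ (2 * M - 1) * (S r * s) ^ 2 + (1 + \<epsilon>) * W ^ M / m * (S r * s * (real M * real h)))
         = (1 + \<epsilon>) * W * (S r ^ 2 + S r * (real M * real h / (s * m * U)))"
      proof -
        have BU: "B = s * U" and WMU: "W ^ M = W * U" by (simp_all add: B_def WM U_def)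
        show ?thesis unfolding W2 BU WMU using U s_pos m(1) W by (simp add: power2_eq_square field_simps)
      qed
      also have "\<dots> \<le> (1 + \<epsilon>) * W * (S r ^ 2 + S r * \<kappa>)"
      proof -
        have "real M * real h / (s * m * U) \<le> \<kappa>" using k1 U s_pos m by (simp add: U_def s_def field_simps)
        then show ?thesis using Snn eps W by (intro mult_left_mono add_left_mono) auto
      qed
      finally show ?thesis .
    qed
    finally show ?thesis .
  qed
  have "avg Om (\<lambda>c. of_bool (r \<in> Rr c) * (Z r c - 1) ^ 2)
     \<le> (1 + \<epsilon>) * W * (S r ^ 2 + S r * \<kappa>) - 2 * ((1 - \<epsilon>) * W * S r) + W * (1 + \<epsilon>)"
    using z0 z1 z2 z3 by linarith
  also have "\<dots> = W * ((1 + \<epsilon>) * S r ^ 2 + (1 + \<epsilon>) * (S r * \<kappa>) - 2 * (1 - \<epsilon>) * S r + (1 + \<epsilon>))"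
    by (simp add: algebra_simps)
  also have "\<dots> \<le> W * (3 * (S r - 1) ^ 2 + 8 * (\<epsilon> + \<kappa>))"
    using W by (intro mult_left_mono perturbed_square_le Snn eps kap) auto
  finally show ?thesis .
qed

lemma avg_X:
  assumes p: "p \<in> PP"
  shows "avg Om (\<lambda>c. (X p c - 1) ^ 2) \<le> 3 * (real (card (E p)) / t p - 1) ^ 2 + 8 * (\<epsilon> + \<kappa>)"
proof -
  define B where "B = t p * W ^ M"
  define u where "u = real (card (E p)) / t p"
  have B: "B > 0" using t_pos[OF p] W by (simp add: B_def)
  have cu: "real (card (E p)) = u * t p" using t_pos[OF p] by (simp add: u_def)
  have u0: "u \<ge> 0" using t_pos[OF p] by (simp add: u_def)
  have x0: "avg Om (\<lambda>c. (X p c - 1) ^ 2) = 1 / B ^ 2 * avg Om (\<lambda>c. T p c ^ 2) - 2 / B * avg Om (T p) + 1"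
  proof -
    have "(X p c - 1) ^ 2 = 1 / B ^ 2 * T p c ^ 2 - 2 / B * T p c + 1" for c
      by (simp add: X_def B_def[symmetric] power2_diff power_divide)
    then show ?thesis by (simp only: avg_add avg_diff avg_cmult avg_const[OF Om])
  qed
  have x1: "avg Om (T p) \<ge> u * B * (1 - \<epsilon>)"
  proof -
    have "avg Om (T p) = (\<Sum>e\<in>E p. Pr e)" unfolding T_def[abs_def] avg_sum Pr_def ..
    also have "\<dots> \<ge> (\<Sum>e\<in>E p. W ^ M * (1 - \<epsilon>))"
    proof (rule sum_mono)
      fix e assume "e \<in> E p"
      then show "W ^ M * (1 - \<epsilon>) \<le> Pr e" using Pr_bounds(1)[of e] edge[OF p, of e] by simp
    qed
    also have "(\<Sum>e\<in>E p. W ^ M * (1 - \<epsilon>)) = u * B * (1 - \<epsilon>)" by (simp add: cu B_def)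
    finally show ?thesis .
  qed
  have x2: "avg Om (\<lambda>c. T p c ^ 2) \<le> (1 + \<epsilon>) * (u * B + u ^ 2 * B ^ 2)"
  proof -
    have "(\<lambda>c. T p c ^ 2) = (\<lambda>c. \<Sum>e\<in>E p. \<Sum>e'\<in>E p. of_bool (e \<union> e' \<subseteq> Rr c))"
      unfolding T_def power2_eq_square sum_product by (intro ext sum.cong refl) (simp add: of_bool_conj)
    then have "avg Om (\<lambda>c. T p c ^ 2) = (\<Sum>e\<in>E p. \<Sum>e'\<in>E p. Pr (e \<union> e'))" by (simp only: avg_sum Pr_def)
    also have "\<dots> \<le> (\<Sum>e\<in>E p. \<Sum>e'\<in>E p. (if e = e' then W ^ M * (1 + \<epsilon>) else 0) + W ^ (2 * M) * (1 + \<epsilon>))"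
    proof (intro sum_mono)
      fix e e' assume e: "e \<in> E p" "e' \<in> E p"
      note ed = edge[OF p e(1)] edge[OF p e(2)]
      have fin: "finite e" "finite e'" using ed finite_subset by auto
      show "Pr (e \<union> e') \<le> (if e = e' then W ^ M * (1 + \<epsilon>) else 0) + W ^ (2 * M) * (1 + \<epsilon>)"
      proof (cases "e = e'")
        case True
        have "Pr e \<le> W ^ M * (1 + \<epsilon>)" using Pr_bounds(2)[of e] ed by simp
        moreover have "W ^ (2 * M) * (1 + \<epsilon>) \<ge> 0" using W eps by simp
        ultimately show ?thesis using True by simp
      next
        case False
        then have "card (e \<union> e') = 2 * M" using fin ed disj[OF p e] by (simp add: card_Un_disjoint)
        then show ?thesis using False Pr_bounds(2)[of "e \<union> e'"] ed by simp
      qed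
    qed
    also have "\<dots> = real (card (E p)) * (W ^ M * (1 + \<epsilon>)) + real (card (E p)) ^ 2 * (W ^ (2 * M) * (1 + \<epsilon>))"
      using finE[OF p] by (simp add: sum.distrib power2_eq_square distrib_left mult.assoc)
    also have "\<dots> = (1 + \<epsilon>) * (u * B + u ^ 2 * B ^ 2)"
    proof -
      have "W ^ (2 * M) = W ^ M * W ^ M" by (simp only: mult_2 power_add)
      then show ?thesis by (simp add: cu B_def power2_eq_square algebra_simps)
    qed
    finally show ?thesis .
  qed
  have "1 / B ^ 2 * avg Om (\<lambda>c. T p c ^ 2) \<le> 1 / B ^ 2 * ((1 + \<epsilon>) * (u * B + u ^ 2 * B ^ 2))"
    using x2 by (intro mult_left_mono) auto
  moreover have "2 / B * (u * B * (1 - \<epsilon>)) \<le> 2 / B * avg Om (T p)"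
    using x1 B by (intro mult_left_mono) auto
  ultimately have "avg Om (\<lambda>c. (X p c - 1) ^ 2) \<le> 1 / B ^ 2 * ((1 + \<epsilon>) * (u * B + u ^ 2 * B ^ 2)) - 2 / B * (u * B * (1 - \<epsilon>)) + 1"
    using x0 by linarith
  also have "\<dots> = (1 + \<epsilon>) * u ^ 2 + (1 + \<epsilon>) * (u * (1 / B)) - 2 * (1 - \<epsilon>) * u + 1"
    using B by (simp add: field_simps power2_eq_square)
  also have "\<dots> \<le> (1 + \<epsilon>) * u ^ 2 + (1 + \<epsilon>) * (u * \<kappa>) - 2 * (1 - \<epsilon>) * u + (1 + \<epsilon>)"
  proof -
    have "\<kappa> * real n * m * W ^ M \<le> \<kappa> * real n * mu p * W ^ M"
      using m(2)[OF p] W kap by (intro mult_right_mono mult_left_mono) auto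
    then have "real M \<le> \<kappa> * real n * mu p * W ^ M" using k2 by linarith
    then have "1 / B \<le> \<kappa>" using B M mu_pos[OF p] n W by (simp add: B_def t_def field_simps)
    then have "(1 + \<epsilon>) * (u * (1 / B)) \<le> (1 + \<epsilon>) * (u * \<kappa>)" using u0 eps by (intro mult_left_mono) auto
    then show ?thesis using eps by linarith
  qed
  also have "\<dots> \<le> 3 * (u - 1) ^ 2 + 8 * (\<epsilon> + \<kappa>)" by (intro perturbed_square_le u0 eps kap)
  finally show ?thesis by (simp add: u_def)
qed

text \<open>On average only a small proportion of the roughly \<open>n * W\<close> surviving vertices remains
  uncovered.\<close>

lemma avg_uncovered:
  "avg Om (\<lambda>c. \<Sum>r\<in>{..<n} \<inter> Rr c. \<Prod>p\<in>{p\<in>PP. T p c \<le> w p}. 1 - N p r c / w p)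
    \<le> real n * W * (2 * exp (- \<Lambda> / 4) + 88 * (\<epsilon> + \<kappa>))"
proof -
  have "avg Om (\<lambda>c. \<Sum>r\<in>{..<n} \<inter> Rr c. \<Prod>p\<in>{p\<in>PP. T p c \<le> w p}. 1 - N p r c / w p)
    \<le> avg Om (\<lambda>c. exp (- \<Lambda> / 4) * (\<Sum>r<n. of_bool ({r} \<subseteq> Rr c))
      + 4 * (\<Sum>r<n. of_bool (r \<in> Rr c) * (Z r c - 1) ^ 2)
      + 4 * real n * W / s * (\<Sum>p\<in>PP. (X p c - 1) ^ 2))"
    using uncovered_pointwise by (intro avg_mono) (simp add: mult.commute)
  also have "\<dots> = exp (- \<Lambda> / 4) * (\<Sum>r<n. Pr {r})
      + 4 * (\<Sum>r<n. avg Om (\<lambda>c. of_bool (r \<in> Rr c) * (Z r c - 1) ^ 2))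
      + 4 * real n * W / s * (\<Sum>p\<in>PP. avg Om (\<lambda>c. (X p c - 1) ^ 2))"
    by (simp only: avg_add avg_cmult avg_sum Pr_def)
  also have "\<dots> \<le> exp (- \<Lambda> / 4) * (\<Sum>r<n. 2 * W)
      + 4 * (\<Sum>r<n. W * (3 * (S r - 1) ^ 2 + 8 * (\<epsilon> + \<kappa>)))
      + 4 * real n * W / s * (\<Sum>p\<in>PP. 3 * (real (card (E p)) / t p - 1) ^ 2 + 8 * (\<epsilon> + \<kappa>))"
  proof (intro add_mono mult_left_mono sum_mono avg_X)
    fix r assume "r \<in> {..<n}"
    then have "Pr {r} \<le> W * (1 + \<epsilon>)" using Pr_bounds(2)[of "{r}"] M by simp
    also have "\<dots> \<le> W * 2" using W kap by (intro mult_left_mono) auto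
    finally show "Pr {r} \<le> 2 * W" by simp
  qed (use avg_Z s_pos W in auto)
  also have "\<dots> \<le> exp (- \<Lambda> / 4) * (\<Sum>r<n. 2 * W) + 4 * (real n * W * (11 * (\<epsilon> + \<kappa>))) + 4 * real n * W / s * (s * (11 * (\<epsilon> + \<kappa>)))"
  proof (intro add_mono mult_left_mono order.refl)
  show "(\<Sum>r<n. W * (3 * (S r - 1) ^ 2 + 8 * (\<epsilon> + \<kappa>))) \<le> real n * W * (11 * (\<epsilon> + \<kappa>))"
  proof -
    have "(\<Sum>r<n. (S r - 1) ^ 2) = (\<Sum>r<n. ((\<Sum>p\<in>PP. (\<Sum>e\<in>E p. of_bool (r \<in> e)) / mu p) - s) ^ 2) / s ^ 2"
    proof -
      have "(S r - 1) ^ 2 = ((\<Sum>p\<in>PP. (\<Sum>e\<in>E p. of_bool (r \<in> e)) / mu p) - s) ^ 2 / s ^ 2" for r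
      proof -
        have "S r - 1 = ((\<Sum>p\<in>PP. (\<Sum>e\<in>E p. of_bool (r \<in> e)) / mu p) - s) / s"
          using s_pos by (simp add: S_def diff_divide_distrib)
        then show ?thesis by (simp add: power_divide)
      qed
      then show ?thesis by (simp add: sum_divide_distrib)
    qed
    also have "\<dots> \<le> (\<kappa> * real n * s ^ 2) / s ^ 2" using A2 by (intro divide_right_mono) (auto simp: s_def)
    also have "\<dots> = \<kappa> * real n" using s_pos by simp
    finally have A: "(\<Sum>r<n. (S r - 1) ^ 2) \<le> \<kappa> * real n" .
    have "(\<Sum>r<n. W * (3 * (S r - 1) ^ 2 + 8 * (\<epsilon> + \<kappa>))) = W * (3 * (\<Sum>r<n. (S r - 1) ^ 2) + real n * (8 * (\<epsilon> + \<kappa>)))"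
      by (simp add: sum.distrib flip: sum_distrib_left)
    also have "\<dots> \<le> W * (3 * (\<kappa> * real n) + real n * (8 * (\<epsilon> + \<kappa>)))"
      using A W by (intro mult_left_mono add_right_mono) auto
    also have "\<dots> \<le> W * (real n * (11 * (\<epsilon> + \<kappa>)))"
      using W eps by (intro mult_left_mono) (auto simp: algebra_simps)
    finally show ?thesis by (simp add: mult_ac)
  qed
  show "(\<Sum>p\<in>PP. 3 * (real (card (E p)) / t p - 1) ^ 2 + 8 * (\<epsilon> + \<kappa>)) \<le> s * (11 * (\<epsilon> + \<kappa>))"
  proof -
    have "(\<Sum>p\<in>PP. 3 * (real (card (E p)) / t p - 1) ^ 2 + 8 * (\<epsilon> + \<kappa>)) = 3 * (\<Sum>p\<in>PP. (real (card (E p)) / t p - 1) ^ 2) + s * (8 * (\<epsilon> + \<kappa>))"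
      by (simp add: sum.distrib s_def flip: sum_distrib_left)
    also have "\<dots> \<le> 3 * (\<kappa> * s) + s * (8 * (\<epsilon> + \<kappa>))"
      using A1 by (intro add_right_mono mult_left_mono) (auto simp: t_def s_def)
    also have "\<dots> \<le> s * (11 * (\<epsilon> + \<kappa>))" using s_pos eps by (simp add: algebra_simps)
    finally show ?thesis .
  qed
  qed (use s_pos W in auto)
  also have "\<dots> = real n * W * (2 * exp (- \<Lambda> / 4) + 88 * (\<epsilon> + \<kappa>))"
    using s_pos by (simp add: algebra_simps)
  finally show ?thesis .
qed

end

section \<open>Covering one class of exponents\<close>

text \<open>The method of conditional expectations. The right side is the expected weight of the uncovered
  vertices if each \<open>p\<close> independently selects at most one edge: each edge of \<open>E p\<close> with probability
  \<open>1 / w p\<close>, and none with the remaining probability.\<close>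

lemma exists_good_edge_choice:
  fixes g :: "'v \<Rightarrow> real" and E :: "'p \<Rightarrow> 'v set set" and w :: "'p \<Rightarrow> real"
  assumes "finite PP" "finite U" "\<And>v. v \<in> U \<Longrightarrow> g v \<ge> 0"
    and "\<And>p. p \<in> PP \<Longrightarrow> finite (E p) \<and> real (card (E p)) \<le> w p \<and> 0 < w p"
  shows "\<exists>\<sigma>. (\<forall>p\<in>PP. \<sigma> p = {} \<or> \<sigma> p \<in> E p) \<and>
    (\<Sum>v\<in>U - (\<Union>p\<in>PP. \<sigma> p). g v) \<le> (\<Sum>v\<in>U. g v * (\<Prod>p\<in>PP. 1 - (\<Sum>e\<in>E p. of_bool (v \<in> e)) / w p))"
  using assms(1,3,4)
proof (induction PP arbitrary: g rule: finite_induct)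
  case (insert p PP)
  define dp where "dp v = (\<Sum>e\<in>E p. of_bool (v \<in> e) :: real)" for v
  have Ep: "finite (E p)" "real (card (E p)) \<le> w p" "0 < w p" using insert.prems by auto
  have dle: "dp v \<le> w p" for v
  proof -
    have "dp v \<le> (\<Sum>e\<in>E p. 1)" unfolding dp_def by (intro sum_mono) auto
    then show ?thesis using Ep by simp
  qed
  have "\<exists>\<sigma>. (\<forall>p\<in>PP. \<sigma> p = {} \<or> \<sigma> p \<in> E p) \<and>
    (\<Sum>v\<in>U - (\<Union>p\<in>PP. \<sigma> p). g v * (1 - dp v / w p)) \<le> (\<Sum>v\<in>U. g v * (1 - dp v / w p) * (\<Prod>p\<in>PP. 1 - (\<Sum>e\<in>E p. of_bool (v \<in> e)) / w p))"
  proof (rule insert.IH)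
    fix v assume "v \<in> U"
    then show "0 \<le> g v * (1 - dp v / w p)" using insert.prems(1) dle[of v] Ep by simp
  qed (use insert.prems in auto)
  then obtain \<sigma> where \<sigma>: "\<forall>p\<in>PP. \<sigma> p = {} \<or> \<sigma> p \<in> E p"
    "(\<Sum>v\<in>U - (\<Union>p\<in>PP. \<sigma> p). g v * (1 - dp v / w p)) \<le> (\<Sum>v\<in>U. g v * (1 - dp v / w p) * (\<Prod>p\<in>PP. 1 - (\<Sum>e\<in>E p. of_bool (v \<in> e)) / w p))"
    by blast
  define U' where "U' = U - (\<Union>p\<in>PP. \<sigma> p)"
  have fU': "finite U'" using assms(2) by (simp add: U'_def)
  define G where "G A = (\<Sum>v\<in>U' - A. g v)" for A
  \<comment> \<open>The weight left after selecting \<open>e\<close>, averaged over the random choice for the single index \<open>p\<close>.\<close>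
  have avg: "(\<Sum>e\<in>E p. G e) + (w p - real (card (E p))) * G {} = w p * (\<Sum>v\<in>U'. g v * (1 - dp v / w p))"
  proof -
    have "G e = (\<Sum>v\<in>U'. g v - g v * of_bool (v \<in> e))" for e
    proof -
      have "G e = (\<Sum>v\<in>U'. if v \<in> e then 0 else g v)"
        unfolding G_def using fU' by (subst sum.If_cases) (auto simp: Diff_eq)
      then show ?thesis by (auto intro: sum.cong)
    qed
    then have "(\<Sum>e\<in>E p. G e) = (\<Sum>e\<in>E p. (\<Sum>v\<in>U'. g v)) - (\<Sum>e\<in>E p. \<Sum>v\<in>U'. g v * of_bool (v \<in> e))"
      by (simp add: sum_subtractf)
    also have "(\<Sum>e\<in>E p. \<Sum>v\<in>U'. g v * of_bool (v \<in> e)) = (\<Sum>v\<in>U'. g v * dp v)"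
      unfolding dp_def sum_distrib_left by (rule sum.swap)
    finally have "(\<Sum>e\<in>E p. G e) + (w p - real (card (E p))) * G {} = w p * (\<Sum>v\<in>U'. g v) - (\<Sum>v\<in>U'. g v * dp v)"
      by (simp add: G_def algebra_simps)
    also have "\<dots> = (\<Sum>v\<in>U'. w p * (g v * (1 - dp v / w p)))"
      using Ep by (simp add: sum_distrib_left sum_subtractf[symmetric] right_diff_distrib)
    finally show ?thesis by (simp add: sum_distrib_left)
  qed
  have "\<exists>A. (A = {} \<or> A \<in> E p) \<and> G A \<le> (\<Sum>v\<in>U'. g v * (1 - dp v / w p))"
  proof (rule ccontr)
    define a where "a = (\<Sum>v\<in>U'. g v * (1 - dp v / w p))"
    assume "\<not> ?thesis"
    then have gt: "a < G {}" "\<And>e. e \<in> E p \<Longrightarrow> a < G e" by (auto simp: a_def not_le)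
    have 1: "real (card (E p)) * a \<le> (\<Sum>e\<in>E p. G e)"
      using sum_mono[of "E p" "\<lambda>_. a" G] gt(2) by (simp add: less_imp_le)
    have 2: "(w p - real (card (E p))) * a \<le> (w p - real (card (E p))) * G {}"
      using gt(1) Ep by (intro mult_left_mono) auto
    have "(\<Sum>e\<in>E p. G e) + (w p - real (card (E p))) * G {} = w p * a" using avg by (simp add: a_def)
    then have eq: "(\<Sum>e\<in>E p. G e) = real (card (E p)) * a" "(w p - real (card (E p))) * G {} = (w p - real (card (E p))) * a"
      using 1 2 by (simp_all add: algebra_simps)
    show False
    proof (cases "E p = {}")
      case True
      then show False using eq(2) gt(1) Ep by simp
    next
      case False
      then have "(\<Sum>e\<in>E p. a) < (\<Sum>e\<in>E p. G e)" using gt(2) Ep by (intro sum_strict_mono) auto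
      then show False using eq(1) by simp
    qed
  qed
  then obtain A where A: "A = {} \<or> A \<in> E p" "G A \<le> (\<Sum>v\<in>U'. g v * (1 - dp v / w p))" by blast
  define \<sigma>' where "\<sigma>' = \<sigma>(p := A)"
  have "(\<Union>q\<in>insert p PP. \<sigma>' q) = A \<union> (\<Union>q\<in>PP. \<sigma> q)"
    using insert.hyps by (auto simp: \<sigma>'_def)
  then have "U - (\<Union>q\<in>insert p PP. \<sigma>' q) = U' - A" by (auto simp: U'_def)
  then have "(\<Sum>v\<in>U - (\<Union>q\<in>insert p PP. \<sigma>' q). g v) \<le> (\<Sum>v\<in>U'. g v * (1 - dp v / w p))"
    using A(2) by (simp add: G_def)
  also have "\<dots> \<le> (\<Sum>v\<in>U. g v * (1 - dp v / w p) * (\<Prod>p\<in>PP. 1 - (\<Sum>e\<in>E p. of_bool (v \<in> e)) / w p))"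
    using \<sigma>(2) by (simp add: U'_def)
  also have "\<dots> = (\<Sum>v\<in>U. g v * (\<Prod>q\<in>insert p PP. 1 - (\<Sum>e\<in>E q. of_bool (v \<in> e)) / w q))"
    using insert.hyps by (simp add: dp_def mult.assoc)
  finally show ?case using \<sigma>(1) A(1) insert.hyps by (intro exI[of _ \<sigma>']) (auto simp: \<sigma>'_def)
qed auto

lemma sum_subset_of_bool: "finite A \<Longrightarrow> (\<Sum>a\<in>{a\<in>A. P a}. f a) = (\<Sum>a\<in>A. of_bool (P a) * (f a :: real))"
  unfolding sum.inter_filter by (intro sum.cong) auto

text \<open>The hypergraph for one class: the vertices are the positions in the class, and the edges for
  the large prime \<open>p\<close> are its full bins. The function \<open>F\<close> bounds the number of positions that
  neither the sieve residues \<open>c\<close> nor suitable residues \<open>d\<close> for the large primes cover; it has a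
  small mean, so that one \<open>c\<close> can serve all classes together.\<close>

lemma class_cover:
  fixes x :: "nat \<Rightarrow> nat" and Q R :: "nat set" and n M h z :: nat and m \<kappa> :: real
  defines "u \<equiv> \<lambda>p. restrict (\<lambda>i. x i mod p) {..<n}"
    and "W \<equiv> (\<Prod>q\<in>Q. 1 - 1 / real q)"
    and "\<epsilon> \<equiv> 16 * real M ^ 2 * real h / real z"
  assumes Q: "finite Q" "\<And>q. q \<in> Q \<Longrightarrow> prime q" "\<And>q. q \<in> Q \<Longrightarrow> z < q" "z \<ge> 1"
    and R: "finite R" "R \<noteq> {}" "\<And>p. p \<in> R \<Longrightarrow> prime p"
    and M: "M \<ge> 2" and n: "n \<ge> 1" and h: "h \<ge> 1" and z: "4 * M \<le> z" "8 * real M ^ 2 * real h \<le> real z"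
    and collQ: "\<And>i j. i < n \<Longrightarrow> j < n \<Longrightarrow> i \<noteq> j \<Longrightarrow> card {q\<in>Q. x i mod q = x j mod q} \<le> h"
    and collR: "\<And>i j. i < n \<Longrightarrow> j < n \<Longrightarrow> i \<noteq> j \<Longrightarrow> card {q\<in>R. x i mod q = x j mod q} \<le> h"
    and kap: "0 \<le> \<kappa>" "\<epsilon> + \<kappa> \<le> 1"
    and m: "0 < m" "\<And>p. p \<in> R \<Longrightarrow> m \<le> prob_full M n p"
    and A1: "(\<Sum>p\<in>R. (real (card (full_bins M n p (u p))) / exp_bins M n p - 1) ^ 2) \<le> \<kappa> * real (card R)"
    and A2: "(\<Sum>r<n. ((\<Sum>p\<in>R. of_bool (in_full_bin M n (u p) r) / prob_full M n p) - real (card R)) ^ 2) \<le> \<kappa> * real n * real (card R) ^ 2"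
    and k1: "real M * real h \<le> \<kappa> * real (card R) * m * W ^ (M - 1)"
    and k2: "real M \<le> \<kappa> * real n * m * W ^ M"
  shows "\<exists>F. avg (sieve_space Q) F \<le> real n * W * (2 * exp (- (real (card R) * real M / (4 * real n * W)) / 4) + 88 * (\<epsilon> + \<kappa>)) \<and>
     (\<forall>c\<in>sieve_space Q. \<exists>d. real (card {r. r \<in> survivors Q n x c \<and> (\<forall>p\<in>R. x r mod p \<noteq> d p)}) \<le> F c)"
proof -
  define E where "E p = bin n (u p) ` full_bins M n p (u p)" for p
  have p0: "p > 0" if "p \<in> R" for p using R(3)[OF that] prime_gt_0_nat by auto
  have ui: "u p i = x i mod p" if "i < n" for p i using that by (simp add: u_def)
  have bin: "bin n (u p) c = {i. i < n \<and> x i mod p = c}" for p c using ui by (auto simp: bin_def)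
  have cardE: "card (E p) = card (full_bins M n p (u p))" for p
  proof -
    have "inj_on (bin n (u p)) (full_bins M n p (u p))"
    proof (rule inj_onI)
      fix c c' assume c: "c \<in> full_bins M n p (u p)" "c' \<in> full_bins M n p (u p)" "bin n (u p) c = bin n (u p) c'"
      have "card (bin n (u p) c) = M" using c(1) by (simp add: full_bins_def)
      then have "bin n (u p) c \<noteq> {}" using M by auto
      then obtain i where "i \<in> bin n (u p) c" by blast
      moreover have "i \<in> bin n (u p) c'" using calculation c(3) by simp
      ultimately show "c = c'" by (simp add: bin_def)
    qed
    then show ?thesis by (simp add: E_def card_image)
  qed
  have mem: "r \<in> bin n (u p) c \<longleftrightarrow> r < n \<and> c = x r mod p" for r p c unfolding bin by auto
  have sumE: "(\<Sum>e\<in>E p. of_bool (r \<in> e)) = (of_bool (in_full_bin M n (u p) r) :: real)" if "r < n" "p \<in> R" for r p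
  proof (cases "in_full_bin M n (u p) r")
    case True
    have c: "x r mod p \<in> full_bins M n p (u p)"
      using True that p0 ui by (simp add: in_full_bin_def full_bins_def)
    have "(\<Sum>e\<in>E p. of_bool (r \<in> e) :: real) = (\<Sum>e\<in>E p. if e = bin n (u p) (x r mod p) then 1 else 0)"
      using that by (intro sum.cong refl) (auto simp: E_def mem)
    also have "\<dots> = 1" using c by (subst sum.delta) (auto simp: E_def)
    finally show ?thesis using True by simp
  next
    case False
    have "r \<notin> e" if eE: "e \<in> E p" for e
    proof
      assume "r \<in> e"
      then obtain c where c: "c \<in> full_bins M n p (u p)" "e = bin n (u p) c" "r \<in> bin n (u p) c" using eE by (auto simp: E_def)
      then have "c = u p r" using \<open>r < n\<close> mem ui by auto
      then show False using c False by (simp add: in_full_bin_def full_bins_def)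
    qed
    then have "(\<Sum>e\<in>E p. of_bool (r \<in> e) :: real) = 0" by (intro sum.neutral) auto
    then show ?thesis using False by simp
  qed
  have mp: "prob_full M n p > 0" if "p \<in> R" for p using m that by force
  have tp: "real n * prob_full M n p / real M = exp_bins M n p" for p
    using prob_full_exp_bins[of M n p] M n by simp
  interpret thinned_hypergraph "sieve_space Q" "survivors Q n x" E R n M h W \<epsilon> m \<kappa> "prob_full M n"
  proof
    show "finite (sieve_space Q)" "sieve_space Q \<noteq> {}" using sieve_space_finite Q by auto
    show "finite R" "R \<noteq> {}" "1 \<le> n" "2 \<le> M" by fact+
    show "e \<subseteq> {..<n} \<and> card e = M" if "p \<in> R" "e \<in> E p" for p e
      using that bin_subset by (auto simp: E_def full_bins_def)
    show "e \<inter> e' = {}" if "p \<in> R" "e \<in> E p" "e' \<in> E p" "e \<noteq> e'" for p e e'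
      using that by (auto simp: E_def mem)
    show "(\<Sum>p\<in>R. \<Sum>e\<in>E p. of_bool (r \<in> e \<and> t \<in> e)) \<le> real h" if "r < n" "t < n" "r \<noteq> t" for r t
    proof -
      have "(\<Sum>p\<in>R. \<Sum>e\<in>E p. of_bool (r \<in> e \<and> t \<in> e)) \<le> (\<Sum>p\<in>R. of_bool (x r mod p = x t mod p) :: real)"
      proof (rule sum_mono)
        fix p assume p: "p \<in> R"
        have "(\<Sum>e\<in>E p. of_bool (r \<in> e \<and> t \<in> e) :: real) \<le> (\<Sum>e\<in>E p. of_bool (x r mod p = x t mod p) * of_bool (r \<in> e))"
          by (intro sum_mono) (auto simp: E_def mem)
        also have "\<dots> = of_bool (x r mod p = x t mod p) * of_bool (in_full_bin M n (u p) r)"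
          using that p by (simp add: sumE flip: sum_distrib_left)
        also have "\<dots> \<le> of_bool (x r mod p = x t mod p)" by simp
        finally show "(\<Sum>e\<in>E p. of_bool (r \<in> e \<and> t \<in> e) :: real) \<le> of_bool (x r mod p = x t mod p)" .
      qed
      also have "\<dots> = real (card {p\<in>R. x r mod p = x t mod p})"
        using R(1) by (simp add: sum.If_cases of_bool_def Int_def)
      also have "\<dots> \<le> real h" using collR[OF that] by simp
      finally show ?thesis .
    qed
    have q2: "real q \<ge> 2" if "q \<in> Q" for q using Q(2)[OF that] prime_ge_2_nat[of q] by simp
    show "0 < W" unfolding W_def by (intro prod_pos) (use q2 in \<open>force simp: field_simps\<close>)
    show "W \<le> 1" unfolding W_def by (intro prod_le_1) (use q2 in \<open>force simp: field_simps\<close>)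
    show "0 \<le> \<epsilon>" by (simp add: \<epsilon>_def)
    show "0 \<le> \<kappa>" "\<epsilon> + \<kappa> \<le> 1" by fact+
    show "W ^ card I * (1 - \<epsilon>) \<le> avg (sieve_space Q) (\<lambda>c. of_bool (I \<subseteq> survivors Q n x c)) \<and>
       avg (sieve_space Q) (\<lambda>c. of_bool (I \<subseteq> survivors Q n x c)) \<le> W ^ card I * (1 + \<epsilon>)"
      if I: "I \<subseteq> {..<n}" "card I \<le> 2 * M" for I
    proof -
      have e: "4 * real (2 * M) ^ 2 * real h / real z = \<epsilon>" by (simp add: \<epsilon>_def power_mult_distrib)
      have z1: "2 * (2 * M) \<le> z" and z2: "2 * real (2 * M) ^ 2 * real h \<le> real z" using z by (auto simp: power_mult_distrib)
      have coll: "card {q \<in> Q. x i mod q = x j mod q} \<le> h" if "i \<in> I" "j \<in> I" "i \<noteq> j" for i j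
        using that I by (intro collQ) auto
      show ?thesis unfolding W_def e[symmetric]
        by (intro conjI survival_probability_bounds) (use Q I z1 z2 h coll in auto)
    qed
    show "0 < m" "\<And>p. p \<in> R \<Longrightarrow> m \<le> prob_full M n p" by fact+
    show "(\<Sum>p\<in>R. (real (card (E p)) / (real n * prob_full M n p / real M) - 1) ^ 2) \<le> \<kappa> * real (card R)"
      using A1 by (simp add: cardE tp)
    have "(\<Sum>r<n. ((\<Sum>p\<in>R. (\<Sum>e\<in>E p. of_bool (r \<in> e)) / prob_full M n p) - real (card R)) ^ 2)
      = (\<Sum>r<n. ((\<Sum>p\<in>R. of_bool (in_full_bin M n (u p) r) / prob_full M n p) - real (card R)) ^ 2)"
      by (intro sum.cong refl arg_cong2[of _ _ _ _ "\<lambda>a b. (a - b) ^ 2"]) (simp add: sumE)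
    then show "(\<Sum>r<n. ((\<Sum>p\<in>R. (\<Sum>e\<in>E p. of_bool (r \<in> e)) / prob_full M n p) - real (card R)) ^ 2) \<le> \<kappa> * real n * real (card R) ^ 2"
      using A2 by simp
    show "real M * real h \<le> \<kappa> * real (card R) * m * W ^ (M - 1)" "real M \<le> \<kappa> * real n * m * W ^ M" by fact+
  qed
  define F where "F c = (\<Sum>r\<in>{..<n} \<inter> survivors Q n x c. \<Prod>p\<in>{p\<in>R. T p c \<le> w p}. 1 - N p r c / w p)" for c
  have "avg (sieve_space Q) F \<le> real n * W * (2 * exp (- \<Lambda> / 4) + 88 * (\<epsilon> + \<kappa>))"
    unfolding F_def by (rule avg_uncovered)
  moreover have "\<Lambda> = real (card R) * real M / (4 * real n * W)" by (simp add: \<Lambda>_def s_def)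
  moreover have "\<exists>d. real (card {r. r \<in> survivors Q n x c \<and> (\<forall>p\<in>R. x r mod p \<noteq> d p)}) \<le> F c" for c
  proof -
    \<comment> \<open>Only primes with at most \<open>w p\<close> surviving full bins take part in the random selection; at the
      others \<open>d\<close> is arbitrary.\<close>
    define PG where "PG = {p\<in>R. T p c \<le> w p}"
    define E' where "E' p = {e\<in>E p. e \<subseteq> survivors Q n x c}" for p
    have finE': "finite (E' p)" if "p \<in> PG" for p using finE[of p] that by (simp add: E'_def PG_def)
    have T: "real (card (E' p)) = T p c" if "p \<in> PG" for p
      using finE[of p] that by (simp add: E'_def T_def PG_def sum.If_cases of_bool_def Int_def)
    have Nn: "(\<Sum>e\<in>E' p. of_bool (v \<in> e)) = N p v c" if "p \<in> PG" for p v
    proof -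
      have "(\<Sum>e\<in>E' p. of_bool (v \<in> e)) = (\<Sum>e\<in>E p. of_bool (e \<subseteq> survivors Q n x c) * of_bool (v \<in> e) :: real)"
        unfolding E'_def using finE[of p] that by (intro sum_subset_of_bool) (simp add: PG_def)
      then show ?thesis by (simp add: N_def of_bool_conj mult.commute)
    qed
    have "\<exists>\<sigma>. (\<forall>p\<in>PG. \<sigma> p = {} \<or> \<sigma> p \<in> E' p) \<and>
      (\<Sum>v\<in>({..<n} \<inter> survivors Q n x c) - (\<Union>p\<in>PG. \<sigma> p). 1) \<le>
      (\<Sum>v\<in>{..<n} \<inter> survivors Q n x c. 1 * (\<Prod>p\<in>PG. 1 - (\<Sum>e\<in>E' p. of_bool (v \<in> e)) / w p))"
    proof (rule exists_good_edge_choice)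
      show "finite (E' p) \<and> real (card (E' p)) \<le> w p \<and> 0 < w p" if "p \<in> PG" for p
        using finE'[OF that] T[OF that] w_pos[of p] that by (simp add: PG_def)
    qed (use R in \<open>auto simp: PG_def\<close>)
    then obtain \<sigma> where \<sigma>: "\<forall>p\<in>PG. \<sigma> p = {} \<or> \<sigma> p \<in> E' p"
      "(\<Sum>v\<in>({..<n} \<inter> survivors Q n x c) - (\<Union>p\<in>PG. \<sigma> p). 1) \<le>
      (\<Sum>v\<in>{..<n} \<inter> survivors Q n x c. 1 * (\<Prod>p\<in>PG. 1 - (\<Sum>e\<in>E' p. of_bool (v \<in> e)) / w p))" by blast
    have "(\<Sum>v\<in>{..<n} \<inter> survivors Q n x c. 1 * (\<Prod>p\<in>PG. 1 - (\<Sum>e\<in>E' p. of_bool (v \<in> e)) / w p)) = F c"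
      unfolding F_def PG_def[symmetric] using Nn by (intro sum.cong refl) simp
    then have le: "real (card (({..<n} \<inter> survivors Q n x c) - (\<Union>p\<in>PG. \<sigma> p))) \<le> F c" using \<sigma>(2) by simp
    \<comment> \<open>A selected bin consists of positions with a common residue modulo \<open>p\<close>, and that residue is
      \<open>d p\<close>.\<close>
    have "\<forall>p\<in>PG. \<exists>d. \<forall>r\<in>\<sigma> p. x r mod p = d"
    proof
      fix p assume "p \<in> PG"
      then have "\<sigma> p = {} \<or> \<sigma> p \<in> E p" using \<sigma>(1) by (auto simp: E'_def)
      then show "\<exists>d. \<forall>r\<in>\<sigma> p. x r mod p = d" by (auto simp: E_def mem)
    qed
    then obtain d where d: "\<And>p r. p \<in> PG \<Longrightarrow> r \<in> \<sigma> p \<Longrightarrow> x r mod p = d p" by metis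
    have "{r. r \<in> survivors Q n x c \<and> (\<forall>p\<in>R. x r mod p \<noteq> d p)} \<subseteq> ({..<n} \<inter> survivors Q n x c) - (\<Union>p\<in>PG. \<sigma> p)"
      using d by (auto simp: survivors_def PG_def)
    then have "card {r. r \<in> survivors Q n x c \<and> (\<forall>p\<in>R. x r mod p \<noteq> d p)} \<le> card (({..<n} \<inter> survivors Q n x c) - (\<Union>p\<in>PG. \<sigma> p))"
      by (intro card_mono) auto
    then have "real (card {r. r \<in> survivors Q n x c \<and> (\<forall>p\<in>R. x r mod p \<noteq> d p)}) \<le> F c" using le by linarith
    then show ?thesis by blast
  qed
  ultimately show ?thesis by auto
qed

text \<open>The primes in \<open>A\<close> with residues \<open>r\<close> cover everything outside \<open>D\<close>; each element of \<open>D\<close> gets a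
  private prime from \<open>Fr\<close>. The Chinese remainder theorem provides \<open>b\<close>.\<close>

lemma assemble_modulus:
  fixes y :: "nat \<Rightarrow> nat" and A Fr :: "nat set" and r :: "nat \<Rightarrow> nat" and B :: nat
  assumes A: "finite A" "A \<noteq> {}" "\<And>q. q \<in> A \<Longrightarrow> prime q \<and> q \<le> B"
    and Fr: "finite Fr" "\<And>q. q \<in> Fr \<Longrightarrow> prime q \<and> q \<le> B" "A \<inter> Fr = {}"
    and D: "finite D" "card D \<le> card Fr" "\<And>m. m \<in> S - D \<Longrightarrow> \<exists>q\<in>A. y m mod q = r q"
  shows "\<exists>Q b :: int. squarefree Q \<and> Q \<ge> 2 \<and> (\<forall>m\<in>S. gcd (b - int (y m)) Q > 1) \<and>
     (\<forall>p. prime p \<and> p dvd Q \<longrightarrow> p \<le> int B) \<and>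
     ln (real_of_int Q) \<le> (\<Sum>q\<in>A. ln (real q)) + real (card D) * ln (real B)"
proof -
  obtain F0 where F0: "F0 \<subseteq> Fr" "card F0 = card D" "finite F0"
    using D(2) obtain_subset_with_card_n by metis
  obtain f where f: "bij_betw f D F0" using D(1) F0 finite_same_card_bij by metis
  define AF where "AF = A \<union> F0"
  have AF: "finite AF" "\<And>q. q \<in> AF \<Longrightarrow> prime q \<and> q \<le> B" "AF \<noteq> {}" using A F0 Fr by (auto simp: AF_def)
  define r' where "r' q = (if q \<in> A then r q else y (inv_into D f q))" for q
  have "\<exists>x. \<forall>q\<in>AF. [x = r' q] (mod q)"
    using AF by (intro chinese_remainder_nat) (auto intro: primes_coprime)
  then obtain b where b: "\<And>q. q \<in> AF \<Longrightarrow> [b = r' q] (mod q)" by blast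
  define Q where "Q = (\<Prod>q\<in>AF. int q)"
  have cov: "\<exists>q\<in>AF. [b = y m] (mod q)" if m: "m \<in> S" for m
  proof (cases "m \<in> D")
    case True
    then have fm: "f m \<in> F0" "inv_into D f (f m) = m" using f by (auto simp: bij_betw_def)
    then have "f m \<notin> A" using F0 Fr by auto
    then have "r' (f m) = y m" using fm by (simp add: r'_def)
    then show ?thesis using b[of "f m"] fm by (auto simp: AF_def)
  next
    case False
    then obtain q where q: "q \<in> A" "y m mod q = r q" using D(3)[of m] m by auto
    have "[b = r q] (mod q)" using b[of q] q by (simp add: AF_def r'_def)
    moreover have "[r q = y m] (mod q)" using q(2) by (metis cong_mod_left cong_refl)
    ultimately have "[b = y m] (mod q)" by (rule cong_trans)
    then show ?thesis using q by (auto simp: AF_def)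
  qed
  have sf: "squarefree Q" unfolding Q_def
  proof (rule squarefree_prod_coprime)
    fix p q assume "p \<in> AF" "q \<in> AF" "p \<noteq> q"
    then show "coprime (int p) (int q)" using AF by (auto intro: primes_coprime)
  next
    fix q assume "q \<in> AF"
    then have "prime (int q)" using AF(2) by simp
    then show "squarefree (int q)" by (intro squarefree_prime)
  qed
  have Q2: "Q \<ge> 2"
  proof -
    obtain q where q: "q \<in> AF" using AF by blast
    then have "int q dvd Q" unfolding Q_def using AF(1) by (intro dvd_prodI) auto
    moreover have "Q > 0" unfolding Q_def using AF by (intro prod_pos) (auto dest!: AF(2) simp: prime_gt_0_nat)
    ultimately have "int q \<le> Q" by (rule zdvd_imp_le)
    moreover have "q \<ge> 2" using AF(2)[OF q] prime_ge_2_nat by auto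
    ultimately show ?thesis by linarith
  qed
  have gcd: "gcd (int b - int (y m)) Q > 1" if m: "m \<in> S" for m
  proof -
    obtain q where q: "q \<in> AF" "[b = y m] (mod q)" using cov[OF m] by blast
    have "int q dvd int b - int (y m)" using q(2) by (metis cong_iff_dvd_diff cong_int_iff)
    moreover have "int q dvd Q" unfolding Q_def using AF(1) q(1) by (intro dvd_prodI) auto
    ultimately have "int q dvd gcd (int b - int (y m)) Q" by simp
    moreover have "gcd (int b - int (y m)) Q > 0" using Q2 by simp
    ultimately have "int q \<le> gcd (int b - int (y m)) Q" by (rule zdvd_imp_le)
    moreover have "q \<ge> 2" using AF(2)[OF q(1)] prime_ge_2_nat by auto
    ultimately show ?thesis by linarith
  qed
  have pd: "p \<le> int B" if "prime p" "p dvd Q" for p :: int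
  proof -
    obtain q where q: "q \<in> AF" "p dvd int q"
      using \<open>p dvd Q\<close> prime_dvd_prod_iff[OF AF(1) \<open>prime p\<close>, of int] unfolding Q_def by blast
    have "int q > 0" using AF(2)[OF q(1)] prime_gt_0_nat by auto
    then have "p \<le> int q" using q(2) by (intro zdvd_imp_le)
    then show ?thesis using AF(2)[OF q(1)] by linarith
  qed
  have q0: "real q > 0" if "q \<in> AF" for q using AF(2)[OF that] prime_gt_0_nat by auto
  have "ln (real_of_int Q) = (\<Sum>q\<in>AF. ln (real q))"
    unfolding Q_def using q0 AF(1) by (simp add: ln_prod)
  also have "\<dots> = (\<Sum>q\<in>A. ln (real q)) + (\<Sum>q\<in>F0. ln (real q))"
    unfolding AF_def using A F0 Fr by (intro sum.union_disjoint) auto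
  also have "(\<Sum>q\<in>F0. ln (real q)) \<le> (\<Sum>q\<in>F0. ln (real B))"
  proof (rule sum_mono)
    fix q assume q: "q \<in> F0"
    then have "real q > 0" by (intro q0) (simp add: AF_def)
    moreover have "q \<le> B" using F0(1) Fr(2) q by blast
    ultimately show "ln (real q) \<le> ln (real B)" by simp
  qed
  finally have "ln (real_of_int Q) \<le> (\<Sum>q\<in>A. ln (real q)) + real (card D) * ln (real B)" by (simp add: F0)
  then show ?thesis using sf Q2 gcd pd by blast
qed

section \<open>All classes together\<close>

text \<open>The construction for one \<open>K\<close> with all parameters explicit, for random integers \<open>y k\<close> in place
  of \<open>\<lfloor>a ^ k\<rfloor>\<close>. The class \<open>g\<close> has the exponents \<open>e g i\<close> with \<open>i < n\<close>, and \<open>l0\<close> bounds the number of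
  exponents in no class. The sieve primes are \<open>Q\<close>, the block of large primes of the class \<open>g\<close> is
  \<open>R g\<close>, and \<open>Fr\<close> is the reserve of private primes. Residues are almost uniform modulo all \<open>d \<le> D\<close>;
  the bound \<open>B ^ h \<le> D\<close> admits products of \<open>h\<close> primes.\<close>

lemma good_modulus_at_scale:
  fixes P :: "'a measure" and y :: "nat \<Rightarrow> 'a \<Rightarrow> nat" and e :: "nat \<Rightarrow> nat \<Rightarrow> nat"
    and Gs Q Fr :: "nat set" and R :: "nat \<Rightarrow> nat set" and B D K n M h z s :: nat and m \<kappa> \<delta> L l0 :: real
  defines "W \<equiv> (\<Prod>q\<in>Q. 1 - 1 / real q)"
    and "\<epsilon> \<equiv> 16 * real M ^ 2 * real h / real z"
  defines "left \<equiv> l0 + real (card Gs) * (real n * W * (2 * exp (- (real s * real M / (4 * real n * W)) / 4) + 88 * (\<epsilon> + \<kappa>)))"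
  assumes P: "prob_space P" and ymeas: "\<And>k. y k \<in> measurable P (count_space UNIV)"
    and quasi: "\<And>g d c. g \<in> Gs \<Longrightarrow> 1 \<le> d \<Longrightarrow> d \<le> D \<Longrightarrow>
       measure P {a \<in> space P. \<forall>i<n. y (e g i) a mod d = c i} \<le> (1 + \<delta>) / real d ^ n"
    and D: "B ^ h \<le> D" "h \<ge> 2" "B \<ge> 1" and \<delta>: "0 \<le> \<delta>" "\<delta> \<le> 1"
    and Gs: "finite Gs" and e: "real (card ({1..K} - (\<Union>g\<in>Gs. e g ` {..<n}))) \<le> l0"
    and Q: "finite Q" "Q \<noteq> {}" "\<And>q. q \<in> Q \<Longrightarrow> prime q \<and> z < q \<and> q \<le> B" "z \<ge> 1"
    and R: "\<And>g. g \<in> Gs \<Longrightarrow> card (R g) = s" "s \<ge> 1"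
      "\<And>g p. g \<in> Gs \<Longrightarrow> p \<in> R g \<Longrightarrow> prime p \<and> p \<le> B \<and> 4 * M \<le> p \<and> L \<le> real p \<and> p \<notin> Q"
      "\<And>g g'. g \<in> Gs \<Longrightarrow> g' \<in> Gs \<Longrightarrow> g \<noteq> g' \<Longrightarrow> R g \<inter> R g' = {}"
    and Fr: "finite Fr" "\<And>p. p \<in> Fr \<Longrightarrow> prime p \<and> p \<le> B \<and> p \<notin> Q \<and> (\<forall>g\<in>Gs. p \<notin> R g)" "left \<le> real (card Fr)"
    and M: "M \<ge> 2" "2 * M \<le> n" and z: "4 * M \<le> z" "8 * real M ^ 2 * real h \<le> real z"
    and kap: "0 < \<kappa>" "\<epsilon> + \<kappa> \<le> 1" and L: "L > 0"
    and m: "0 < m" "m \<le> 1" "\<And>g p. g \<in> Gs \<Longrightarrow> p \<in> R g \<Longrightarrow> m \<le> prob_full M n p"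
    and k1: "real M * real h \<le> \<kappa> * real s * m * W ^ (M - 1)"
    and k2: "real M \<le> \<kappa> * real n * m * W ^ M"
  shows "\<exists>N\<in>sets P. measure P N \<le> real (card Gs) * (real n ^ 2 * (1 + \<delta>) * exp (2 * (\<Sum>q | prime q \<and> q \<le> B. 1 / real q)) / 2 ^ h
        + ((2 * real M / (real n * m) + 16 * real M / L) / \<kappa> + (2 / (real s * m) + \<delta> / m ^ 2) / \<kappa>)) \<and>
     (\<forall>a\<in>space P - N. \<exists>Q' b :: int. squarefree Q' \<and> Q' \<ge> 2 \<and>
        (\<forall>k\<in>{1..K}. gcd (b - int (y k a)) Q' > 1) \<and> (\<forall>p. prime p \<and> p dvd Q' \<longrightarrow> p \<le> int B) \<and>
        ln (real_of_int Q') \<le> (\<Sum>q\<in>Q. ln (real q)) + (real (card Gs) * real s + left) * ln (real B))"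
proof -
  define PR where "PR = {q::nat. prime q \<and> q \<le> B}"
  have finPR: "finite PR" unfolding PR_def by (rule finite_subset[of _ "{..B}"]) auto
  have n: "n \<ge> 1" using M by linarith
  have finR: "finite (R g)" "R g \<noteq> {}" if "g \<in> Gs" for g
  proof -
    have "card (R g) > 0" using R(1)[OF that] R(2) by simp
    then show "finite (R g)" "R g \<noteq> {}" by (auto simp: card_gt_0_iff)
  qed
  define u where "u g a p = restrict (\<lambda>i. y (e g i) a mod p) {..<n}" for g a p
  define good where "good g a \<longleftrightarrow> (\<forall>i<n. \<forall>j<n. i \<noteq> j \<longrightarrow> card {q\<in>PR. y (e g i) a mod q = y (e g j) a mod q} < h) \<and>
    (\<Sum>p\<in>R g. (real (card (full_bins M n p (u g a p))) / exp_bins M n p - 1) ^ 2) \<le> \<kappa> * real s \<and>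
    (\<Sum>r<n. ((\<Sum>p\<in>R g. of_bool (in_full_bin M n (u g a p) r) / prob_full M n p) - real s) ^ 2)
           \<le> \<kappa> * real n * real s ^ 2" for g a
  define C where "C = real n ^ 2 * (1 + \<delta>) * exp (2 * (\<Sum>q\<in>PR. 1 / real q)) / 2 ^ h
        + ((2 * real M / (real n * m) + 16 * real M / L) / \<kappa> + (2 / (real s * m) + \<delta> / m ^ 2) / \<kappa>)"
  have ex: "\<exists>N\<in>sets P. measure P N \<le> C \<and> (\<forall>a\<in>space P - N. good g a)" if g: "g \<in> Gs" for g
  proof -
    have prod: "1 \<le> \<Prod>A \<and> \<Prod>A \<le> D" if A: "A \<subseteq> PR" "card A = h" for A
    proof -
      have "\<Prod>A \<ge> 1" using A by (intro prod_ge_1) (auto simp: PR_def prime_ge_1_nat Suc_le_eq prime_gt_0_nat)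
      moreover have "\<Prod>A \<le> (\<Prod>q\<in>A. B)" using A by (intro prod_mono) (auto simp: PR_def)
      moreover have "(\<Prod>q\<in>A. B) = B ^ h" using A by simp
      ultimately show ?thesis using D(1) by linarith
    qed
    obtain N1 where N1: "N1 \<in> sets P" "measure P N1 \<le> real n ^ 2 * (1 + \<delta>) * exp (2 * (\<Sum>q\<in>PR. 1 / real q)) / 2 ^ h"
      "\<forall>a\<in>space P - N1. \<forall>i<n. \<forall>j<n. i \<noteq> j \<longrightarrow> card {q\<in>PR. y (e g i) a mod q = y (e g j) a mod q} < h"
      using prob_many_common_primes[where X = "\<lambda>i. y (e g i)" and Q = PR and n = n and h = h, OF P ymeas finPR _ n \<delta>(1) quasi[OF g]]
        prod PR_def by blast
    have Rg: "prime p \<and> 4 * M \<le> p \<and> L \<le> real p" "p \<le> B" "p \<ge> 1" if "p \<in> R g" for p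
      using R(3)[OF g that] prime_ge_1_nat by auto
    have BB: "B \<le> D" "B * B \<le> D"
    proof -
      have "B ^ 1 \<le> B ^ h" "B ^ 2 \<le> B ^ h" using D by (intro power_increasing; simp)+
      then show "B \<le> D" "B * B \<le> D" using D(1) by (auto simp: power2_eq_square)
    qed
    have q1: "measure P {a \<in> space P. \<forall>i<n. y (e g i) a mod p = c i} \<le> (1 + \<delta>) / real p ^ n" if "p \<in> R g" for p c
      using Rg[OF that] BB by (intro quasi g) auto
    have q2: "measure P {a \<in> space P. \<forall>i<n. y (e g i) a mod (p * p') = c i} \<le> (1 + \<delta>) / real (p * p') ^ n"
      if "p \<in> R g" "p' \<in> R g" for p p' c
    proof (rule quasi[OF g])
      show "1 \<le> p * p'" using Rg(3)[OF that(1)] Rg(3)[OF that(2)] by simp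
      have "p * p' \<le> B * B" using Rg(2)[OF that(1)] Rg(2)[OF that(2)] by (intro mult_mono) auto
      then show "p * p' \<le> D" using BB by linarith
    qed
    have "\<exists>N2\<in>sets P. measure P N2 \<le> (2 * real M / (real n * m) + 16 * real M / L) / \<kappa> + (2 / (real s * m) + \<delta> / m ^ 2) / \<kappa> \<and>
      (\<forall>a\<in>space P - N2. (\<Sum>p\<in>R g. (real (card (full_bins M n p (u g a p))) / exp_bins M n p - 1) ^ 2) \<le> \<kappa> * real s \<and>
        (\<Sum>r<n. ((\<Sum>p\<in>R g. of_bool (in_full_bin M n (u g a p) r) / prob_full M n p) - real s) ^ 2)
           \<le> \<kappa> * real n * real s ^ 2)"
      unfolding u_def R(1)[OF g, symmetric]
      by (rule prob_irregular_full_bins[where X = "\<lambda>i. y (e g i)"])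
         (use P ymeas finR[OF g] Rg L M \<delta> kap m(1,2) m(3)[OF g] q1 q2 in auto)
    then obtain N2 where N2: "N2 \<in> sets P"
      "measure P N2 \<le> (2 * real M / (real n * m) + 16 * real M / L) / \<kappa> + (2 / (real s * m) + \<delta> / m ^ 2) / \<kappa>"
      "\<forall>a\<in>space P - N2. (\<Sum>p\<in>R g. (real (card (full_bins M n p (u g a p))) / exp_bins M n p - 1) ^ 2) \<le> \<kappa> * real s \<and>
        (\<Sum>r<n. ((\<Sum>p\<in>R g. of_bool (in_full_bin M n (u g a p) r) / prob_full M n p) - real s) ^ 2)
           \<le> \<kappa> * real n * real s ^ 2" by blast
    have "measure P (N1 \<union> N2) \<le> measure P N1 + measure P N2"
      using N1(1) N2(1) by (rule measure_Un_le)
    then have "measure P (N1 \<union> N2) \<le> C" using N1(2) N2(2) by (simp add: C_def)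
    moreover have "good g a" if "a \<in> space P - (N1 \<union> N2)" for a
      using N1(3) N2(3) that by (auto simp: good_def)
    ultimately show ?thesis using N1(1) N2(1) by (intro bexI[of _ "N1 \<union> N2"]) auto
  qed
  then obtain Ng where Ng: "\<And>g. g \<in> Gs \<Longrightarrow> Ng g \<in> sets P" "\<And>g. g \<in> Gs \<Longrightarrow> measure P (Ng g) \<le> C"
    "\<And>g a. g \<in> Gs \<Longrightarrow> a \<in> space P - Ng g \<Longrightarrow> good g a" by metis
  define N where "N = (\<Union>g\<in>Gs. Ng g)"
  have N: "N \<in> sets P" unfolding N_def using Ng(1) Gs by (intro sets.finite_UN) auto
  have "measure P N \<le> (\<Sum>g\<in>Gs. measure P (Ng g))"
    unfolding N_def using Ng(1) Gs by (intro measure_UNION_le) auto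
  also have "\<dots> \<le> (\<Sum>g\<in>Gs. C)" using Ng(2) by (intro sum_mono) auto
  finally have mN: "measure P N \<le> real (card Gs) * C" by simp
  have main: "\<exists>Q' b :: int. squarefree Q' \<and> Q' \<ge> 2 \<and>
        (\<forall>k\<in>{1..K}. gcd (b - int (y k a)) Q' > 1) \<and> (\<forall>p. prime p \<and> p dvd Q' \<longrightarrow> p \<le> int B) \<and>
        ln (real_of_int Q') \<le> (\<Sum>q\<in>Q. ln (real q)) + (real (card Gs) * real s + left) * ln (real B)"
    if a: "a \<in> space P - N" for a
  proof -
    have gd: "good g a" if "g \<in> Gs" for g using a that by (intro Ng(3)) (auto simp: N_def)
    define bnd where "bnd = real n * W * (2 * exp (- (real s * real M / (4 * real n * W)) / 4) + 88 * (\<epsilon> + \<kappa>))"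
    have h1: "h \<ge> 1" using D by simp
    define cov where "cov g F \<longleftrightarrow> avg (sieve_space Q) F \<le> bnd \<and>
       (\<forall>c\<in>sieve_space Q. \<exists>d. real (card {r. r \<in> survivors Q n (\<lambda>i. y (e g i) a) c \<and> (\<forall>p\<in>R g. y (e g r) a mod p \<noteq> d p)}) \<le> F c)" for g F
    have "\<exists>F. cov g F" if g: "g \<in> Gs" for g
      unfolding cov_def bnd_def W_def \<epsilon>_def R(1)[OF g, symmetric]
    proof (rule class_cover[where m = m])
      fix i j assume ij: "i < n" "j < n" "i \<noteq> j"
      have lt: "card {q\<in>PR. y (e g i) a mod q = y (e g j) a mod q} < h" using gd[OF g] ij by (auto simp: good_def)
      have "card {q\<in>Q. y (e g i) a mod q = y (e g j) a mod q} \<le> card {q\<in>PR. y (e g i) a mod q = y (e g j) a mod q}"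
        using Q(3) finPR by (intro card_mono) (auto simp: PR_def)
      then show "card {q\<in>Q. y (e g i) a mod q = y (e g j) a mod q} \<le> h" using lt by simp
      have "card {q\<in>R g. y (e g i) a mod q = y (e g j) a mod q} \<le> card {q\<in>PR. y (e g i) a mod q = y (e g j) a mod q}"
        using R(3)[OF g] finPR by (intro card_mono) (auto simp: PR_def)
      then show "card {q\<in>R g. y (e g i) a mod q = y (e g j) a mod q} \<le> h" using lt by simp
    next
      show "(\<Sum>p\<in>R g. (real (card (full_bins M n p (restrict (\<lambda>i. y (e g i) a mod p) {..<n}))) / exp_bins M n p - 1) ^ 2) \<le> \<kappa> * real (card (R g))"
        using gd[OF g] by (simp add: good_def u_def R(1)[OF g])
      show "(\<Sum>r<n. ((\<Sum>p\<in>R g. of_bool (in_full_bin M n (restrict (\<lambda>i. y (e g i) a mod p) {..<n}) r) / prob_full M n p) - real (card (R g))) ^ 2)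
           \<le> \<kappa> * real n * real (card (R g)) ^ 2"
        using gd[OF g] by (simp add: good_def u_def R(1)[OF g])
    qed (use Q R(3)[OF g] finR[OF g] M n h1 z kap m(1) m(3)[OF g] k1 k2 in \<open>auto simp: W_def \<epsilon>_def R(1)[OF g]\<close>)
    then obtain F where F: "\<And>g. g \<in> Gs \<Longrightarrow> cov g (F g)" using bchoice[of Gs cov] by blast
    \<comment> \<open>The sieve primes are shared by all classes, so \<open>c\<close> is chosen for the sum over the classes.\<close>
    have "\<exists>c\<in>sieve_space Q. (\<Sum>g\<in>Gs. F g c) \<le> avg (sieve_space Q) (\<lambda>c. \<Sum>g\<in>Gs. F g c)"
      by (rule avg_le_exists) (use sieve_space_finite Q in auto)
    then obtain c where c: "c \<in> sieve_space Q" "(\<Sum>g\<in>Gs. F g c) \<le> avg (sieve_space Q) (\<lambda>c. \<Sum>g\<in>Gs. F g c)" by blast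
    have "(\<Sum>g\<in>Gs. avg (sieve_space Q) (F g)) \<le> (\<Sum>g\<in>Gs. bnd)" using F by (intro sum_mono) (simp add: cov_def)
    then have Fsum: "(\<Sum>g\<in>Gs. F g c) \<le> real (card Gs) * bnd"
      using c(2) unfolding avg_sum[of "sieve_space Q" F Gs] by simp
    define few where "few g d \<longleftrightarrow> real (card {r. r \<in> survivors Q n (\<lambda>i. y (e g i) a) c \<and> (\<forall>p\<in>R g. y (e g r) a mod p \<noteq> d p)}) \<le> F g c" for g and d :: "nat \<Rightarrow> nat"
    have "\<exists>d. few g d" if "g \<in> Gs" for g using F[OF that] c(1) by (simp add: cov_def few_def)
    then obtain d where d: "\<And>g. g \<in> Gs \<Longrightarrow> few g (d g)" using bchoice[of Gs few] by blast
    \<comment> \<open>\<open>cls p\<close> is the class to whose block the large prime \<open>p\<close> belongs.\<close>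
    define cls where "cls p = (SOME g. g \<in> Gs \<and> p \<in> R g)" for p
    have cls: "cls p = g" if "g \<in> Gs" "p \<in> R g" for g p
    proof -
      have "cls p \<in> Gs \<and> p \<in> R (cls p)"
        unfolding cls_def using that by (intro someI[of "\<lambda>g. g \<in> Gs \<and> p \<in> R g" g] conjI)
      then show ?thesis using R(4)[of "cls p" g] that by blast
    qed
    define res where "res q = (if q \<in> Q then c q else d (cls q) q)" for q
    define A where "A = Q \<union> (\<Union>g\<in>Gs. R g)"
    define E0 where "E0 = {1..K} - (\<Union>g\<in>Gs. e g ` {..<n})"
    define U where "U g = {r. r \<in> survivors Q n (\<lambda>i. y (e g i) a) c \<and> (\<forall>p\<in>R g. y (e g r) a mod p \<noteq> d g p)}" for g
    have finU: "finite (U g)" for g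
      by (rule finite_subset[of _ "{..<n}"]) (auto simp: U_def survivors_def)
    \<comment> \<open>The exponents that need a private prime.\<close>
    define D0 where "D0 = E0 \<union> (\<Union>g\<in>Gs. e g ` U g)"
    have finD0: "finite D0" unfolding D0_def E0_def using Gs finU by auto
    have "card D0 \<le> card E0 + card (\<Union>g\<in>Gs. e g ` U g)" unfolding D0_def by (rule card_Un_le)
    also have "card (\<Union>g\<in>Gs. e g ` U g) \<le> (\<Sum>g\<in>Gs. card (e g ` U g))" using Gs by (rule card_UN_le)
    also have "\<dots> \<le> (\<Sum>g\<in>Gs. card (U g))" using finU by (intro sum_mono card_image_le)
    finally have "card D0 \<le> card E0 + (\<Sum>g\<in>Gs. card (U g))" by simp
    then have "real (card D0) \<le> real (card E0 + (\<Sum>g\<in>Gs. card (U g)))" by (rule of_nat_mono)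
    then have "real (card D0) \<le> real (card E0) + (\<Sum>g\<in>Gs. real (card (U g)))" by simp
    moreover have "real (card E0) \<le> l0" using e by (simp add: E0_def)
    moreover have "(\<Sum>g\<in>Gs. real (card (U g))) \<le> (\<Sum>g\<in>Gs. F g c)"
      unfolding U_def using d by (intro sum_mono) (simp add: few_def)
    ultimately have cD0: "real (card D0) \<le> left" using Fsum unfolding left_def bnd_def by linarith
    have *: "\<exists>Q' b :: int. squarefree Q' \<and> Q' \<ge> 2 \<and>
        (\<forall>k\<in>{1..K}. gcd (b - int (y k a)) Q' > 1) \<and> (\<forall>p. prime p \<and> p dvd Q' \<longrightarrow> p \<le> int B) \<and>
        ln (real_of_int Q') \<le> (\<Sum>q\<in>A. ln (real q)) + real (card D0) * ln (real B)"
    proof (rule assemble_modulus[where Fr = Fr and r = res])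
      show "finite A" "A \<noteq> {}" "\<And>q. q \<in> A \<Longrightarrow> prime q \<and> q \<le> B"
        using Q R(3) finR Gs by (auto simp: A_def)
      show "finite Fr" "\<And>q. q \<in> Fr \<Longrightarrow> prime q \<and> q \<le> B" "A \<inter> Fr = {}" using Fr by (auto simp: A_def)
      show "finite D0" by (rule finD0)
      show "card D0 \<le> card Fr" using cD0 Fr(3) by linarith
      fix k assume k: "k \<in> {1..K} - D0"
      then obtain g i where gi: "g \<in> Gs" "i < n" "k = e g i" by (auto simp: D0_def E0_def)
      then have "i \<notin> U g" using k by (auto simp: D0_def)
      then consider q where "q \<in> Q" "c q = y (e g i) a mod q" | p where "p \<in> R g" "y (e g i) a mod p = d g p"
        using gi by (auto simp: U_def survivors_def)
      then show "\<exists>q\<in>A. y k a mod q = res q"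
      proof cases
        case 1
        then show ?thesis using gi by (intro bexI[of _ q]) (auto simp: A_def res_def)
      next
        case 2
        then have "p \<notin> Q" using R(3)[OF gi(1)] by auto
        then show ?thesis using gi 2 cls[OF gi(1) 2(1)] by (intro bexI[of _ p]) (auto simp: A_def res_def)
      qed
    qed
    have **: "(\<Sum>q\<in>A. ln (real q)) + real (card D0) * ln (real B) \<le> (\<Sum>q\<in>Q. ln (real q)) + (real (card Gs) * real s + left) * ln (real B)"
    proof -
      have "(\<Sum>q\<in>A. ln (real q)) = (\<Sum>q\<in>Q. ln (real q)) + (\<Sum>q\<in>(\<Union>g\<in>Gs. R g). ln (real q))"
        unfolding A_def using Q Gs finR R(3) by (intro sum.union_disjoint) auto
      also have "(\<Sum>q\<in>(\<Union>g\<in>Gs. R g). ln (real q)) = (\<Sum>g\<in>Gs. \<Sum>q\<in>R g. ln (real q))"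
        using Gs finR R(4) by (intro sum.UNION_disjoint) auto
      also have "\<dots> \<le> (\<Sum>g\<in>Gs. \<Sum>q\<in>R g. ln (real B))"
      proof (intro sum_mono)
        fix g q assume "g \<in> Gs" "q \<in> R g"
        then have "prime q" "q \<le> B" using R(3) by auto
        moreover have "real q > 0" using prime_gt_0_nat[OF calculation(1)] by simp
        ultimately show "ln (real q) \<le> ln (real B)" by simp
      qed
      also have "\<dots> = real (card Gs) * real s * ln (real B)" using R(1) by simp
      finally have "(\<Sum>q\<in>A. ln (real q)) \<le> (\<Sum>q\<in>Q. ln (real q)) + real (card Gs) * real s * ln (real B)" by simp
      moreover have "real (card D0) * ln (real B) \<le> left * ln (real B)" using cD0 D(3) by (intro mult_right_mono) auto
      ultimately show ?thesis by (simp add: distrib_right)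
    qed
    show ?thesis using order_trans[OF _ **] * by blast
  qed
  show ?thesis using N mN main unfolding C_def PR_def by (intro bexI[of _ N]) auto
qed

section \<open>Estimates for the sieve and for the residues\<close>

lemma sieve_asymptotics:
  shows "\<forall>\<^sub>F j in sequentially. (3 * log 2 (real j) + 1) ^ 4 * exp 5 / ((real j - 1) / 2 * ln 2) \<le> real j powr (-31/32)"
    and "\<forall>\<^sub>F j in sequentially. 1 / real j ^ 5 \<le> exp (-5) / (real j / 2) ^ 4"
    and "\<forall>\<^sub>F j in sequentially. real j ^ 3 * (real j / 2) < 2 powr ((real j - 1) / 2) - 1"
  by real_asymp+

text \<open>The sieve primes leave a proportion of at most \<open>j powr (-31/32)\<close>. Removing the primes up to
  \<open>j ^ 3\<close> from the product costs only a power of \<open>log j\<close>, so the exponent can be any number above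
  \<open>-1\<close>.\<close>

lemma sieve_product_bounds:
  "\<forall>\<^sub>F j in sequentially. 1 / real j ^ 5 \<le> (\<Prod>q | prime q \<and> j ^ 3 < q \<and> q \<le> 2 ^ (j div 2). 1 - 1 / real q) \<and>
     (\<Prod>q | prime q \<and> j ^ 3 < q \<and> q \<le> 2 ^ (j div 2). 1 - 1 / real q) \<le> real j powr (-31/32)"
  using sieve_asymptotics eventually_ge_at_top[of 4]
proof eventually_elim
  case (elim j)
  define Y :: nat where "Y = 2 ^ (j div 2)"
  \<comment> \<open>A power of two above \<open>j ^ 3\<close> is \<open>2 ^ I0\<close>, where \<open>I0\<close> has the order of \<open>log j\<close>.\<close>
  define I0 where "I0 = nat \<lceil>3 * log 2 (real j)\<rceil>"
  define A where "A = {q::nat. prime q \<and> q \<le> j ^ 3}"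
  define Q where "Q = {q::nat. prime q \<and> j ^ 3 < q \<and> q \<le> Y}"
  define W where "W = (\<Prod>q\<in>Q. 1 - 1 / real q)"
  have j: "real j \<ge> 4" using elim by simp
  have lj: "log 2 (real j) \<ge> 2"
  proof -
    have "log 2 (2 powr 2) \<le> log 2 (real j)" using j by (intro log_le_cancel_iff[THEN iffD2]) auto
    then show ?thesis by (simp only: log_powr_cancel)
  qed
  have fac: "0 < 1 - 1 / real q" "1 - 1 / real q \<le> 1" if "prime q" for q :: nat
    using prime_ge_2_nat[OF that] by (auto simp: field_simps)
  have finAll: "finite {q::nat. prime q \<and> q \<le> N}" for N by (rule finite_subset[of _ "{..N}"]) auto
  have Q_sub: "Q \<subseteq> {q. prime q \<and> q \<le> Y}" by (auto simp: Q_def)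
  have fac': "0 \<le> 1 - 1 / real q \<and> 1 - 1 / real q \<le> 1" if "prime q" for q :: nat
    using fac[OF that] by linarith
  have Wpos: "W > 0" unfolding W_def
  proof (rule prod_pos)
    fix q assume "q \<in> Q"
    then show "0 < 1 - 1 / real q" by (intro fac) (simp add: Q_def)
  qed
  have "real j \<le> real (2 * (j div 2) + 1)" "real (2 * (j div 2)) \<le> real j"
    by (rule of_nat_mono, linarith)+
  then have jd: "(real j - 1) / 2 \<le> real (j div 2)" "real (j div 2) \<le> real j / 2" by simp_all
  have "1 / real j ^ 5 \<le> exp (-5) / (real j / 2) ^ 4" by (rule elim)
  also have "\<dots> \<le> exp (-5) / real (j div 2) ^ 4"
    using jd j by (intro divide_left_mono power_mono mult_pos_pos) auto
  also have "\<dots> \<le> (\<Prod>q | prime q \<and> q \<le> Y. 1 - 1 / real q)"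
    unfolding Y_def using elim by (intro euler_prod_lower) auto
  also have "\<dots> = W * (\<Prod>q\<in>{q. prime q \<and> q \<le> Y} - Q. 1 - 1 / real q)"
    unfolding W_def using finAll Q_sub by (subst prod.subset_diff[of Q]) (auto simp: mult.commute)
  also have "\<dots> \<le> W * 1"
    by (rule mult_left_mono, rule prod_le_1, rule fac') (use Wpos in auto)
  finally have lower: "1 / real j ^ 5 \<le> W" by simp
  have I0: "real I0 \<ge> 3 * log 2 (real j)" "real I0 \<le> 3 * log 2 (real j) + 1" "I0 \<ge> 2"
    unfolding I0_def using lj by linarith+
  have "real (j ^ 3) = 2 powr (3 * log 2 (real j))"
    using j by (simp add: powr_mult_base powr_powr[symmetric] mult.commute[of 3] flip: powr_numeral)
  also have "\<dots> \<le> 2 powr (real I0)" using I0 by simp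
  also have "\<dots> = real (2 ^ I0)" by (simp add: powr_realpow)
  finally have z: "j ^ 3 \<le> 2 ^ I0" by (simp only: of_nat_le_iff)
  have Z: "exp (-5) / real I0 ^ 4 \<le> (\<Prod>q\<in>A. 1 - 1 / real q)"
  proof -
    have "exp (-5) / real I0 ^ 4 \<le> (\<Prod>q | prime q \<and> q \<le> 2 ^ I0. 1 - 1 / real q)"
      using I0 by (intro euler_prod_lower)
    also have "\<dots> = (\<Prod>q\<in>A. 1 - 1 / real q) * (\<Prod>q\<in>{q. prime q \<and> q \<le> 2 ^ I0} - A. 1 - 1 / real q)"
      using finAll z by (subst prod.subset_diff[of A]) (auto simp: A_def mult.commute)
    also have "\<dots> \<le> (\<Prod>q\<in>A. 1 - 1 / real q) * 1"
      by (rule mult_left_mono, rule prod_le_1, rule fac', simp, rule prod_nonneg)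
        (use fac' in \<open>simp add: A_def\<close>)
    finally show ?thesis by simp
  qed
  have "j ^ 3 \<le> Y"
  proof -
    have "real (j ^ 3) * 1 \<le> real j ^ 3 * (real j / 2)" using j by (simp add: mult_left_mono)
    also have "\<dots> \<le> 2 powr ((real j - 1) / 2)" using elim by linarith
    also have "\<dots> \<le> 2 powr (real (j div 2))" using jd by simp
    also have "\<dots> = real Y" by (simp add: Y_def powr_realpow)
    finally show ?thesis by (simp only: of_nat_le_iff mult_1_right)
  qed
  then have "{q. prime q \<and> q \<le> Y} = Q \<union> A" "Q \<inter> A = {}" by (auto simp: Q_def A_def)
  then have split: "(\<Prod>q | prime q \<and> q \<le> Y. 1 - 1 / real q) = W * (\<Prod>q\<in>A. 1 - 1 / real q)"
    unfolding W_def using finAll[of Y] by (subst prod.union_disjoint[symmetric]) auto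
  have Ypos: "ln (real Y) > 0" "ln (real Y) = real (j div 2) * ln 2" using elim by (auto simp: Y_def ln_realpow)
  have "W * (exp (-5) / real I0 ^ 4) \<le> W * (\<Prod>q\<in>A. 1 - 1 / real q)" using Z Wpos by (intro mult_left_mono) auto
  also have "\<dots> \<le> 1 / ln (real Y)"
  proof -
    have "(2::nat) ^ 1 \<le> 2 ^ (j div 2)" using elim by (intro power_increasing) auto
    then show ?thesis unfolding split[symmetric] by (intro euler_prod_upper) (simp add: Y_def)
  qed
  finally have "W \<le> real I0 ^ 4 * exp 5 / ln (real Y)"
    using I0 Ypos by (simp add: exp_minus field_simps)
  also have "\<dots> \<le> (3 * log 2 (real j) + 1) ^ 4 * exp 5 / ((real j - 1) / 2 * ln 2)"
    unfolding Ypos(2) using I0 jd j by (intro frac_le mult_right_mono power_mono mult_nonneg_nonneg) auto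
  also have "\<dots> \<le> real j powr (-31/32)" by (rule elim)
  finally show ?case using lower unfolding W_def Q_def Y_def by simp
qed

text \<open>For \<open>p \<ge> n\<close> the factor \<open>(1 - 1 / p) ^ (n - M)\<close> is at least \<open>exp (-2)\<close>, which exceeds \<open>1 / 9\<close>.\<close>

lemma prob_full_lower:
  assumes "M \<ge> 2" "2 * M \<le> n" "n \<le> p" "p \<ge> 2"
  shows "prob_full M n p \<ge> 1 / 9 * (real (n - 1) / (real M * real p)) ^ (M - 1)"
proof -
  define k where "k = M - 1"
  have k: "k \<ge> 1" "k \<le> n - 1" "M = Suc k" "n = Suc k + (n - M)" using assms by (auto simp: k_def)
  have "(real (n - 1) / (real M * real p)) ^ k \<le> (real (n - 1) / real k / real p) ^ k"
    using k assms by (intro power_mono) (auto intro!: divide_left_mono mult_mono)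
  also have "\<dots> = (real (n - 1) / real k) ^ k / real p ^ k" by (rule power_divide)
  also have "\<dots> \<le> real ((n - 1) choose k) / real p ^ k"
    using binomial_ge_n_over_k_pow_k[of k "n - 1", where 'a = real] k by (intro divide_right_mono) auto
  finally have 1: "(real (n - 1) / (real M * real p)) ^ k \<le> real ((n - 1) choose k) / real p ^ k" .
  have 2: "1 / 9 \<le> (1 - 1 / real p) ^ (n - M)"
  proof -
    have "exp (2::real) = exp 1 * exp 1" by (simp flip: exp_add)
    also have "\<dots> \<le> 3 * 3" by (intro mult_mono exp_le) auto
    finally have "1 / 9 \<le> exp (- 2 :: real)" by (simp add: exp_minus field_simps)
    also have "\<dots> \<le> exp (- 2 * (1 / real p)) ^ (n - M)"
    proof -
      have "real (n - M) \<le> real p" using assms by simp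
      then have "real (n - M) * (- 2 * (1 / real p)) \<ge> - 2" using assms by (simp add: field_simps)
      then show ?thesis by (simp flip: exp_of_nat_mult)
    qed
    also have "\<dots> \<le> (1 - 1 / real p) ^ (n - M)"
      using assms by (intro power_mono one_minus_ge_exp) (auto simp: field_simps)
    finally show ?thesis .
  qed
  have "real p ^ n = real p * real p ^ k * real p ^ (n - M)"
    using k(4) by (metis power_add power_Suc)
  then have "prob_full M n p = real ((n - 1) choose k) / real p ^ k * ((real p - 1) ^ (n - M) / real p ^ (n - M))"
    using assms by (simp add: prob_full_def k_def)
  also have "(real p - 1) ^ (n - M) / real p ^ (n - M) = (1 - 1 / real p) ^ (n - M)"
    using assms by (simp add: power_divide[symmetric] diff_divide_distrib)
  also have "real ((n - 1) choose k) / real p ^ k * (1 - 1 / real p) ^ (n - M)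
     \<ge> (real (n - 1) / (real M * real p)) ^ k * (1 / 9)"
    using 1 2 by (intro mult_mono) auto
  finally show ?thesis by (simp add: k_def)
qed

text \<open>The uniform distribution on \<open>{\<alpha>..<\<beta>}\<close>.\<close>

definition interval_measure :: "real \<Rightarrow> real \<Rightarrow> real measure" where
  "interval_measure \<alpha> \<beta> = uniform_measure lborel {\<alpha>..<\<beta>}"

lemma prob_space_interval_measure: "\<alpha> < \<beta> \<Longrightarrow> prob_space (interval_measure \<alpha> \<beta>)"
  unfolding interval_measure_def by (intro prob_space_uniform_measure) auto

lemma sets_interval_measure [simp]: "sets (interval_measure \<alpha> \<beta>) = sets borel"
  by (simp add: interval_measure_def)

lemma space_interval_measure [simp]: "space (interval_measure \<alpha> \<beta>) = UNIV"
  by (simp add: interval_measure_def)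

lemma measure_interval_measure:
  assumes "\<alpha> < \<beta>" "A \<in> sets borel"
  shows "measure (interval_measure \<alpha> \<beta>) A = measure lborel ({\<alpha>..<\<beta>} \<inter> A) / (\<beta> - \<alpha>)"
  unfolding interval_measure_def using assms by (subst measure_uniform_measure) auto

lemma sets_residue_pattern:
  fixes n d :: nat and e c :: "nat \<Rightarrow> nat"
  shows
  "{a \<in> space borel. \<forall>i<n. nat \<lfloor>(a::real) ^ e i\<rfloor> mod d = c i} \<in> sets borel"
  by measurable

lemma exp_cubic_dominates:
  fixes c C :: real assumes "c > 0" "C > 0"
  shows "\<forall>\<^sub>F j in sequentially. 48 * exp (ln 2 * (10 * real j ^ 2 + 32 * real j)) \<le> exp (c * real j ^ 3)"
   "\<forall>\<^sub>F j in sequentially. C * exp (ln 2 * real j) \<le> exp (c * real j ^ 3)"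
  using assms by real_asymp+

text \<open>With the gap \<open>j ^ 3\<close> the error \<open>d / \<alpha> ^ (j ^ 3)\<close> is negligible even for moduli \<open>d\<close> as large as
  \<open>2 ^ O(j ^ 2)\<close>.\<close>

lemma interval_measure_residues:
  assumes "1 < \<alpha>" "\<alpha> < \<beta>"
  shows "\<forall>\<^sub>F j in sequentially. \<forall>g d n e c. j ^ 3 \<le> g \<longrightarrow> (\<forall>i. e i = g + (i + 1) * j ^ 3) \<longrightarrow>
     n \<le> 2 ^ j \<longrightarrow> 1 \<le> d \<longrightarrow> d \<le> (8 * 2 ^ j) ^ (10 * j) \<longrightarrow>
     measure (interval_measure \<alpha> \<beta>) {a. \<forall>i<n. nat \<lfloor>a ^ e i\<rfloor> mod d = c i} \<le> (1 + 1 / 2 ^ j) / real d ^ n"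
proof -
  define c0 where "c0 = ln \<alpha>"
  have c0: "c0 > 0" using assms by (simp add: c0_def)
  have C: "16 * \<alpha> / (\<beta> - \<alpha>) > 0" using assms by simp
  show ?thesis
    using exp_cubic_dominates(1)[OF c0 C] exp_cubic_dominates(2)[OF c0 C] exp_cubic_dominates(2)[OF c0, of 2, simplified] eventually_ge_at_top[of 1]
  proof eventually_elim
    case (elim j)
    define G where "G = j ^ 3"
    have aG: "\<alpha> ^ G = exp (c0 * real j ^ 3)"
    proof -
      have "\<alpha> ^ G = exp (real G * ln \<alpha>)" using assms by (simp add: exp_of_nat_mult)
      then show ?thesis by (simp add: G_def c0_def mult.commute)
    qed
    have k: "exp (ln 2 * real j) = 2 ^ j" by (simp add: mult.commute exp_of_nat_mult)
    have K1: "(2::real) ^ j \<ge> 1" by simp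
    show ?case
    proof (intro allI impI)
      fix g d n :: nat and e c :: "nat \<Rightarrow> nat"
      assume g: "j ^ 3 \<le> g" and e: "\<forall>i. e i = g + (i + 1) * j ^ 3" and n: "n \<le> 2 ^ j"
        and d: "1 \<le> d" "d \<le> (8 * 2 ^ j) ^ (10 * j)"
      have g1: "g \<ge> 1" using g elim by (meson le_trans one_le_power)
      have aG2: "\<alpha> ^ G \<ge> 2" using elim(3) k K1 unfolding aG by linarith
      have ag: "\<alpha> ^ g \<ge> \<alpha> ^ G" using assms g by (intro power_increasing) (auto simp: G_def)
      then have ag2: "\<alpha> ^ g \<ge> 2" using aG2 by linarith
      define t where "t = 12 * real d / \<alpha> ^ G"
      define v where "v = 4 * \<alpha> / \<alpha> ^ g / (\<beta> - \<alpha>)"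
      have "measure lborel {a \<in> {\<alpha>..<\<beta>}. \<forall>i<n. nat \<lfloor>a ^ e i\<rfloor> mod d = c i}
         \<le> ((1 + t) / real d) ^ n * (\<beta> - \<alpha> + 4 * \<alpha> / \<alpha> ^ g)"
        unfolding t_def using assms g1 aG2 ag2 d e g
        by (intro interval_residues_measure_le) (auto simp: G_def)
      then have "measure lborel {a \<in> {\<alpha>..<\<beta>}. \<forall>i<n. nat \<lfloor>a ^ e i\<rfloor> mod d = c i} / (\<beta> - \<alpha>)
         \<le> ((1 + t) / real d) ^ n * (\<beta> - \<alpha> + 4 * \<alpha> / \<alpha> ^ g) / (\<beta> - \<alpha>)"
        using assms by (intro divide_right_mono) auto
      also have "\<dots> = (1 + t) ^ n * (1 + v) / real d ^ n"
        using assms by (simp add: v_def power_divide field_simps)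
      also have "\<dots> \<le> (1 + 1 / 2 ^ j) / real d ^ n"
      proof (intro divide_right_mono)
        have t0: "t \<ge> 0" "v \<ge> 0" using assms by (auto simp: t_def v_def)
        have "real d \<le> real ((8 * 2 ^ j) ^ (10 * j))" using d(2) by (rule of_nat_mono)
        also have "\<dots> = exp (ln 2 * (real j + 3)) ^ (10 * j)"
        proof -
          have "exp (ln 2 * (real j + 3)) = 8 * 2 ^ j"
            by (simp add: distrib_left exp_add k exp_of_nat_mult[of 3, simplified] mult.commute[of "ln 2" 3])
          then show ?thesis by simp
        qed
        also have "\<dots> = exp (ln 2 * (10 * real j ^ 2 + 30 * real j))"
          by (simp add: power2_eq_square algebra_simps flip: exp_of_nat_mult)
        finally have "48 * real d * (2 ^ j * 2 ^ j) \<le> 48 * exp (ln 2 * (10 * real j ^ 2 + 30 * real j)) * (2 ^ j * 2 ^ j)"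
          by (intro mult_right_mono) auto
        also have "\<dots> = 48 * exp (ln 2 * (10 * real j ^ 2 + 32 * real j))"
          by (simp add: algebra_simps flip: k exp_add)
        also have "\<dots> \<le> \<alpha> ^ G" using elim(1) by (simp add: aG)
        finally have "48 * real d * (2 ^ j * 2 ^ j) \<le> \<alpha> ^ G" .
        then have t1: "t * 2 ^ j * 2 ^ j \<le> 1 / 4" using assms aG2 by (simp add: t_def field_simps)
        have "real n \<le> real (2 ^ j)" using n by (rule of_nat_mono)
        then have "real n * t \<le> 2 ^ j * t" using t0 by (intro mult_right_mono) auto
        also have "\<dots> \<le> 1 / 4 / 2 ^ j" using t1 by (simp add: field_simps)
        finally have nt: "real n * t \<le> 1 / 4 / 2 ^ j" .
        have "v \<le> 4 * \<alpha> / \<alpha> ^ G / (\<beta> - \<alpha>)"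
          unfolding v_def using assms ag aG2 by (intro divide_right_mono divide_left_mono) auto
        also have "\<dots> \<le> 1 / 4 / 2 ^ j"
          using elim(2) assms aG2 unfolding k aG[symmetric] by (simp add: field_simps)
        finally have v1: "v \<le> 1 / 4 / 2 ^ j" .
        have "(1 + t) ^ n * (1 + v) \<le> exp t ^ n * exp v"
          using t0 by (intro mult_mono power_mono) (auto simp: add.commute exp_ge_add_one_self)
        also have "\<dots> = exp (real n * t + v)" by (simp add: exp_add exp_of_nat_mult)
        also have "\<dots> \<le> exp (1 / 2 / 2 ^ j)" using nt v1 by simp
        also have "\<dots> \<le> 1 + 1 / 2 ^ j"
        proof -
          define x where "x = (1 / 2 / 2 ^ j :: real)"
          have x: "0 \<le> x" "x \<le> 1 / 2" by (auto simp: x_def field_simps)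
          have "exp x \<le> 1 + x + x ^ 2" using x by (intro exp_bound) auto
          also have "x ^ 2 \<le> x" using x by (simp add: power2_eq_square mult_left_le)
          finally show ?thesis by (simp add: x_def)
        qed
        finally show "(1 + t) ^ n * (1 + v) \<le> 1 + 1 / 2 ^ j" .
      qed simp
      finally have "measure lborel {a \<in> {\<alpha>..<\<beta>}. \<forall>i<n. nat \<lfloor>a ^ e i\<rfloor> mod d = c i} / (\<beta> - \<alpha>) \<le> (1 + 1 / 2 ^ j) / real d ^ n" .
      moreover have "{a \<in> space borel. \<forall>i<n. nat \<lfloor>(a::real) ^ e i\<rfloor> mod d = c i} \<in> sets borel"
        by (rule sets_residue_pattern)
      ultimately show "measure (interval_measure \<alpha> \<beta>) {a. \<forall>i<n. nat \<lfloor>a ^ e i\<rfloor> mod d = c i} \<le> (1 + 1 / 2 ^ j) / real d ^ n"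
        using assms by (subst measure_interval_measure) (auto simp: Int_def conj_commute)
    qed
  qed
qed

section \<open>The construction for a power of two\<close>

lemma disjoint_blocks:
  fixes A :: "nat set"
  assumes "finite A" "k * s \<le> card A"
  shows "\<exists>R :: nat \<Rightarrow> nat set. (\<forall>i<k. R i \<subseteq> A \<and> card (R i) = s) \<and> (\<forall>i<k. \<forall>j<k. i \<noteq> j \<longrightarrow> R i \<inter> R j = {})"
proof -
  obtain f where f: "bij_betw f {..<card A} A" using ex_bij_betw_nat_finite[OF assms(1)] by (auto simp: atLeast0LessThan)
  define R where "R i = f ` {i * s..<(i + 1) * s}" for i
  have sub: "{i * s..<(i + 1) * s} \<subseteq> {..<card A}" if "i < k" for i
  proof
    fix x assume x: "x \<in> {i * s..<(i + 1) * s}"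
    have "(i + 1) * s \<le> k * s" using that by (intro mult_right_mono) auto
    then show "x \<in> {..<card A}" using x assms(2) by auto
  qed
  have inj: "inj_on f {..<card A}" using f by (simp add: bij_betw_def)
  have "R i \<subseteq> A \<and> card (R i) = s" if "i < k" for i
  proof
    show "R i \<subseteq> A" using sub[OF that] f by (auto simp: R_def bij_betw_def)
    show "card (R i) = s" unfolding R_def using sub[OF that] inj by (subst card_image) (auto intro: inj_on_subset)
  qed
  moreover have "R i \<inter> R j = {}" if "i < k" "j < k" "i \<noteq> j" for i j
  proof -
    have "{i * s..<(i + 1) * s} \<inter> {j * s..<(j + 1) * s} = {}"
    proof (rule ccontr)
      assume "\<not> ?thesis"
      then obtain x where x: "i * s \<le> x" "x < (i + 1) * s" "j * s \<le> x" "x < (j + 1) * s"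
        by (metis Int_iff atLeastLessThan_iff ex_in_conv)
      then have "i * s < (j + 1) * s" "j * s < (i + 1) * s" by linarith+
      then have "i < j + 1" "j < i + 1" by (simp_all only: mult_less_cancel2)
      then show False using that(3) by linarith
    qed
    then show ?thesis unfolding R_def using inj sub[OF that(1)] sub[OF that(2)]
      by (subst inj_on_image_Int[OF inj, symmetric]) auto
  qed
  ultimately show ?thesis by blast
qed

text \<open>The classes \<open>{g + (i + 1) * G | i < n}\<close> with \<open>G \<le> g < 2 * G\<close> start at \<open>2 * G\<close> or later and
  miss at most \<open>3 * G\<close> exponents at the two ends. Every class leaves out its initial element \<open>g\<close>,
  which plays the part of the exponent of the initial cells.\<close>

lemma uncovered_exponents:
  fixes G K n :: nat
  assumes G: "G \<ge> 1" and n: "n = K div G - 2"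
  shows "card ({1..K} - (\<Union>g\<in>{G..<2 * G}. (\<lambda>i. g + (i + 1) * G) ` {..<n})) \<le> 3 * G"
proof -
  have "{1..K} - (\<Union>g\<in>{G..<2 * G}. (\<lambda>i. g + (i + 1) * G) ` {..<n}) \<subseteq> {..<2 * G} \<union> {G * (K div G)..<G * (K div G) + G}"
  proof
    fix k assume k: "k \<in> {1..K} - (\<Union>g\<in>{G..<2 * G}. (\<lambda>i. g + (i + 1) * G) ` {..<n})"
    have dm: "G * (k div G) + k mod G = k" "k mod G < G" using G by auto
    show "k \<in> {..<2 * G} \<union> {G * (K div G)..<G * (K div G) + G}"
    proof (rule ccontr)
      assume "\<not> ?thesis"
      then have k2: "k \<ge> 2 * G" "k < G * (K div G) \<or> k \<ge> G * (K div G) + G" by auto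
      have "K < G * (K div G) + G" using G by (metis dividend_less_div_times mult.commute add.commute less_le_trans zero_less_one)
      then have "k < G * (K div G)" using k2 k by auto
      then have lt: "k div G < K div G" using G by (simp add: div_less_iff_less_mult mult.commute)
      have "k div G \<ge> 2" using k2(1) G by (simp add: less_eq_div_iff_mult_less_eq)
      define i where "i = k div G - 2"
      have "i < n" using lt \<open>k div G \<ge> 2\<close> by (simp add: i_def n)
      moreover have "k = (G + k mod G) + (i + 1) * G"
      proof -
        have "k div G = i + 2" using \<open>k div G \<ge> 2\<close> by (simp add: i_def)
        then have "k = G * (i + 2) + k mod G" using dm by simp
        then show ?thesis by (simp add: algebra_simps)
      qed
      moreover have "G + k mod G \<in> {G..<2 * G}" using dm by auto
      ultimately show False using k by blast
    qed
  qed
  then have "card ({1..K} - (\<Union>g\<in>{G..<2 * G}. (\<lambda>i. g + (i + 1) * G) ` {..<n}))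
      \<le> card ({..<2 * G} \<union> {G * (K div G)..<G * (K div G) + G})" by (intro card_mono) auto
  also have "\<dots> \<le> card {..<2 * G} + card {G * (K div G)..<G * (K div G) + G}" by (rule card_Un_le)
  finally show ?thesis by simp
qed

text \<open>The bound for the logarithm of the modulus, as a sum of the contributions of the sieve primes,
  the blocks of large primes, and the private primes; every prime of the last two kinds has a
  logarithm of at most \<open>j + 3\<close>.\<close>

definition log_bound :: "nat \<Rightarrow> real" where
  "log_bound j = 2 powr (real j / 2) * real j + (2 ^ j * real j powr (-17/16) + (3 * real j ^ 3 + 178 * 2 ^ j * real j powr (-63/32))) * (real j + 3)"

lemma log_bound_smallo: "log_bound \<in> o(\<lambda>j. 2 ^ j)"
  unfolding log_bound_def[abs_def] by real_asymp

text \<open>The pair \<open>Q\<close>, \<open>b\<close> does what is required for \<open>K = 2 ^ j\<close> at the base \<open>a\<close>. The natural number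
  \<open>nat \<lfloor>a ^ k\<rfloor>\<close> agrees with \<open>\<lfloor>a ^ k\<rfloor>\<close> for \<open>a \<ge> 0\<close>.\<close>

definition good_modulus :: "real \<Rightarrow> nat \<Rightarrow> int \<Rightarrow> int \<Rightarrow> bool" where
  "good_modulus a j Q b \<longleftrightarrow> squarefree Q \<and> Q \<ge> 2 \<and> (\<forall>k\<in>{1..2 ^ j}. gcd (b - int (nat \<lfloor>a ^ k\<rfloor>)) Q > 1) \<and>
     (\<forall>p. prime p \<and> p dvd Q \<longrightarrow> p \<le> int (8 * 2 ^ j)) \<and> ln (real_of_int Q) \<le> log_bound j"

text \<open>The inequalities between the parameters that the construction needs, with
  \<open>2 ^ j / (2 * j ^ 3)\<close> in place of the class size and \<open>j powr (1/4)\<close> in place of \<open>M\<close>. The decisive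
  one compares \<open>2 ^ j\<close> times negative powers of \<open>j\<close> below \<open>-1\<close> with the number of large primes.\<close>

lemma scale_asymptotics:
  shows "\<forall>\<^sub>F j in sequentially. 2 * real j powr (1/4) \<le> 2 ^ j / (2 * real j ^ 3)"
    and "\<forall>\<^sub>F j in sequentially. 4 \<le> (2 ^ j / (2 * real j ^ 3) :: real)"
    and "\<forall>\<^sub>F j in sequentially. 2 \<le> (2 ^ j / (2 * real j ^ 3) / real j powr (17/16) :: real)"
    and "\<forall>\<^sub>F j in sequentially. 4 \<le> real j powr (1/4)"
    and "\<forall>\<^sub>F j in sequentially. 4 * real j powr (1/4) \<le> real j ^ 3"
    and "\<forall>\<^sub>F j in sequentially. 160 * real j powr (1/2) * real j \<le> real j ^ 3 / real j"
    and "\<forall>\<^sub>F j in sequentially. 9 * (16 * real j ^ 4) powr (real j powr (1/4)) \<le> 2 powr (real j / 8)"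
    and "\<forall>\<^sub>F j in sequentially. (real j ^ 5) powr (real j powr (1/4)) \<le> 2 powr (real j / 8)"
    and "\<forall>\<^sub>F j in sequentially. 10 * real j powr (5/4) \<le> 1 / real j * (2 ^ j / (4 * real j ^ 3 * real j powr (17/16))) * 2 powr (- real j / 8) * 2 powr (- real j / 8)"
    and "\<forall>\<^sub>F j in sequentially. real j powr (1/4) \<le> 1 / real j * (2 ^ j / (2 * real j ^ 3)) * 2 powr (- real j / 8) * 2 powr (- real j / 8)"
    and "\<forall>\<^sub>F j in sequentially. exp (- (real j powr (5/32)) / 64) \<le> 1 / real j"
    and "\<forall>\<^sub>F j in sequentially. 2 ^ j * real j powr (-17/16) + (3 * real j ^ 3 + 178 * 2 ^ j * real j powr (-63/32)) \<le> (8 * 2 ^ j - 1) / (real j + 3) - 2 ^ j / real j"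
    and "\<forall>\<^sub>F j in sequentially. real j ^ 3 * (2 * (2 ^ j) ^ 2 * (exp 5 * (real j + 3) ^ 4) / 2 ^ (10 * j)
   + ((4 * real j powr (1/4) * real j ^ 3 / (2 ^ j * 2 powr (- real j / 8)) + 16 * real j powr (1/4) * real j / 2 ^ j) * real j
      + (8 * real j ^ 3 * real j powr (17/16) / (2 ^ j * 2 powr (- real j / 8)) + 1 / 2 ^ j / (2 powr (- real j / 8)) ^ 2) * real j)) \<le> 2 powr (- real j / 4)"
    and "\<forall>\<^sub>F j in sequentially. real j ^ 3 * (real j / 2) < 2 powr ((real j - 1) / 2) - 1"
    and "\<forall>\<^sub>F j in sequentially. 2 powr (real j / 2) \<le> 2 ^ j / real j"
    and "\<forall>\<^sub>F j in sequentially. 4 * real j powr (1/4) \<le> 2 ^ j / real j"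
  by real_asymp+

lemma good_modulus_eventually:
  assumes "1 < \<alpha>" "\<alpha> < \<beta>"
  shows "\<forall>\<^sub>F j in sequentially. \<exists>N\<in>sets borel. measure (interval_measure \<alpha> \<beta>) N \<le> 2 powr (- real j / 4) \<and>
    (\<forall>a. a \<notin> N \<longrightarrow> (\<exists>Q b. good_modulus a j Q b))"
  using interval_measure_residues[OF assms] sieve_product_bounds scale_asymptotics
    eventually_ge_at_top[of 256]
proof eventually_elim
  case (elim j)
  \<comment> \<open>The class size is \<open>n\<close>, full bins have \<open>M\<close> elements, every class owns \<open>s\<close> large primes, and two
    members of a class may agree modulo fewer than \<open>h\<close> primes. With \<open>W \<le> x powr (-31/32)\<close> the
    expected number of selected bins at a survivor, about \<open>s * M / (4 * n * W)\<close>, is at least of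
    order \<open>x powr (-17/16 + 1/4 + 31/32) = x powr (5/32)\<close>, while the large primes cost only
    \<open>K * x powr (-1/16)\<close>. The number \<open>m\<close> is a common lower bound for \<open>prob_full\<close>, \<open>W ^ M\<close> and
    \<open>W ^ (M - 1)\<close>; it is a small power of \<open>1 / K\<close>, harmless against \<open>n\<close> and \<open>s\<close>.\<close>
  define x where "x = real j"
  define k where "k = (2 ^ j :: real)"
  define P where "P = interval_measure \<alpha> \<beta>"
  define G where "G = j ^ 3"
  define n where "n = 2 ^ j div G - 2"
  define M where "M = nat \<lfloor>x powr (1/4)\<rfloor>"
  define s where "s = nat \<lfloor>real n / x powr (17/16)\<rfloor>"
  define h where "h = 10 * j"
  define Q where "Q = {q::nat. prime q \<and> j ^ 3 < q \<and> q \<le> 2 ^ (j div 2)}"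
  define W where "W = (\<Prod>q\<in>Q. 1 - 1 / real q)"
  define m where "m = 2 powr (- x / 8)"
  define B :: nat where "B = 8 * 2 ^ j"
  define LP where "LP = {p::nat. prime p \<and> k / x < real p \<and> p \<le> B}"
  define \<epsilon> where "\<epsilon> = 16 * real M ^ 2 * real h / real (j ^ 3)"
  define bnd where "bnd = real n * W * (2 * exp (- (real s * real M / (4 * real n * W)) / 4) + 88 * (\<epsilon> + 1 / x))"
  define Gset where "Gset = {G..<2 * G}"
  define left where "left = 3 * x ^ 3 + real (card Gset) * bnd"
  have cG: "card Gset = G" by (simp add: Gset_def)
  have x: "x \<ge> 256" using elim(19) by (simp add: x_def)
  have k: "k \<ge> 1" by (simp add: k_def)
  have x3: "real G = x ^ 3" "real (j ^ 3) = x ^ 3" by (simp_all add: G_def x_def)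
  have G1: "G \<ge> 1" using elim(19) by (simp add: G_def)
  have Bk: "real B = 8 * k" by (simp add: B_def k_def)
  have n_upper: "real n \<le> k / x ^ 3"
  proof -
    have "real n \<le> real (2 ^ j div G)" by (simp add: n_def)
    also have "\<dots> \<le> real (2 ^ j) / real G" by (rule of_nat_div_le_of_nat)
    finally show ?thesis by (simp add: x3 k_def)
  qed
  have KG: "2 ^ j < G * (2 ^ j div G) + G"
  proof -
    have "G * (2 ^ j div G) + 2 ^ j mod G = (2 ^ j :: nat)" by simp
    moreover have "2 ^ j mod G < G" using G1 by simp
    ultimately show ?thesis by linarith
  qed
  have n_lower: "k / (2 * x ^ 3) \<le> real n - 1"
  proof -
    have "real (2 ^ j) < real (G * (2 ^ j div G) + G)" using KG by (rule of_nat_less_iff[THEN iffD2])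
    then have "k < x ^ 3 * (real (2 ^ j div G) + 1)" by (simp add: k_def x3(1)[symmetric] distrib_left)
    then have "k / x ^ 3 < real (2 ^ j div G) + 1" using x by (simp add: field_simps)
    moreover have "real n \<ge> real (2 ^ j div G) - 2" unfolding n_def by linarith
    moreover have "k / x ^ 3 = 2 * (k / (2 * x ^ 3))" by simp
    moreover have "4 \<le> k / (2 * x ^ 3)" unfolding x_def k_def by (rule elim(4))
    ultimately show ?thesis by linarith
  qed
  have kx: "k / (2 * x ^ 3) > 0" using x k by simp
  have n0: "real n > 0" using n_lower kx by linarith
  have px: "x powr c > 0" for c using x by simp
  have M_upper: "real M \<le> x powr (1/4)" unfolding M_def using px[of "1/4"] by linarith
  have M4: "x powr (1/4) \<ge> 4" unfolding x_def by (rule elim(6))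
  have M_lower: "x powr (1/4) / 2 \<le> real M" unfolding M_def using M4 by linarith
  have M2: "M \<ge> 2" using M_lower M4 by linarith
  have Mn: "2 * M \<le> n"
  proof -
    have "2 * x powr (1/4) \<le> k / (2 * x ^ 3)" unfolding x_def k_def by (rule elim(3))
    then have "real (2 * M) \<le> real n" using M_upper n_lower by simp
    then show ?thesis by (simp only: of_nat_le_iff)
  qed
  define v where "v = real n / x powr (17/16)"
  have s_v: "s = nat \<lfloor>v\<rfloor>" by (simp add: s_def v_def)
  have v_lower: "k / (2 * x ^ 3) / x powr (17/16) \<le> v"
    unfolding v_def using n_lower px[of "17/16"] by (intro divide_right_mono) auto
  moreover have "2 \<le> k / (2 * x ^ 3) / x powr (17/16)" unfolding x_def k_def by (rule elim(5))
  ultimately have s2: "2 \<le> v" by (rule order_trans[rotated])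
  have s_upper: "real s \<le> v" unfolding s_v using s2 by linarith
  have s_lower: "v / 2 \<le> real s" unfolding s_v using s2 by linarith
  have "real s \<ge> 1" using s_lower s2 by linarith
  then have s1: "s \<ge> 1" by simp
  have s_lower': "k / (4 * x ^ 3 * x powr (17/16)) \<le> real s"
  proof -
    have "k / (4 * x ^ 3 * x powr (17/16)) = k / (2 * x ^ 3) / x powr (17/16) / 2" by simp
    also have "\<dots> \<le> v / 2" using v_lower by (rule divide_right_mono) simp
    finally show ?thesis using s_lower by (rule order_trans)
  qed
  have hx: "real h = 10 * x" by (simp add: h_def x_def)
  have W: "1 / x ^ 5 \<le> W" "W \<le> x powr (-31/32)" using elim(2) unfolding W_def Q_def x_def by simp_all
  have "1 / x ^ 5 > 0" using x by simp
  then have W0: "W > 0" using W(1) by linarith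
  have "m \<le> 2 powr 0" unfolding m_def using x by (intro powr_mono) auto
  then have m0: "0 < m" "m \<le> 1" by (simp_all add: m_def)
  have x1: "x \<ge> 1" using x by simp
  have WM: "2 powr (- x / 8) \<le> W ^ M" "2 powr (- x / 8) \<le> W ^ (M - 1)"
  proof -
    have "x powr (-31/32) \<le> x powr 0" using x1 by (intro powr_mono) auto
    then have le1: "W \<le> 1" using W(2) x by simp
    have "(x ^ 5) ^ M = (x ^ 5) powr real M" using x by (simp add: powr_realpow)
    also have "\<dots> \<le> (x ^ 5) powr (x powr (1/4))" using M_upper x1 by (intro powr_mono) auto
    also have "\<dots> \<le> 2 powr (x / 8)" unfolding x_def by (rule elim(10))
    finally have "1 / 2 powr (x / 8) \<le> 1 / (x ^ 5) ^ M" using x by (intro divide_left_mono) auto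
    also have "\<dots> = (1 / x ^ 5) ^ M" by (simp add: power_divide)
    also have "\<dots> \<le> W ^ M" using W(1) x by (intro power_mono) auto
    finally show 1: "2 powr (- x / 8) \<le> W ^ M" by (simp add: powr_minus_divide)
    also have "W ^ M \<le> W ^ (M - 1)" using W0 le1 by (intro power_decreasing) auto
    finally show "2 powr (- x / 8) \<le> W ^ (M - 1)" .
  qed
  have M_sq: "real M ^ 2 \<le> x powr (1/2)"
  proof -
    have "real M ^ 2 \<le> (x powr (1/4)) ^ 2" using M_upper by (intro power_mono) auto
    also have "\<dots> = x powr (1/2)" using x by (simp add: powr_power)
    finally show ?thesis .
  qed
  have Mh: "16 * real M ^ 2 * real h \<le> x ^ 3 / x"
  proof -
    have "16 * real M ^ 2 * real h \<le> 16 * x powr (1/2) * (10 * x)"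
      unfolding hx using M_sq x by (intro mult_right_mono mult_left_mono) auto
    also have "\<dots> \<le> x ^ 3 / x" using elim(8) unfolding x_def by simp
    finally show ?thesis .
  qed
  have eps: "0 \<le> \<epsilon>" "\<epsilon> \<le> 1 / x"
  proof -
    show "0 \<le> \<epsilon>" by (simp add: \<epsilon>_def)
    have "\<epsilon> \<le> (x ^ 3 / x) / x ^ 3" unfolding \<epsilon>_def x3 using Mh x by (intro divide_right_mono) auto
    also have "\<dots> = 1 / x" using x by simp
    finally show "\<epsilon> \<le> 1 / x" .
  qed
  \<comment> \<open>Since \<open>n\<close> is about \<open>K / x ^ 3\<close> and \<open>p \<le> 8 * K\<close>, the probability is at least about
    \<open>(16 * x ^ 4) powr (- M)\<close>, and \<open>M * log x\<close> is \<open>o(x)\<close>.\<close>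
  have fullp: "m \<le> prob_full M n p" if p: "k / x < real p" "p \<le> B" for p
  proof -
    have "x ^ 3 \<ge> x" using x1 self_le_power[of x 3] by simp
    then have "k / x ^ 3 \<le> k / x" using k x by (intro divide_left_mono) auto
    then have np: "n \<le> p" using n_upper p by linarith
    have p0: "real p > 0" using np n0 by linarith
    have "1 / (16 * x ^ 4) \<le> real (n - 1) / (real M * real p)"
    proof -
      have "real M * real p \<le> x * (8 * k)"
      proof (intro mult_mono)
        have "x powr (1/4) \<le> x powr 1" using x1 by (intro powr_mono) auto
        then show "real M \<le> x" using M_upper x by simp
        show "real p \<le> 8 * k" using of_nat_mono[OF p(2), where 'a = real] Bk by simp
      qed (use x in auto)
      then have "k / (2 * x ^ 3) / (x * (8 * k)) \<le> real (n - 1) / (real M * real p)"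
        using n_lower kx p0 M2 n0 by (intro frac_le) (auto simp: of_nat_diff)
      moreover have "k / (2 * x ^ 3) / (x * (8 * k)) = 1 / (16 * x ^ 4)"
        using k x by (simp add: field_simps eval_nat_numeral)
      ultimately show ?thesis by simp
    qed
    then have "(1 / (16 * x ^ 4)) ^ (M - 1) \<le> (real (n - 1) / (real M * real p)) ^ (M - 1)"
      using x by (intro power_mono) auto
    moreover have "(1 / (16 * x ^ 4)) ^ M \<le> (1 / (16 * x ^ 4)) ^ (M - 1)"
    proof (rule power_decreasing)
      have "16 * x ^ 4 \<ge> 1" using x1 one_le_power[of x 4] by linarith
      then show "1 / (16 * x ^ 4) \<le> 1" using x by (subst divide_le_eq_1_pos) auto
    qed (use x in auto)
    moreover have "9 * m \<le> (1 / (16 * x ^ 4)) ^ M"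
    proof -
      have x4: "16 * x ^ 4 \<ge> 1" using x1 one_le_power[of x 4] by linarith
      have "(16 * x ^ 4) ^ M = (16 * x ^ 4) powr real M" using x by (simp add: powr_realpow)
      also have "\<dots> \<le> (16 * x ^ 4) powr (x powr (1/4))" using M_upper x4 by (intro powr_mono) auto
      finally have "9 * (16 * x ^ 4) ^ M \<le> 9 * (16 * x ^ 4) powr (x powr (1/4))" by simp
      also have "\<dots> \<le> 2 powr (x / 8)" unfolding x_def by (rule elim(9))
      finally have "9 * (16 * x ^ 4) ^ M \<le> 2 powr (x / 8)" .
      then show ?thesis using x by (simp add: m_def powr_minus_divide power_divide field_simps)
    qed
    moreover have "prob_full M n p \<ge> 1 / 9 * (real (n - 1) / (real M * real p)) ^ (M - 1)"
      using M2 Mn np by (intro prob_full_lower) auto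
    ultimately show ?thesis by linarith
  qed
  have bnd: "0 \<le> bnd" "real G * bnd \<le> 178 * k * x powr (-63/32)"
  proof -
    have "x powr (5/32) / 64 \<le> real s * real M / (4 * real n * W) / 4"
    proof -
      have "x powr (5/32) = x powr (-17/16) * x powr (1/4) * x powr (31/32)"
        by (simp flip: powr_add)
      then have "x powr (5/32) / 64 = (1 / (2 * x powr (17/16))) * (x powr (1/4) / 2) * (1 / x powr (-31/32)) / 16"
        by (simp add: powr_minus_divide)
      also have "\<dots> \<le> (real s / real n) * real M * (1 / W) / 16"
      proof (intro divide_right_mono mult_mono M_lower)
        show "1 / (2 * x powr (17/16)) \<le> real s / real n"
          using s_lower n0 px[of "17/16"] by (simp add: v_def field_simps)
        show "1 / x powr (-31/32) \<le> 1 / W" using W(2) W0 by (intro divide_left_mono mult_pos_pos px) auto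
      qed (use px W0 in auto)
      also have "\<dots> = real s * real M / (4 * real n * W) / 4" by simp
      finally show ?thesis .
    qed
    then have "exp (- (real s * real M / (4 * real n * W)) / 4) \<le> exp (- (x powr (5/32)) / 64)" by simp
    also have "\<dots> \<le> 1 / x" unfolding x_def by (rule elim(13))
    finally have ex: "exp (- (real s * real M / (4 * real n * W)) / 4) \<le> 1 / x" .
    show "0 \<le> bnd" unfolding bnd_def using W0 eps x
      by (intro mult_nonneg_nonneg add_nonneg_nonneg) auto
    have "2 * exp (- (real s * real M / (4 * real n * W)) / 4) + 88 * (\<epsilon> + 1 / x) \<le> 178 / x"
      using ex eps by simp
    then have "bnd \<le> real n * W * (178 / x)" unfolding bnd_def using W0 by (intro mult_left_mono) auto
    then have "real G * bnd \<le> real G * (real n * W * (178 / x))" by (intro mult_left_mono) auto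
    also have "\<dots> = (x ^ 3 * real n) * (W * (178 / x))" by (simp add: x3)
    also have "\<dots> \<le> k * (x powr (-31/32) * (178 / x))"
    proof (intro mult_mono W(2) order.refl)
      show "x ^ 3 * real n \<le> k" using n_upper x by (simp add: field_simps)
    qed (use W0 k x in auto)
    also have "\<dots> = 178 * k * (x powr (-31/32) * x powr (-1))" using x by (simp add: powr_minus_divide)
    also have "x powr (-31/32) * x powr (-1) = x powr (-63/32)" unfolding powr_add[symmetric] by simp
    finally show "real G * bnd \<le> 178 * k * x powr (-63/32)" .
  qed
  have Gs: "real G * real s \<le> k * x powr (-17/16)"
  proof -
    have "real G * real s \<le> x ^ 3 * (k / x ^ 3 / x powr (17/16))"
      unfolding x3(1)
    proof (intro mult_left_mono)
      have "v \<le> k / x ^ 3 / x powr (17/16)"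
        unfolding v_def using n_upper px[of "17/16"] by (intro divide_right_mono) auto
      then show "real s \<le> k / x ^ 3 / x powr (17/16)" using s_upper by (rule order_trans[rotated])
    qed (use x in auto)
    also have "\<dots> = k * x powr (-17/16)" using x by (simp add: powr_minus_divide)
    finally show ?thesis .
  qed
  have left: "left \<le> 3 * x ^ 3 + 178 * k * x powr (-63/32)" "left \<ge> 0"
    using bnd x by (auto simp: left_def cG)
  have finLP: "finite LP" unfolding LP_def by (rule finite_subset[of _ "{..B}"]) auto
  \<comment> \<open>There are enough large primes for all blocks and for the private primes.\<close>
  have cardLP: "real G * real s + left \<le> real (card LP)"
  proof -
    have B_pow: "B = 2 ^ (j + 3)" by (simp add: B_def power_add)
    have "{p::nat. prime p \<and> p \<le> B} \<subseteq> LP \<union> {1..nat \<lfloor>k / x\<rfloor>}"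
    proof
      fix p assume p: "p \<in> {p::nat. prime p \<and> p \<le> B}"
      show "p \<in> LP \<union> {1..nat \<lfloor>k / x\<rfloor>}"
      proof (cases "k / x < real p")
        case False
        then have "p \<le> nat \<lfloor>k / x\<rfloor>" by (simp add: le_nat_floor)
        moreover have "p \<ge> 1" using p prime_ge_1_nat by auto
        ultimately show ?thesis by simp
      qed (use p in \<open>simp add: LP_def\<close>)
    qed
    then have "card {p::nat. prime p \<and> p \<le> B} \<le> card (LP \<union> {1..nat \<lfloor>k / x\<rfloor>})" using finLP by (intro card_mono) auto
    also have "\<dots> \<le> card LP + nat \<lfloor>k / x\<rfloor>" using card_Un_le[of LP "{1..nat \<lfloor>k / x\<rfloor>}"] by simp
    finally have "real (card {p::nat. prime p \<and> p \<le> B}) \<le> real (card LP) + real (nat \<lfloor>k / x\<rfloor>)"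
      unfolding of_nat_add[symmetric] by (rule of_nat_mono)
    moreover have "real (nat \<lfloor>k / x\<rfloor>) \<le> k / x" using k x by simp
    moreover have "(8 * k - 1) / (x + 3) \<le> real (card {p::nat. prime p \<and> p \<le> B})"
      using prime_count_pow2_lower[of "j + 3"] by (simp add: B_pow power_add k_def x_def mult.commute)
    moreover have "k * x powr (-17/16) + (3 * x ^ 3 + 178 * k * x powr (-63/32)) \<le> (8 * k - 1) / (x + 3) - k / x"
      unfolding x_def k_def by (rule elim(14))
    ultimately show ?thesis using Gs left by linarith
  qed
  have "real (G * s) \<le> real (card LP)" using cardLP left by simp
  then have "G * s \<le> card LP" by (simp only: of_nat_le_iff)
  then obtain R0 where R0: "\<And>i. i < G \<Longrightarrow> R0 i \<subseteq> LP \<and> card (R0 i) = s"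
    "\<And>i i'. i < G \<Longrightarrow> i' < G \<Longrightarrow> i \<noteq> i' \<Longrightarrow> R0 i \<inter> R0 i' = {}"
    using disjoint_blocks[OF finLP] by meson
  define R where "R g = R0 (g - G)" for g
  have R: "R g \<subseteq> LP" "card (R g) = s" if "g \<in> Gset" for g
  proof -
    have "g - G < G" using that unfolding Gset_def atLeastLessThan_iff by linarith
    then show "R g \<subseteq> LP" "card (R g) = s" using R0(1)[of "g - G"] by (simp_all add: R_def)
  qed
  have Rdisj: "R g \<inter> R g' = {}" if "g \<in> Gset" "g' \<in> Gset" "g \<noteq> g'" for g g'
    unfolding R_def by (rule R0(2)) (use that in \<open>auto simp: Gset_def\<close>)
  define Fr where "Fr = LP - (\<Union>g\<in>Gset. R g)"
  have Fr: "left \<le> real (card Fr)"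
  proof -
    have "card (\<Union>g\<in>Gset. R g) \<le> (\<Sum>g\<in>Gset. card (R g))" by (rule card_UN_le) (simp add: Gset_def)
    also have "\<dots> = G * s" using R(2) cG by simp
    finally have cU: "card (\<Union>g\<in>Gset. R g) \<le> G * s" .
    have sub: "(\<Union>g\<in>Gset. R g) \<subseteq> LP" using R(1) by blast
    then have "card Fr = card LP - card (\<Union>g\<in>Gset. R g)"
      unfolding Fr_def using finLP finite_subset by (intro card_Diff_subset) blast+
    then have "card LP \<le> card Fr + G * s" using cU by linarith
    then have "real (card LP) \<le> real (card Fr) + real G * real s"
      unfolding of_nat_add[symmetric] of_nat_mult[symmetric] by (rule of_nat_mono)
    then show ?thesis using cardLP by linarith
  qed
  have Qlt: "real q \<le> k / x" if "q \<in> Q" for q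
  proof -
    have "real q \<le> real (2 ^ (j div 2))" using that by (intro of_nat_mono) (simp add: Q_def)
    also have "\<dots> = 2 powr (real (j div 2))" by (simp add: powr_realpow)
    also have "\<dots> \<le> 2 powr (x / 2)" by (simp add: x_def)
    also have "\<dots> \<le> k / x" unfolding x_def k_def by (rule elim(17))
    finally show ?thesis .
  qed
  have LPQ: "p \<notin> Q" if "p \<in> LP" for p using Qlt[of p] that by (auto simp: LP_def)
  have finQ: "finite Q" unfolding Q_def by (rule finite_subset[of _ "{..2 ^ (j div 2)}"]) auto
  have kB: "k / x \<le> real B" using k x by (simp add: Bk field_simps)
  \<comment> \<open>A sieve without primes would contradict the lower bound for the number of primes up to
    \<open>2 ^ (j div 2)\<close>.\<close>
  have Qne: "Q \<noteq> {}"
  proof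
    assume "Q = {}"
    define I where "I = j div 2"
    have "real j \<le> real (2 * I + 1)" "real (2 * I) \<le> real j"
      unfolding I_def by (rule of_nat_mono, linarith)+
    then have I: "real I \<le> x / 2" "(x - 1) / 2 \<le> real I" by (simp_all add: x_def)
    have "1 \<le> (x - 1) / 2" using x by simp
    then have "real I \<ge> 1" using I(2) by (rule order_trans)
    then have I1: "I \<ge> 1" by simp
    have "{q::nat. prime q \<and> q \<le> 2 ^ I} \<subseteq> {1..j ^ 3}"
      using \<open>Q = {}\<close> by (auto simp: Q_def I_def prime_ge_1_nat Suc_le_eq prime_gt_0_nat not_less)
    then have "card {q::nat. prime q \<and> q \<le> 2 ^ I} \<le> card {1..j ^ 3}" by (intro card_mono) auto
    then have "real (card {q::nat. prime q \<and> q \<le> 2 ^ I}) \<le> x ^ 3" by (simp add: x_def flip: of_nat_power)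
    then have "(2 ^ I - 1) / real I \<le> x ^ 3" using prime_count_pow2_lower[OF I1] by linarith
    then have "2 ^ I - 1 \<le> x ^ 3 * real I" using I1 by (simp add: field_simps)
    also have "\<dots> \<le> x ^ 3 * (x / 2)" using I x by (intro mult_left_mono) auto
    also have "\<dots> < 2 powr ((x - 1) / 2) - 1" unfolding x_def by (rule elim(16))
    also have "\<dots> \<le> 2 powr (real I) - 1" using I by simp
    finally show False by (simp add: powr_realpow)
  qed
  have P: "prob_space P" unfolding P_def using assms by (intro prob_space_interval_measure) auto
  have main: "\<exists>N\<in>sets P. measure P N \<le> real (card Gset) * (real n ^ 2 * (1 + 1 / k) * exp (2 * (\<Sum>q | prime q \<and> q \<le> B. 1 / real q)) / 2 ^ h
        + ((2 * real M / (real n * m) + 16 * real M / (k / x)) / (1 / x) + (2 / (real s * m) + 1 / k / m ^ 2) / (1 / x))) \<and>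
     (\<forall>a\<in>space P - N. \<exists>Q' b :: int. squarefree Q' \<and> Q' \<ge> 2 \<and>
        (\<forall>i\<in>{1..2 ^ j}. gcd (b - int (nat \<lfloor>a ^ i\<rfloor>)) Q' > 1) \<and> (\<forall>p. prime p \<and> p dvd Q' \<longrightarrow> p \<le> int B) \<and>
        ln (real_of_int Q') \<le> (\<Sum>q\<in>Q. ln (real q)) + (real (card Gset) * real s + left) * ln (real B))"
    unfolding left_def bnd_def W_def \<epsilon>_def
  proof (rule good_modulus_at_scale[where e = "\<lambda>g i. g + (i + 1) * G" and D = "B ^ h" and z = "j ^ 3" and Fr = Fr and R = R])
    show "prob_space P" by (rule P)
    show "(\<lambda>a. nat \<lfloor>a ^ i\<rfloor>) \<in> measurable P (count_space UNIV)" for i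
    proof -
      have "measurable P (count_space UNIV :: nat measure) = measurable borel (count_space UNIV)"
        by (rule measurable_cong_sets) (simp_all add: P_def)
      then show ?thesis using measurable_nat_floor_power[of i] by simp
    qed
    fix g d c assume g: "g \<in> Gset" and d: "1 \<le> d" "d \<le> B ^ h"
    have "n \<le> 2 ^ j" unfolding n_def using div_le_dividend[of "2 ^ j" G] by linarith
    moreover have "j ^ 3 \<le> g" using g by (simp add: Gset_def G_def)
    moreover have "d \<le> (8 * 2 ^ j) ^ (10 * j)" using d by (simp add: B_def h_def)
    ultimately have "measure P {a. \<forall>i<n. nat \<lfloor>a ^ (g + (i + 1) * G)\<rfloor> mod d = c i} \<le> (1 + 1 / 2 ^ j) / real d ^ n"
      using elim(1)[rule_format, of g "\<lambda>i. g + (i + 1) * G" n d c] d(1) by (simp add: G_def P_def)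
    then show "measure P {a \<in> space P. \<forall>i<n. nat \<lfloor>a ^ (g + (i + 1) * G)\<rfloor> mod d = c i} \<le> (1 + 1 / k) / real d ^ n"
      by (simp add: P_def k_def)
  next
    show "real (card ({1..2 ^ j} - (\<Union>g\<in>Gset. (\<lambda>i. g + (i + 1) * G) ` {..<n}))) \<le> 3 * x ^ 3"
      using of_nat_mono[OF uncovered_exponents[OF G1 n_def], where 'a = real] unfolding Gset_def x3(1)[symmetric]
      by simp
    show "prime q \<and> j ^ 3 < q \<and> q \<le> B" if "q \<in> Q" for q
    proof -
      have "real q \<le> real B" using Qlt[OF that] kB by (rule order_trans)
      then show ?thesis using that by (simp add: Q_def)
    qed
    show "prime p \<and> p \<le> B \<and> 4 * M \<le> p \<and> k / x \<le> real p \<and> p \<notin> Q" if "g \<in> Gset" "p \<in> R g" for g p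
    proof -
      have p: "p \<in> LP" using R(1) that by auto
      have "4 * x powr (1/4) \<le> k / x" unfolding x_def k_def by (rule elim(18))
      then have "real (4 * M) \<le> real p" using p M_upper by (simp add: LP_def)
      then show ?thesis using p LPQ by (auto simp: LP_def)
    qed
    show "\<And>p. p \<in> Fr \<Longrightarrow> prime p \<and> p \<le> B \<and> p \<notin> Q \<and> (\<forall>g\<in>Gset. p \<notin> R g)"
      using LPQ by (auto simp: Fr_def LP_def)
    show "finite Fr" using finLP by (simp add: Fr_def)
    show "m \<le> prob_full M n p" if "g \<in> Gset" "p \<in> R g" for g p
      using R(1)[OF that(1)] that(2) by (intro fullp) (auto simp: LP_def)
    show "4 * M \<le> j ^ 3"
    proof -
      have "4 * x powr (1/4) \<le> x ^ 3" unfolding x_def by (rule elim(7))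
      then have "real (4 * M) \<le> real (j ^ 3)" using M_upper x3 by simp
      then show ?thesis by (simp only: of_nat_le_iff)
    qed
    show "8 * real M ^ 2 * real h \<le> real (j ^ 3)"
    proof -
      have "8 * real M ^ 2 * real h \<le> 16 * real M ^ 2 * real h" by (intro mult_right_mono) auto
      also have "\<dots> \<le> x ^ 3 / x" by (rule Mh)
      also have "\<dots> \<le> x ^ 3" using x1 by (simp add: field_simps mult_left_mono)
      finally show ?thesis by (simp only: x3)
    qed
    show "16 * real M ^ 2 * real h / real (j ^ 3) + 1 / x \<le> 1"
    proof -
      have "1 / x \<le> 1 / 2" using x by (intro divide_left_mono) auto
      then show ?thesis using eps unfolding \<epsilon>_def by linarith
    qed
    show "real M * real h \<le> 1 / x * real s * m * (\<Prod>q\<in>Q. 1 - 1 / real q) ^ (M - 1)"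
    proof -
      have "real M * real h \<le> x powr (1/4) * (10 * x powr 1)" unfolding hx using M_upper x by (intro mult_mono) auto
      also have "\<dots> = 10 * (x powr (1/4) * x powr 1)" by simp
      also have "x powr (1/4) * x powr 1 = x powr (5/4)" unfolding powr_add[symmetric] by simp
      also have "10 * x powr (5/4) \<le> 1 / x * (k / (4 * x ^ 3 * x powr (17/16))) * 2 powr (- x / 8) * 2 powr (- x / 8)"
        unfolding x_def k_def by (rule elim(11))
      also have "\<dots> \<le> 1 / x * real s * m * W ^ (M - 1)"
        unfolding m_def using s_lower' WM x k W0 by (intro mult_mono) auto
      finally show ?thesis by (simp add: W_def)
    qed
    show "real M \<le> 1 / x * real n * m * (\<Prod>q\<in>Q. 1 - 1 / real q) ^ M"
    proof -
      have "x powr (1/4) \<le> 1 / x * (k / (2 * x ^ 3)) * 2 powr (- x / 8) * 2 powr (- x / 8)"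
        unfolding x_def k_def by (rule elim(12))
      also have "\<dots> \<le> 1 / x * real n * m * W ^ M"
        unfolding m_def using n_lower WM x k W0 by (intro mult_mono) auto
      finally show ?thesis using M_upper by (simp add: W_def)
    qed
    show "3 * x ^ 3 + real (card Gset) * (real n * (\<Prod>q\<in>Q. 1 - 1 / real q) *
        (2 * exp (- (real s * real M / (4 * real n * (\<Prod>q\<in>Q. 1 - 1 / real q))) / 4) +
         88 * (16 * real M ^ 2 * real h / real (j ^ 3) + 1 / x))) \<le> real (card Fr)"
      using Fr unfolding left_def bnd_def W_def \<epsilon>_def .
    show "B ^ h \<le> B ^ h" "finite Gset" by (simp_all add: Gset_def)
    show "2 \<le> h" "1 \<le> B" "1 \<le> j ^ 3" using elim(19) by (simp_all add: h_def B_def)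
    show "0 \<le> 1 / k" "1 / k \<le> 1" "0 < 1 / x" "0 < k / x" using k x by simp_all
    show "\<And>g. g \<in> Gset \<Longrightarrow> card (R g) = s" by (rule R(2))
    show "\<And>g g'. g \<in> Gset \<Longrightarrow> g' \<in> Gset \<Longrightarrow> g \<noteq> g' \<Longrightarrow> R g \<inter> R g' = {}" by (rule Rdisj)
  qed (fact finQ Qne s1 M2 Mn m0)+
  then obtain N where N: "N \<in> sets P" "measure P N \<le> real (card Gset) * (real n ^ 2 * (1 + 1 / k) * exp (2 * (\<Sum>q | prime q \<and> q \<le> B. 1 / real q)) / 2 ^ h
        + ((2 * real M / (real n * m) + 16 * real M / (k / x)) / (1 / x) + (2 / (real s * m) + 1 / k / m ^ 2) / (1 / x)))"
    "\<And>a. a \<in> space P - N \<Longrightarrow> \<exists>Q' b :: int. squarefree Q' \<and> Q' \<ge> 2 \<and>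
        (\<forall>i\<in>{1..2 ^ j}. gcd (b - int (nat \<lfloor>a ^ i\<rfloor>)) Q' > 1) \<and> (\<forall>p. prime p \<and> p dvd Q' \<longrightarrow> p \<le> int B) \<and>
        ln (real_of_int Q') \<le> (\<Sum>q\<in>Q. ln (real q)) + (real (card Gset) * real s + left) * ln (real B)"
    by blast
  have "measure P N \<le> 2 powr (- real j / 4)"
  proof -
    have E: "exp (2 * (\<Sum>q | prime q \<and> q \<le> B. 1 / real q)) \<le> exp 5 * (x + 3) ^ 4"
    proof -
      have "(\<Sum>q | prime q \<and> q \<le> B. 1 / real q) \<le> 1 / 2 + 2 * harm (j + 2)"
        using sum_inverse_primes_pow2_upper[of "j + 3"] by (simp add: B_def power_add mult.commute)
      also have "harm (j + 2) \<le> 1 + ln (real (j + 2))" by (intro harm_upper) simp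
      also have "ln (real (j + 2)) \<le> ln (x + 3)" by (simp add: x_def)
      finally have "2 * (\<Sum>q | prime q \<and> q \<le> B. 1 / real q) \<le> 5 + 4 * ln (x + 3)" by simp
      then have "exp (2 * (\<Sum>q | prime q \<and> q \<le> B. 1 / real q)) \<le> exp (5 + 4 * ln (x + 3))" by simp
      also have "\<dots> = exp 5 * (x + 3) ^ 4" using x exp_of_nat_mult[of 4 "ln (x + 3)"] by (simp add: exp_add)
      finally show ?thesis .
    qed
    have t1: "real n ^ 2 * (1 + 1 / k) * exp (2 * (\<Sum>q | prime q \<and> q \<le> B. 1 / real q)) / 2 ^ h
        \<le> 2 * k ^ 2 * (exp 5 * (x + 3) ^ 4) / 2 ^ (10 * j)"
    proof -
      have "1 \<le> x ^ 3" using x1 by (rule one_le_power)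
      then have "k / x ^ 3 \<le> k / 1" using k x by (intro divide_left_mono) auto
      then have "real n \<le> k" using n_upper by simp
      then have "real n ^ 2 \<le> k ^ 2" by (intro power_mono) auto
      moreover have "1 + 1 / k \<le> 2" using k by simp
      ultimately have "real n ^ 2 * (1 + 1 / k) \<le> k ^ 2 * 2" using k by (intro mult_mono) auto
      then have "real n ^ 2 * (1 + 1 / k) * exp (2 * (\<Sum>q | prime q \<and> q \<le> B. 1 / real q)) \<le> (k ^ 2 * 2) * (exp 5 * (x + 3) ^ 4)"
        by (rule mult_mono) (use E k in auto)
      then show ?thesis by (simp add: h_def divide_right_mono mult_ac)
    qed
    have t2: "(2 * real M / (real n * m) + 16 * real M / (k / x)) / (1 / x)
        \<le> (4 * x powr (1/4) * x ^ 3 / (k * m) + 16 * x powr (1/4) * x / k) * x"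
    proof -
      have "2 * real M / (real n * m) \<le> 2 * x powr (1/4) / (k / (2 * x ^ 3) * m)"
        using M_upper n_lower kx m0 by (intro frac_le mult_right_mono mult_pos_pos) auto
      moreover have "16 * real M / (k / x) \<le> 16 * x powr (1/4) / (k / x)"
        using M_upper k x by (intro divide_right_mono) auto
      ultimately have "2 * real M / (real n * m) + 16 * real M / (k / x)
         \<le> 4 * x powr (1/4) * x ^ 3 / (k * m) + 16 * x powr (1/4) * x / k" by (simp add: mult_ac)
      then show ?thesis using x by (simp add: mult_right_mono)
    qed
    have t3: "(2 / (real s * m) + 1 / k / m ^ 2) / (1 / x) \<le> (8 * x ^ 3 * x powr (17/16) / (k * m) + 1 / k / m ^ 2) * x"
    proof -
      have "2 / (real s * m) \<le> 2 / (k / (4 * x ^ 3 * x powr (17/16)) * m)"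
        using s_lower' s1 m0 k x by (intro divide_left_mono mult_right_mono mult_pos_pos divide_pos_pos) auto
      then have "2 / (real s * m) \<le> 8 * x ^ 3 * x powr (17/16) / (k * m)" by (simp add: mult_ac)
      then show ?thesis using x by (simp add: mult_right_mono)
    qed
    have "measure P N \<le> x ^ 3 * (2 * k ^ 2 * (exp 5 * (x + 3) ^ 4) / 2 ^ (10 * j)
      + ((4 * x powr (1/4) * x ^ 3 / (k * m) + 16 * x powr (1/4) * x / k) * x
        + (8 * x ^ 3 * x powr (17/16) / (k * m) + 1 / k / m ^ 2) * x))"
      using N(2) unfolding cG x3(1)
      by (rule order_trans) (use t1 t2 t3 x in \<open>intro mult_left_mono add_mono; simp\<close>)
    also have "\<dots> \<le> 2 powr (- real j / 4)" unfolding m_def x_def k_def by (rule elim(15))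
    finally show ?thesis .
  qed
  moreover have "\<exists>Q b :: int. squarefree Q \<and> Q \<ge> 2 \<and> (\<forall>k\<in>{1..2 ^ j}. gcd (b - int (nat \<lfloor>a ^ k\<rfloor>)) Q > 1) \<and>
       (\<forall>p. prime p \<and> p dvd Q \<longrightarrow> p \<le> int (8 * 2 ^ j)) \<and> ln (real_of_int Q) \<le> log_bound j" if a: "a \<notin> N" for a
  proof -
    have "(\<Sum>q\<in>Q. ln (real q)) + (real (card Gset) * real s + left) * ln (real B) \<le> log_bound j"
    proof -
      have Yx: "real (2 ^ (j div 2)) \<le> 2 powr (x / 2)"
      proof -
        have "real (2 ^ (j div 2)) = 2 powr (real (j div 2))" by (simp add: powr_realpow)
        also have "\<dots> \<le> 2 powr (x / 2)" by (simp add: x_def)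
        finally show ?thesis .
      qed
      have "(\<Sum>q\<in>Q. ln (real q)) \<le> (\<Sum>q\<in>Q. x)"
      proof (rule sum_mono)
        fix q assume q: "q \<in> Q"
        have q0: "q > 0" using q by (simp add: Q_def prime_gt_0_nat)
        have "real q \<le> real (2 ^ (j div 2))" using q by (intro of_nat_mono) (simp add: Q_def)
        then have "ln (real q) \<le> ln (2 ^ (j div 2))" using q0 by simp
        also have "\<dots> = real (j div 2) * ln 2" by (simp add: ln_realpow)
        also have "\<dots> \<le> x * 1" using ln_2_less_1 by (intro mult_mono) (auto simp: x_def)
        finally show "ln (real q) \<le> x" by simp
      qed
      also have "\<dots> = real (card Q) * x" by simp
      also have "\<dots> \<le> 2 powr (x / 2) * x"
      proof (intro mult_right_mono)
        have "card Q \<le> card {1..(2::nat) ^ (j div 2)}"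
          by (intro card_mono) (auto simp: Q_def)
        then have "card Q \<le> 2 ^ (j div 2)" by simp
        then have "real (card Q) \<le> real (2 ^ (j div 2))" by (rule of_nat_mono)
        then show "real (card Q) \<le> 2 powr (x / 2)" using Yx by linarith
      qed (use x in auto)
      finally have 1: "(\<Sum>q\<in>Q. ln (real q)) \<le> 2 powr (x / 2) * x" .
      have 2: "(real (card Gset) * real s + left) * ln (real B)
          \<le> (k * x powr (-17/16) + (3 * x ^ 3 + 178 * k * x powr (-63/32))) * (x + 3)"
      proof (intro mult_mono)
        show "real (card Gset) * real s + left \<le> k * x powr (-17/16) + (3 * x ^ 3 + 178 * k * x powr (-63/32))"
          using Gs left unfolding cG by linarith
        have "real B = 2 ^ (j + 3)" by (simp add: B_def power_add)
        then have "ln (real B) = (x + 3) * ln 2" by (simp add: ln_realpow x_def)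
        also have "\<dots> \<le> (x + 3) * 1" using ln_2_less_1 x by (intro mult_left_mono) auto
        finally show "ln (real B) \<le> x + 3" by simp
        show "0 \<le> ln (real B)" using k by (simp add: Bk)
        show "0 \<le> k * x powr (-17/16) + (3 * x ^ 3 + 178 * k * x powr (-63/32))" using k x by simp
      qed
      show ?thesis using 1 2 unfolding log_bound_def x_def k_def by linarith
    qed
    moreover obtain Q' b :: int where "squarefree Q' \<and> Q' \<ge> 2 \<and>
        (\<forall>i\<in>{1..2 ^ j}. gcd (b - int (nat \<lfloor>a ^ i\<rfloor>)) Q' > 1) \<and> (\<forall>p. prime p \<and> p dvd Q' \<longrightarrow> p \<le> int B) \<and>
        ln (real_of_int Q') \<le> (\<Sum>q\<in>Q. ln (real q)) + (real (card Gset) * real s + left) * ln (real B)"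
      using N(3)[of a] a by (auto simp: P_def)
    ultimately show ?thesis unfolding B_def by (meson order_trans)
  qed
  moreover have "N \<in> sets borel" using N(1) by (simp add: P_def)
  ultimately show ?case unfolding P_def good_modulus_def by blast
qed

section \<open>Almost every base\<close>

lemma summable_two_powr: "summable (\<lambda>j. 2 powr (- real j / 4))"
proof -
  have "(\<lambda>j. 2 powr (- real j / 4)) = (\<lambda>j. (2 powr (-1/4)) ^ j)"
    by (rule ext) (simp add: powr_powr flip: powr_realpow)
  then show ?thesis by (simp add: summable_geometric powr_less_one)
qed

text \<open>The Borel--Cantelli lemma over \<open>j\<close>.\<close>

lemma AE_interval_good_modulus:
  assumes "1 < \<alpha>" "\<alpha> < \<beta>"
  shows "AE a in lborel. a \<in> {\<alpha>..<\<beta>} \<longrightarrow> (\<forall>\<^sub>F j in sequentially. \<exists>Q b. good_modulus a j Q b)"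
proof -
  interpret prob_space "interval_measure \<alpha> \<beta>" using assms by (intro prob_space_interval_measure)
  obtain j0 where j0: "\<And>j. j \<ge> j0 \<Longrightarrow> \<exists>N\<in>sets borel. measure (interval_measure \<alpha> \<beta>) N \<le> 2 powr (- real j / 4) \<and>
      (\<forall>a. a \<notin> N \<longrightarrow> (\<exists>Q b. good_modulus a j Q b))"
    using good_modulus_eventually[OF assms] unfolding eventually_sequentially by blast
  define bad where "bad j N \<longleftrightarrow> N \<in> sets borel \<and> measure (interval_measure \<alpha> \<beta>) N \<le> 2 powr (- real j / 4) \<and>
      (\<forall>a. a \<notin> N \<longrightarrow> (\<exists>Q b. good_modulus a j Q b))" for j N
  define N where "N j = (if j \<ge> j0 then SOME N. bad j N else {})" for j
  have N: "bad j (N j)" if "j \<ge> j0" for j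
  proof -
    have "\<exists>N. bad j N" using j0[OF that] by (auto simp: bad_def)
    then show ?thesis using that by (simp add: N_def someI_ex)
  qed
  have sets_N: "N j \<in> sets (interval_measure \<alpha> \<beta>)" for j
    using N[of j] by (cases "j \<ge> j0") (auto simp: bad_def N_def)
  have "summable (\<lambda>j. measure (interval_measure \<alpha> \<beta>) (N j))"
  proof (rule summable_comparison_test'[OF summable_two_powr, of 0])
    fix j
    show "norm (measure (interval_measure \<alpha> \<beta>) (N j)) \<le> 2 powr (- real j / 4)"
      using N[of j] by (cases "j \<ge> j0") (auto simp: bad_def N_def)
  qed
  then have "AE a in interval_measure \<alpha> \<beta>. \<forall>\<^sub>F j in sequentially. a \<in> space (interval_measure \<alpha> \<beta>) - N j"
    using sets_N by (intro borel_cantelli_AE1) (auto simp: less_top[symmetric])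
  then have "AE a in interval_measure \<alpha> \<beta>. \<forall>\<^sub>F j in sequentially. \<exists>Q b. good_modulus a j Q b"
  proof (rule AE_mp, intro AE_I2 impI)
    fix a assume "\<forall>\<^sub>F j in sequentially. a \<in> space (interval_measure \<alpha> \<beta>) - N j"
    with eventually_ge_at_top[of j0] show "\<forall>\<^sub>F j in sequentially. \<exists>Q b. good_modulus a j Q b"
    proof eventually_elim
      case (elim j)
      then show ?case using N[of j] by (simp add: bad_def)
    qed
  qed
  moreover have "emeasure lborel {\<alpha>..<\<beta>} \<noteq> 0" "emeasure lborel {\<alpha>..<\<beta>} < \<infinity>" using assms by auto
  ultimately show ?thesis unfolding interval_measure_def by (subst (asm) AE_uniform_measure) auto
qed

lemma AE_good_modulus:
  "AE a in lebesgue. a > 1 \<longrightarrow> (\<forall>\<^sub>F j in sequentially. \<exists>Q b. good_modulus a j Q b)"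
proof -
  \<comment> \<open>These intervals exhaust all \<open>a > 1\<close> and stay away from \<open>1\<close>.\<close>
  have "AE a in lborel. \<forall>t::nat. a \<in> {1 + 1 / real (t + 1)..<real (t + 3)} \<longrightarrow> (\<forall>\<^sub>F j in sequentially. \<exists>Q b. good_modulus a j Q b)"
    unfolding AE_all_countable
  proof
    fix t :: nat
    have "1 / real (t + 1) \<le> 1" by simp
    then show "AE a in lborel. a \<in> {1 + 1 / real (t + 1)..<real (t + 3)} \<longrightarrow> (\<forall>\<^sub>F j in sequentially. \<exists>Q b. good_modulus a j Q b)"
      by (intro AE_interval_good_modulus) (simp, linarith)
  qed
  then have "AE a in lborel. a > 1 \<longrightarrow> (\<forall>\<^sub>F j in sequentially. \<exists>Q b. good_modulus a j Q b)"
  proof (rule AE_mp, intro AE_I2 impI)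
    fix a :: real
    assume *: "\<forall>t::nat. a \<in> {1 + 1 / real (t + 1)..<real (t + 3)} \<longrightarrow> (\<forall>\<^sub>F j in sequentially. \<exists>Q b. good_modulus a j Q b)" and a: "a > 1"
    obtain t1 :: nat where t1: "real t1 > 1 / (a - 1)" using reals_Archimedean2 by blast
    obtain t2 :: nat where t2: "real t2 > a" using reals_Archimedean2 by blast
    define t where "t = max t1 t2"
    have "1 / (a - 1) < real (t + 1)" using t1 by (simp add: t_def)
    then have "1 / real (t + 1) < a - 1" using a by (simp add: field_simps)
    moreover have "a < real (t + 3)" using t2 by (simp add: t_def)
    ultimately have "a \<in> {1 + 1 / real (t + 1)..<real (t + 3)}" by simp
    then show "\<forall>\<^sub>F j in sequentially. \<exists>Q b. good_modulus a j Q b" using * by blast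
  qed
  then show ?thesis by (rule AE_completion)
qed

theorem proposition5p1:
  "AE a :: real in lebesgue. a > 1 \<longrightarrow>
     (\<exists>(Q :: nat \<Rightarrow> int) (b :: nat \<Rightarrow> int).
        (\<exists>K0. \<forall>K\<ge>K0. (\<exists>j. K = 2 ^ j) \<longrightarrow>
           squarefree (Q K) \<and> Q K \<ge> 2 \<and>
           (\<forall>m\<in>{1..K}. gcd (b K - \<lfloor>a ^ m\<rfloor>) (Q K) > 1) \<and>
           (\<forall>p. prime p \<and> p dvd Q K \<longrightarrow> p \<le> 8 * int K)) \<and>
        (\<lambda>j. ln (real_of_int (Q (2 ^ j)))) \<in> o(\<lambda>j. real (2 ^ j)))"
  using AE_good_modulus
proof (rule AE_mp, intro AE_I2 impI)
  fix a :: real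
  assume "a > 1 \<longrightarrow> (\<forall>\<^sub>F j in sequentially. \<exists>Q b. good_modulus a j Q b)" and a: "a > 1"
  then obtain j0 where j0: "\<And>j. j \<ge> j0 \<Longrightarrow> \<exists>Q b. good_modulus a j Q b"
    by (auto simp: eventually_sequentially)
  define QB where "QB j = (SOME z. good_modulus a j (fst z) (snd z))" for j
  have QB: "good_modulus a j (fst (QB j)) (snd (QB j))" if "j \<ge> j0" for j
  proof -
    have "\<exists>z. good_modulus a j (fst z) (snd z)" using j0[OF that] by auto
    then show ?thesis unfolding QB_def by (rule someI_ex)
  qed
  \<comment> \<open>The modulus and the shift are indexed by \<open>K\<close>; at numbers that are no powers of two their values
    do not matter.\<close>
  define lg where "lg K = (THE j. K = 2 ^ j)" for K :: nat
  have lg: "lg (2 ^ j) = j" for j unfolding lg_def by (rule the_equality) auto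
  define Q where "Q K = fst (QB (lg K))" for K
  define b where "b K = snd (QB (lg K))" for K
  have good: "good_modulus a j (Q (2 ^ j)) (b (2 ^ j))" if "j \<ge> j0" for j
    using QB[OF that] by (simp add: Q_def b_def lg)
  have fl: "int (nat \<lfloor>a ^ k\<rfloor>) = \<lfloor>a ^ k\<rfloor>" for k using a by simp
  have "\<forall>K\<ge>2 ^ j0. (\<exists>j. K = 2 ^ j) \<longrightarrow>
           squarefree (Q K) \<and> Q K \<ge> 2 \<and>
           (\<forall>m\<in>{1..K}. gcd (b K - \<lfloor>a ^ m\<rfloor>) (Q K) > 1) \<and>
           (\<forall>p. prime p \<and> p dvd Q K \<longrightarrow> p \<le> 8 * int K)"
  proof (intro allI impI)
    fix K :: nat assume K: "K \<ge> 2 ^ j0" and "\<exists>j. K = 2 ^ j"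
    then obtain j where j: "K = 2 ^ j" by blast
    then have "j \<ge> j0" using K by simp
    then show "squarefree (Q K) \<and> Q K \<ge> 2 \<and>
           (\<forall>m\<in>{1..K}. gcd (b K - \<lfloor>a ^ m\<rfloor>) (Q K) > 1) \<and>
           (\<forall>p. prime p \<and> p dvd Q K \<longrightarrow> p \<le> 8 * int K)"
      using good[of j] unfolding j good_modulus_def fl by simp
  qed
  moreover have "(\<lambda>j. ln (real_of_int (Q (2 ^ j)))) \<in> o(\<lambda>j. real (2 ^ j))"
  proof -
    have "(\<lambda>j. ln (real_of_int (Q (2 ^ j)))) \<in> O(log_bound)"
    proof (rule bigoI[where c = 1])
      show "\<forall>\<^sub>F j in sequentially. norm (ln (real_of_int (Q (2 ^ j)))) \<le> 1 * norm (log_bound j)"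
        using eventually_ge_at_top[of j0]
      proof eventually_elim
        case (elim j)
        then have "2 \<le> Q (2 ^ j)" "ln (real_of_int (Q (2 ^ j))) \<le> log_bound j"
          using good[OF elim] by (auto simp: good_modulus_def)
        moreover have "0 \<le> ln (real_of_int (Q (2 ^ j)))" using calculation(1) by simp
        ultimately show ?case by simp
      qed
    qed
    moreover have "log_bound \<in> o(\<lambda>j. real (2 ^ j))"
      using log_bound_smallo by simp
    ultimately show ?thesis by (rule landau_o.big_small_trans)
  qed
  ultimately show "\<exists>(Q :: nat \<Rightarrow> int) (b :: nat \<Rightarrow> int).
        (\<exists>K0. \<forall>K\<ge>K0. (\<exists>j. K = 2 ^ j) \<longrightarrow>
           squarefree (Q K) \<and> Q K \<ge> 2 \<and>
           (\<forall>m\<in>{1..K}. gcd (b K - \<lfloor>a ^ m\<rfloor>) (Q K) > 1) \<and>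
           (\<forall>p. prime p \<and> p dvd Q K \<longrightarrow> p \<le> 8 * int K)) \<and>
        (\<lambda>j. ln (real_of_int (Q (2 ^ j)))) \<in> o(\<lambda>j. real (2 ^ j))"
    by blast
qed

end
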